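(* Let $n$ range over the even positive integers, and let $P=P_n$ be the following distributed relational problem. Alice receives $x\in\{0,1\}^n$; Bob receives $y,s\in\{0,1\}^n$ where $s$ has Hamming weight $|s|=n/2$. For every input, the referee must, with probability at least $1-\varepsilon$, output a triple $(i,x_i,y_i)$ for some $i\in\{1,\dots,n\}$ with $s_i=1$, and otherwise he must output ``don't know'' (so he never outputs anything other than such a correct triple or ``don't know''). With $\varepsilon=1/3$, as $n\to\infty$, $$R^{\parallel,pub}(P)=\Theta(\log n),\qquad R^{\parallel}(P)=\Theta(\sqrt n),\qquad Q^{\parallel}(P)=\Theta(\sqrt n).$$
   Context: Simultaneous message passing (SMP) model: Alice and Bob each hold their own input and each send a single message to a third party, the referee, who has no input and must produce the output from the two messages. There is no other communication. The cost of a protocol is the total length (in bits or qubits) of the two messages for a worst-case input; the complexity of a problem is the minimum cost of a protocol solving it. $R^{\parallel}(P)$: classical messages; each party has only private randomness. $R^{\parallel,pub}(P)$: classical messages; Alice and Bob additionally share a public random string, which the referee does not see. $Q^{\parallel}(P)$: quantum messages; the parties share neither a public coin nor entanglement. On inputs $x$ and $(y,s)$ Alice and Bob send (possibly mixed) states $\alpha_x$ and $\beta_{ys}$, and the referee applies a measurement (POVM) to $\alpha_x\otimes\beta_{ys}$ to obtain his output. In each case the error parameter is $\varepsilon=1/3$. *)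

theory Defs
  imports
    "HOL-Probability.Probability_Mass_Function"
    "HOL-Library.Landau_Symbols"
    "Jordan_Normal_Form.Matrix"
begin

section \<open>The relational problem\<close>

type_synonym bits = "bool list"

text \<open>A referee's output is \<open>None\<close> (``don't know'') or \<open>Some (i, a, b)\<close>. Bit positions are
  numbered \<open>0, \<dots>, n - 1\<close>.\<close>

type_synonym answer = "(nat \<times> bool \<times> bool) option"

definition hamming_weight :: "bits \<Rightarrow> nat" where
  "hamming_weight s = card {i. i < length s \<and> s ! i}"

definition alice_inputs :: "nat \<Rightarrow> bits set" where
  "alice_inputs n = {x. length x = n}"

definition bob_inputs :: "nat \<Rightarrow> (bits \<times> bits) set" where
  "bob_inputs n = {(y, s). length y = n \<and> length s = n \<and> 2 * hamming_weight s = n}"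

definition answers :: "nat \<Rightarrow> answer set" where
  "answers n = insert None (Some ` ({..<n} \<times> UNIV))"

fun correct_answers :: "bits \<Rightarrow> bits \<times> bits \<Rightarrow> answer set" where
  "correct_answers x (y, s) = {Some (i, x ! i, y ! i) | i. i < length x \<and> s ! i}"

text \<open>\<open>prob x ys z\<close> is the probability that the referee outputs \<open>z\<close> on the inputs \<open>x\<close> and \<open>ys\<close>.
  The error \<open>\<epsilon>\<close> only bounds the probability of ``don't know''; an incorrect triple must
  have probability exactly zero.\<close>

definition solves :: "real \<Rightarrow> nat \<Rightarrow> (bits \<Rightarrow> bits \<times> bits \<Rightarrow> answer \<Rightarrow> real) \<Rightarrow> bool" where
  "solves \<epsilon> n prob \<longleftrightarrow>
     (\<forall>x \<in> alice_inputs n. \<forall>ys \<in> bob_inputs n.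
        (\<Sum>z \<in> correct_answers x ys. prob x ys z) \<ge> 1 - \<epsilon> \<and>
        (\<forall>z \<in> answers n - insert None (correct_answers x ys). prob x ys z = 0))"


section \<open>Classical simultaneous message passing\<close>

text \<open>Private randomness is modelled by letting each party choose its message, and the referee
  its output, according to a discrete distribution.\<close>

definition private_output ::
  "(bits \<Rightarrow> bits pmf) \<Rightarrow> (bits \<times> bits \<Rightarrow> bits pmf) \<Rightarrow> (bits \<Rightarrow> bits \<Rightarrow> answer pmf) \<Rightarrow>
   bits \<Rightarrow> bits \<times> bits \<Rightarrow> answer pmf" where
  "private_output A B C x ys =
     bind_pmf (A x) (\<lambda>a. bind_pmf (B ys) (\<lambda>b. C a b))"

definition private_protocol :: "real \<Rightarrow> nat \<Rightarrow> nat \<Rightarrow> bool" where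
  "private_protocol \<epsilon> n c \<longleftrightarrow>
     (\<exists>A B C.
        (\<forall>x \<in> alice_inputs n. \<forall>ys \<in> bob_inputs n. \<forall>a \<in> set_pmf (A x). \<forall>b \<in> set_pmf (B ys).
           length a + length b \<le> c) \<and>
        (\<forall>a b. set_pmf (C a b) \<subseteq> answers n) \<and>
        solves \<epsilon> n (\<lambda>x ys. pmf (private_output A B C x ys)))"

text \<open>The shared random string \<open>r\<close> is seen by Alice and Bob but is not an argument of the
  referee \<open>C\<close>. Conditionally on \<open>r\<close>, all parties still have private randomness.\<close>

definition public_output ::
  "bits pmf \<Rightarrow> (bits \<Rightarrow> bits \<Rightarrow> bits pmf) \<Rightarrow> (bits \<Rightarrow> bits \<times> bits \<Rightarrow> bits pmf) \<Rightarrow>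
   (bits \<Rightarrow> bits \<Rightarrow> answer pmf) \<Rightarrow> bits \<Rightarrow> bits \<times> bits \<Rightarrow> answer pmf" where
  "public_output R A B C x ys =
     bind_pmf R (\<lambda>r. private_output (A r) (B r) C x ys)"

definition public_protocol :: "real \<Rightarrow> nat \<Rightarrow> nat \<Rightarrow> bool" where
  "public_protocol \<epsilon> n c \<longleftrightarrow>
     (\<exists>R A B C.
        (\<forall>r \<in> set_pmf R. \<forall>x \<in> alice_inputs n. \<forall>ys \<in> bob_inputs n.
           \<forall>a \<in> set_pmf (A r x). \<forall>b \<in> set_pmf (B r ys). length a + length b \<le> c) \<and>
        (\<forall>a b. set_pmf (C a b) \<subseteq> answers n) \<and>
        solves \<epsilon> n (\<lambda>x ys. pmf (public_output R A B C x ys)))"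

definition R_par :: "real \<Rightarrow> nat \<Rightarrow> nat" where
  "R_par \<epsilon> n = (LEAST c. private_protocol \<epsilon> n c)"

definition R_par_pub :: "real \<Rightarrow> nat \<Rightarrow> nat" where
  "R_par_pub \<epsilon> n = (LEAST c. public_protocol \<epsilon> n c)"


section \<open>Quantum simultaneous message passing\<close>

definition mat_trace :: "complex mat \<Rightarrow> complex" where
  "mat_trace A = (\<Sum>i < dim_row A. A $$ (i, i))"

text \<open>The order on \<open>complex\<close> makes \<open>0 \<le> z\<close> say that \<open>z\<close> is real and nonnegative; over the
  complex numbers this condition implies that \<open>A\<close> is Hermitian.\<close>

definition psd :: "nat \<Rightarrow> complex mat \<Rightarrow> bool" where
  "psd d A \<longleftrightarrow> A \<in> carrier_mat d d \<and> (\<forall>v \<in> carrier_vec d. 0 \<le> (A *\<^sub>v v) \<bullet>c v)"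

definition density_matrix :: "nat \<Rightarrow> complex mat \<Rightarrow> bool" where
  "density_matrix d \<rho> \<longleftrightarrow> psd d \<rho> \<and> mat_trace \<rho> = 1"

definition kron :: "complex mat \<Rightarrow> complex mat \<Rightarrow> complex mat" where
  "kron A B = mat (dim_row A * dim_row B) (dim_col A * dim_col B)
     (\<lambda>(i, j). A $$ (i div dim_row B, j div dim_col B) * B $$ (i mod dim_row B, j mod dim_col B))"

definition povm :: "nat \<Rightarrow> 'z set \<Rightarrow> ('z \<Rightarrow> complex mat) \<Rightarrow> bool" where
  "povm d Z M \<longleftrightarrow> finite Z \<and> (\<forall>z \<in> Z. psd d (M z)) \<and>
     mat d d (\<lambda>(i, j). \<Sum>z \<in> Z. M z $$ (i, j)) = 1\<^sub>m d"

text \<open>A single measurement has to apply to all states \<open>\<alpha> x \<otimes> \<beta> ys\<close>, so the messages are states of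
  registers of \<open>a\<close> and \<open>b\<close> qubits that do not depend on the inputs.\<close>

definition quantum_protocol :: "real \<Rightarrow> nat \<Rightarrow> nat \<Rightarrow> bool" where
  "quantum_protocol \<epsilon> n c \<longleftrightarrow>
     (\<exists>a b \<alpha> \<beta> M. a + b \<le> c \<and>
        (\<forall>x \<in> alice_inputs n. density_matrix (2 ^ a) (\<alpha> x)) \<and>
        (\<forall>ys \<in> bob_inputs n. density_matrix (2 ^ b) (\<beta> ys)) \<and>
        povm (2 ^ (a + b)) (answers n) M \<and>
        solves \<epsilon> n (\<lambda>x ys z. Re (mat_trace (M z * kron (\<alpha> x) (\<beta> ys)))))"

definition Q_par :: "real \<Rightarrow> nat \<Rightarrow> nat" where
  "Q_par \<epsilon> n = (LEAST c. quantum_protocol \<epsilon> n c)"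

text \<open>The limit \<open>n \<rightarrow> \<infinity>\<close> along even \<open>n\<close>. For odd \<open>n\<close> Bob has no admissible input.\<close>

definition even_at_top :: "nat filter" where
  "even_at_top = inf at_top (principal {n. even n})"

end

theory Submission
  imports Defs "Jordan_Normal_Form.Schur_Decomposition"
begin

text \<open>
  For the quantum lower bound, fix \<open>s\<close>. The zero-error condition forces the measurement operator of
  \<open>(i, a, b)\<close> to act on the supports of the messages through \<open>P \<otimes> Q\<close>, where \<open>P\<close> projects onto the
  part of Alice's support orthogonal to all messages with \<open>x\<^sub>i \<noteq> a\<close>, and \<open>Q\<close> likewise for Bob. So the
  success probability is at most \<open>\<Sum>i | s\<^sub>i = 1. p\<^sub>i * p'\<^sub>i\<close>, where \<open>p\<^sub>i\<close> and \<open>p'\<^sub>i\<close> are the probabilities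
  that Alice's and Bob's messages alone reveal \<open>x\<^sub>i\<close> and \<open>y\<^sub>i\<close> with certainty. On average over the
  inputs, a message of \<open>q\<close> qubits reveals \<open>O(q)\<close> bits, and \<open>p\<close> does not depend on \<open>s\<close>; putting the ones
  of \<open>s\<close> on \<open>n/2\<close> positions where \<open>p\<close> is small bounds the sum by \<open>O(q * q' / n)\<close>.

  The \<open>O(q)\<close> bound is an entropy argument. Instead of the von Neumann entropy it uses the concave
  functionals \<open>inf X. tr (X\<^sup>* \<rho> X) + s * |X - 1|\<^sup>2\<close> with \<open>s = 1, 1/2, 1/4, \<dots>\<close>, whose sum is at most
  \<open>q + 2\<close> and drops by a constant times the probability of an unambiguous answer whenever the state
  is conditioned on a further bit.

  The lower bound for private coins follows by encoding messages as diagonal density matrices. With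
  a public coin, a referee who sees fewer than \<open>n/2\<close> message pairs names too few positions. The upper
  bounds use two public random positions, and a \<open>\<surd>n \<times> \<surd>n\<close> table of which Alice sends three random
  rows and Bob the column with the most ones of \<open>s\<close>.
\<close>

text \<open>On an eigenvalue \<open>l\<close> of \<rho> the minimum at scale \<open>s\<close>
  contributes \<open>l * s / (l + s)\<close>, which is \<open>min l s\<close> up to a factor 2.
  Summed over all dyadic scales this is of the order of \<open>l * log 2 (1 / l) + l\<close>, so the
  sum of the functionals is a discretised entropy. One scale would not do. The gain in a
  conditioning step comes from a perturbation along the difference \<open>D\<close> of the two
  detecting projectors. At scale \<open>s\<close> its quadratic cost contains
  \<open>s * tr (D * D)\<close>, which the detection probability \<open>p\<close> does not control;
  only \<open>tr (D * D * r)\<close> is of order \<open>p\<close>. Distributing the entries of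
  \<open>D\<close> over the scales according to the eigenvalues of \<open>r\<close> replaces the
  former by the latter. Stopping after finitely many scales leaves an error proportional to
  \<open>d / 2 ^ J\<close> per bit. The diagonal encoding of classical messages serves twice: it
  also turns the table protocol into a quantum protocol, so that no separate quantum upper bound is
  required.\<close>

unbundle no vec_syntax
unbundle no inner_syntax

section \<open>Matrices and the spectral theorem\<close>

abbreviation adj :: "complex mat \<Rightarrow> complex mat" where "adj \<equiv> mat_adjoint"

lemma adj_dim [simp]: "dim_row (adj A) = dim_col A" "dim_col (adj A) = dim_row A"
  by (simp_all add: mat_adjoint_def)

lemma adj_carrier [simp]: "A \<in> carrier_mat n m \<Longrightarrow> adj A \<in> carrier_mat m n"
  by (metis adj_dim carrier_matD carrier_matI)

lemma adj_index [simp]: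
  assumes "i < dim_col A" "j < dim_row A"
  shows "adj A $$ (i, j) = cnj (A $$ (j, i))"
  using assms by (simp add: mat_adjoint_def mat_of_rows_def)

lemma mult_index:
  assumes "A \<in> carrier_mat n m" "B \<in> carrier_mat m p" "i < n" "j < p"
  shows "(A * B) $$ (i, j) = (\<Sum>k<m. A $$ (i, k) * B $$ (k, j))"
  using assms by (auto simp: scalar_prod_def atLeast0LessThan intro!: sum.cong)

lemma mult3_index:
  assumes A: "A \<in> carrier_mat n m" and B: "B \<in> carrier_mat m p" and C: "C \<in> carrier_mat p q"
    and ij: "i < n" "j < q"
  shows "(A * B * C) $$ (i, j) = (\<Sum>k<p. (\<Sum>l<m. A $$ (i, l) * B $$ (l, k)) * C $$ (k, j))"
proof -
  have "(A * B * C) $$ (i, j) = (\<Sum>k<p. (A * B) $$ (i, k) * C $$ (k, j))"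
    using assms by (intro mult_index) auto
  also have "\<dots> = (\<Sum>k<p. (\<Sum>l<m. A $$ (i, l) * B $$ (l, k)) * C $$ (k, j))"
    using mult_index[OF A B ij(1)] by (intro sum.cong) auto
  finally show ?thesis .
qed

lemma adj_adj [simp]: "adj (adj A) = A"
  by (rule eq_matI) auto

lemma adj_mult:
  assumes "A \<in> carrier_mat n m" "B \<in> carrier_mat m p"
  shows "adj (A * B) = adj B * adj A"
proof (rule eq_matI)
  fix i j assume "i < dim_row (adj B * adj A)" "j < dim_col (adj B * adj A)"
  then have ij: "i < p" "j < n" using assms by auto
  have "adj (A * B) $$ (i, j) = cnj ((A * B) $$ (j, i))" using ij assms by (intro adj_index) auto
  also have "\<dots> = (\<Sum>k<m. adj B $$ (i, k) * adj A $$ (k, j))"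
    using ij assms by (subst mult_index[OF assms ij(2,1)]) (auto intro!: sum.cong)
  also have "\<dots> = (adj B * adj A) $$ (i, j)"
    using ij assms by (subst mult_index[where n = p and m = m and p = n]) auto
  finally show "adj (A * B) $$ (i, j) = (adj B * adj A) $$ (i, j)" .
qed (use assms in auto)

lemma adj_add: "A \<in> carrier_mat n m \<Longrightarrow> B \<in> carrier_mat n m \<Longrightarrow> adj (A + B) = adj A + adj B"
  by (rule eq_matI) auto

lemma adj_minus: "A \<in> carrier_mat n m \<Longrightarrow> B \<in> carrier_mat n m \<Longrightarrow> adj (A - B) = adj A - adj B"
  by (rule eq_matI) auto

lemma adj_one [simp]: "adj (1\<^sub>m n) = 1\<^sub>m n"
  by (rule eq_matI) auto

lemma eigenvector_exists:
  assumes A: "A \<in> carrier_mat (Suc n) (Suc n)"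
  shows "\<exists>v (e::complex). v \<in> carrier_vec (Suc n) \<and> v \<noteq> 0\<^sub>v (Suc n) \<and> A *\<^sub>v v = e \<cdot>\<^sub>v v"
proof -
  obtain as where as: "char_poly A = (\<Prod> a \<leftarrow> as. [:- a, 1:])" "length as = Suc n"
    using char_poly_factorized[OF A] by blast
  then obtain e es where "as = e # es" by (cases as) auto
  then have "poly (char_poly A) e = 0" using as by simp
  then have "eigenvalue A e" using eigenvalue_root_char_poly[OF A] by simp
  then show ?thesis using A unfolding eigenvalue_def eigenvector_def by auto
qed

text \<open>Complete \<open>v\<close> to a basis, orthogonalise, and divide each vector by its norm.
  Gram-Schmidt leaves the first vector alone, so column 0 stays a multiple of
  \<open>v\<close>.\<close>

lemma unitary_completion:
  assumes v: "v \<in> carrier_vec n" "v \<noteq> 0\<^sub>v n"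
  shows "\<exists>W c. W \<in> carrier_mat n n \<and> adj W * W = 1\<^sub>m n \<and> W * adj W = 1\<^sub>m n \<and> col W 0 = c \<cdot>\<^sub>v v"
proof -
  interpret cof_vec_space n "TYPE(complex)" .
  define ws where "ws = gram_schmidt n (basis_completion v)"
  note bc = basis_completion[OF v]
  note gs = gram_schmidt_result[OF bc(2,4,5) refl, folded ws_def]
  have n0: "n > 0" using v by (cases n) auto
  have ne: "basis_completion v \<noteq> []" using bc(6) n0 by auto
  have hd: "hd ws = v"
    using gram_schmidt_hd[of v "tl (basis_completion v)"] v bc(7) ne
    unfolding ws_def by (metis list.collapse)
  have len: "length ws = n" using gs(4) bc(6) by simp
  have nn: "ws ! i \<in> carrier_vec n" if "i < n" for i
    using gs(3) that len by auto
  have orth: "(ws ! i \<bullet>c ws ! j = 0) = (i \<noteq> j)" if "i < n" "j < n" for i j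
    using corthogonalD[OF gs(2)] that len by auto
  define nr where "nr i = sqrt (\<Sum>k<n. (cmod (ws ! i $ k))\<^sup>2)" for i
  have sq: "ws ! i \<bullet>c ws ! i = complex_of_real (\<Sum>k<n. (cmod (ws ! i $ k))\<^sup>2)" if "i < n" for i
    using nn[OF that]
    by (auto simp: scalar_prod_def atLeast0LessThan complex_norm_square simp flip: of_real_power intro!: sum.cong)
  have nrpos: "nr i > 0" if "i < n" for i
  proof -
    have "(\<Sum>k<n. (cmod (ws ! i $ k))\<^sup>2) \<noteq> 0" using sq[OF that] orth[OF that that] by (metis of_real_0)
    moreover have "(\<Sum>k<n. (cmod (ws ! i $ k))\<^sup>2) \<ge> 0" by (simp add: sum_nonneg)
    ultimately show ?thesis by (simp add: nr_def)
  qed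
  define W where "W = mat n n (\<lambda>(k, i). ws ! i $ k / complex_of_real (nr i))"
  have W: "W \<in> carrier_mat n n" by (simp add: W_def)
  have WW: "adj W * W = 1\<^sub>m n"
  proof (rule eq_matI)
    fix i j assume "i < dim_row (1\<^sub>m n :: complex mat)" "j < dim_col (1\<^sub>m n :: complex mat)"
    then have ij: "i < n" "j < n" by auto
    have "(adj W * W) $$ (i, j) = (\<Sum>k<n. cnj (ws ! i $ k / complex_of_real (nr i)) * (ws ! j $ k / complex_of_real (nr j)))"
      using W ij by (subst mult_index[where n = n and m = n and p = n]) (auto simp: W_def)
    also have "\<dots> = (\<Sum>k<n. ws ! j $ k * cnj (ws ! i $ k)) / (complex_of_real (nr i) * complex_of_real (nr j))"
      by (auto simp: sum_divide_distrib intro!: sum.cong)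
    also have "(\<Sum>k<n. ws ! j $ k * cnj (ws ! i $ k)) = ws ! j \<bullet>c ws ! i"
      using nn[OF ij(1)] by (auto simp: scalar_prod_def atLeast0LessThan)
    also have "\<dots> / (complex_of_real (nr i) * complex_of_real (nr j)) = 1\<^sub>m n $$ (i, j)"
    proof (cases "i = j")
      case True
      have "(\<Sum>k<n. (cmod (ws ! i $ k))\<^sup>2) = nr i * nr i" by (simp add: nr_def sum_nonneg)
      then show ?thesis using True sq[OF ij(1)] nrpos[OF ij(1)] ij by simp
    next
      case False
      then show ?thesis using orth[OF ij(2,1)] ij by auto
    qed
    finally show "(adj W * W) $$ (i, j) = 1\<^sub>m n $$ (i, j)" .
  qed (use W in auto)
  moreover have "W * adj W = 1\<^sub>m n"
    using mat_mult_left_right_inverse[OF adj_carrier[OF W] W WW] .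
  moreover have "col W 0 = complex_of_real (1 / nr 0) \<cdot>\<^sub>v v"
  proof (rule eq_vecI)
    have "ws ! 0 = v" using hd len n0 by (metis hd_conv_nth list.size(3) neq0_conv)
    then show "col W 0 $ i = (complex_of_real (1 / nr 0) \<cdot>\<^sub>v v) $ i"
      if "i < dim_vec (complex_of_real (1 / nr 0) \<cdot>\<^sub>v v)" for i
      using that n0 v by (auto simp: W_def)
  qed (use v W in auto)
  ultimately show ?thesis using W by blast
qed

text \<open>Deflation: in a unitary basis that starts with an eigenvector, column 0 vanishes below
  the diagonal; being Hermitian, the matrix then also has a clear row 0 and a real eigenvalue
  \<open>e\<close>. The remaining block \<open>C\<close> is Hermitian of size \<open>n\<close>, and
  its diagonaliser is bordered by a 1.\<close>

lemma hermitian_diagonalization: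
  assumes "A \<in> carrier_mat n n" "adj A = A"
  shows "\<exists>U (l :: nat \<Rightarrow> real). U \<in> carrier_mat n n \<and> adj U * U = 1\<^sub>m n \<and> U * adj U = 1\<^sub>m n \<and>
    adj U * A * U = mat n n (\<lambda>(i, j). if i = j then complex_of_real (l i) else 0)"
  using assms
proof (induction n arbitrary: A)
  case 0
  show ?case by (intro exI[of _ "1\<^sub>m 0"] exI[of _ "\<lambda>_. 0"]) (use 0 in auto)
next
  case (Suc n)
  let ?N = "Suc n"
  note A = Suc.prems(1)
  obtain v e where v: "v \<in> carrier_vec ?N" "v \<noteq> 0\<^sub>v ?N" and ev: "A *\<^sub>v v = e \<cdot>\<^sub>v v"
    using eigenvector_exists[OF A] by blast
  obtain W c where W: "W \<in> carrier_mat ?N ?N" "adj W * W = 1\<^sub>m ?N" "W * adj W = 1\<^sub>m ?N" "col W 0 = c \<cdot>\<^sub>v v"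
    using unitary_completion[OF v] by blast
  define B where "B = adj W * A * W"
  have B: "B \<in> carrier_mat ?N ?N" using W A by (auto simp: B_def)
  have adjB: "adj B = B" unfolding B_def using W A Suc.prems(2)
    by (simp add: adj_mult[of _ ?N ?N _ ?N] assoc_mult_mat[of _ ?N ?N _ ?N _ ?N] mult_carrier_mat[of _ ?N ?N _ ?N])
  have Bs: "cnj (B $$ (i, j)) = B $$ (j, i)" if "i < ?N" "j < ?N" for i j
    using that B adj_index[of j B i] adjB by auto
  have AW: "A *\<^sub>v col W 0 = e \<cdot>\<^sub>v col W 0"
    unfolding W(4) using v ev A by (simp add: mult_mat_vec smult_smult_assoc mult.commute)
  have B0: "B $$ (i, 0) = (if i = 0 then e else 0)" if "i < ?N" for i
  proof -
    have "B $$ (i, 0) = (adj W * (A * W)) $$ (i, 0)" unfolding B_def using W A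
      by (simp add: assoc_mult_mat[of _ ?N ?N _ ?N _ ?N] mult_carrier_mat[of _ ?N ?N _ ?N])
    also have "\<dots> = row (adj W) i \<bullet> (A *\<^sub>v col W 0)"
      using that W A by (subst index_mult_mat) (auto simp: col_mult2[of _ ?N ?N _ ?N])
    also have "\<dots> = e * (row (adj W) i \<bullet> col W 0)"
      unfolding AW using that W(1) by (subst scalar_prod_smult_right) auto
    also have "row (adj W) i \<bullet> col W 0 = (adj W * W) $$ (i, 0)" using that W by (subst index_mult_mat) auto
    finally show ?thesis using W that by auto
  qed
  have B0': "B $$ (0, i) = (if i = 0 then e else 0)" if "i < ?N" for i
    using Bs[of i 0] B0[of i] B0[of 0] Bs[of 0 0] that by (auto split: if_splits)
  have e: "e = complex_of_real (Re e)" using Bs[of 0 0] B0[of 0] by (simp add: complex_eq_iff)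
  define C where "C = mat n n (\<lambda>(i, j). B $$ (Suc i, Suc j))"
  have C: "C \<in> carrier_mat n n" "adj C = C" using Bs by (auto simp: C_def intro!: eq_matI)
  obtain V l where V: "V \<in> carrier_mat n n" "adj V * V = 1\<^sub>m n"
    "adj V * C * V = mat n n (\<lambda>(i, j). if i = j then complex_of_real (l i) else 0)"
    using Suc.IH[OF C] by blast
  define V' where "V' = mat ?N ?N (\<lambda>(i, j). if i = 0 \<or> j = 0 then (if i = j then 1 else 0) else V $$ (i - 1, j - 1))"
  have V': "V' \<in> carrier_mat ?N ?N" by (simp add: V'_def)
  have V'e: "V' $$ (0, 0) = 1" "\<And>i. i < n \<Longrightarrow> V' $$ (0, Suc i) = 0" "\<And>i. i < n \<Longrightarrow> V' $$ (Suc i, 0) = 0"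
    "\<And>i j. i < n \<Longrightarrow> j < n \<Longrightarrow> V' $$ (Suc i, Suc j) = V $$ (i, j)"
    by (auto simp: V'_def)
  have Be: "B $$ (0, 0) = e" "\<And>i. i < n \<Longrightarrow> B $$ (0, Suc i) = 0" "\<And>i. i < n \<Longrightarrow> B $$ (Suc i, 0) = 0"
    "\<And>i j. i < n \<Longrightarrow> j < n \<Longrightarrow> B $$ (Suc i, Suc j) = C $$ (i, j)"
    using B0 B0' by (auto simp: C_def)
  have dim: "dim_row V' = ?N" "dim_col V' = ?N" "dim_row V = n" "dim_col V = n" "dim_row C = n" "dim_col C = n" "dim_row B = ?N" "dim_col B = ?N"
    using V' V B C by auto
  have VV: "adj V' * V' = 1\<^sub>m ?N"
  proof (rule eq_matI)
    fix i j assume "i < dim_row (1\<^sub>m ?N :: complex mat)" "j < dim_col (1\<^sub>m ?N :: complex mat)"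
    then have ij: "i < ?N" "j < ?N" by auto
    have "(adj V * V) $$ (i', j') = (\<Sum>k<n. cnj (V $$ (k, i')) * V $$ (k, j'))" if "i' < n" "j' < n" for i' j'
      using that V by (subst mult_index[where n = n and m = n and p = n]) auto
    moreover have "(adj V' * V') $$ (i, j) = (\<Sum>k<?N. cnj (V' $$ (k, i)) * V' $$ (k, j))"
      using V' ij by (subst mult_index[where n = ?N and m = ?N and p = ?N]) auto
    ultimately show "(adj V' * V') $$ (i, j) = 1\<^sub>m ?N $$ (i, j)"
      using ij V(2)
      by (cases i; cases j) (auto simp: sum.lessThan_Suc_shift V'e simp del: sum.lessThan_Suc)
  qed (use V' in auto)
  have VBV: "adj V' * B * V' = mat ?N ?N (\<lambda>(i, j). if i = j then complex_of_real (case i of 0 \<Rightarrow> Re e | Suc i \<Rightarrow> l i) else 0)"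
      (is "_ = ?D")
  proof (rule eq_matI)
    fix i j assume "i < dim_row ?D" "j < dim_col ?D"
    then have ij: "i < ?N" "j < ?N" by auto
    have *: "(adj V * C * V) $$ (i', j') = (\<Sum>k<n. (\<Sum>m<n. cnj (V $$ (m, i')) * C $$ (m, k)) * V $$ (k, j'))" if "i' < n" "j' < n" for i' j'
      using that V C by (subst mult3_index[where n = n and m = n and p = n and q = n]) auto
    have "(adj V' * B * V') $$ (i, j) = (\<Sum>k<?N. (\<Sum>m<?N. cnj (V' $$ (m, i)) * B $$ (m, k)) * V' $$ (k, j))"
      using V' B ij by (subst mult3_index[where n = ?N and m = ?N and p = ?N and q = ?N]) auto
    then show "(adj V' * B * V') $$ (i, j) = mat ?N ?N (\<lambda>(i, j). if i = j then complex_of_real (case i of 0 \<Rightarrow> Re e | Suc i \<Rightarrow> l i) else 0) $$ (i, j)"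
      using ij e *[symmetric, unfolded V(3)]
      by (cases i; cases j) (auto simp: sum.lessThan_Suc_shift V'e Be simp del: sum.lessThan_Suc)
  qed (use V' in auto)
  define U where "U = W * V'"
  have U: "U \<in> carrier_mat ?N ?N" using W V' by (auto simp: U_def)
  have UU: "adj U * U = 1\<^sub>m ?N"
  proof -
    have "adj U * U = adj V' * (adj W * W) * V'" unfolding U_def using W(1) V'
      by (simp add: adj_mult[of _ ?N ?N _ ?N] assoc_mult_mat[of _ ?N ?N _ ?N _ ?N] mult_carrier_mat[of _ ?N ?N _ ?N])
    then show ?thesis using W V' VV by simp
  qed
  have "adj U * A * U = adj V' * B * V'" unfolding U_def B_def using W(1) V' A
    by (simp add: adj_mult[of _ ?N ?N _ ?N] assoc_mult_mat[of _ ?N ?N _ ?N _ ?N] mult_carrier_mat[of _ ?N ?N _ ?N])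
  then show ?case using U UU mat_mult_left_right_inverse[OF adj_carrier[OF U] U UU] VBV
    by (intro exI[of _ U] exI[of _ "\<lambda>i. case i of 0 \<Rightarrow> Re e | Suc i \<Rightarrow> l i"]) auto
qed

section \<open>Positive semidefinite matrices\<close>

lemma mat_trace_mult:
  assumes "A \<in> carrier_mat n m" "B \<in> carrier_mat m n"
  shows "mat_trace (A * B) = (\<Sum>i<n. \<Sum>k<m. A $$ (i, k) * B $$ (k, i))"
  using assms by (auto simp: mat_trace_def scalar_prod_def atLeast0LessThan intro!: sum.cong)

lemma mat_trace_comm:
  assumes "A \<in> carrier_mat n m" "B \<in> carrier_mat m n"
  shows "mat_trace (A * B) = mat_trace (B * A)"
  unfolding mat_trace_mult[OF assms] mat_trace_mult[OF assms(2,1)]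
  by (subst sum.swap) (simp add: mult.commute)

lemma mat_trace_add:
  "A \<in> carrier_mat n n \<Longrightarrow> B \<in> carrier_mat n n \<Longrightarrow> mat_trace (A + B) = mat_trace A + mat_trace B"
  by (auto simp: mat_trace_def sum.distrib)

lemma mat_trace_minus:
  "A \<in> carrier_mat n n \<Longrightarrow> B \<in> carrier_mat n n \<Longrightarrow> mat_trace (A - B) = mat_trace A - mat_trace B"
  by (auto simp: mat_trace_def sum_subtractf)

text \<open>The squared Frobenius norm of \<open>Y\<close>. Nonnegative traces and vanishing
  products are all reduced to it.\<close>

lemma mat_trace_gram:
  assumes "Y \<in> carrier_mat n m"
  shows "mat_trace (adj Y * Y) = complex_of_real (\<Sum>i<m. \<Sum>k<n. (cmod (Y $$ (k, i)))\<^sup>2)"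
  using assms by (auto simp: mat_trace_mult[of _ m n] complex_norm_square mult.commute simp flip: of_real_power intro!: sum.cong)

lemma mat_trace_gram_nonneg: "Y \<in> carrier_mat n m \<Longrightarrow> 0 \<le> Re (mat_trace (adj Y * Y))"
  by (auto simp: mat_trace_gram intro!: sum_nonneg)

lemma mat_trace_gram_eq_0:
  assumes Y: "Y \<in> carrier_mat n m" and "Re (mat_trace (adj Y * Y)) = 0"
  shows "Y = 0\<^sub>m n m"
proof -
  have "(\<Sum>i<m. \<Sum>k<n. (cmod (Y $$ (k, i)))\<^sup>2) = 0" using assms by (simp add: mat_trace_gram del: of_real_sum)
  then have "\<forall>i<m. \<forall>k<n. (cmod (Y $$ (k, i)))\<^sup>2 = 0"
    by (simp add: sum_nonneg_eq_0_iff sum_nonneg)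
  then show ?thesis using Y by (intro eq_matI) auto
qed

lemma sum_mult_two_deltas:
  fixes f :: "nat \<Rightarrow> complex"
  assumes "i < d" "j < d"
  shows "(\<Sum>k<d. f k * ((if k = i then a else 0) + (if k = j then b else 0))) = f i * a + f j * b"
proof -
  have "(\<Sum>k<d. f k * (if k = i then a else 0)) = f i * a" if "i < d" for i a
    using that by (simp add: if_distrib[where f = "\<lambda>x. _ * x"] cong: if_cong)
  then show ?thesis using assms by (simp add: distrib_left sum.distrib)
qed

text \<open>Polarisation: the form is real at the vector with 1 at \<open>i\<close> and
  \<open>t\<close> at \<open>j\<close>, and the values \<open>0, 1, -1, \<i>, -\<i>\<close> of
  \<open>t\<close> determine how the entries at \<open>(i, j)\<close> and \<open>(j, i)\<close> are
  related. The two contributions are added, so that \<open>i = j\<close> needs no separate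
  case.\<close>

lemma psd_hermitian:
  assumes "psd d A"
  shows "adj A = A"
proof (rule eq_matI)
  have A: "A \<in> carrier_mat d d" using assms by (simp add: psd_def)
  fix i j assume "i < dim_row A" "j < dim_col A"
  then have ij: "i < d" "j < d" using A by auto
  have "Im (A $$ (i, i) + A $$ (i, j) * t + (A $$ (j, i) + A $$ (j, j) * t) * cnj t) = 0" for t
  proof -
    define v where "v = vec d (\<lambda>l. (if l = i then 1 else 0) + (if l = j then t else 0))"
    have v: "v \<in> carrier_vec d" by (simp add: v_def)
    have Av: "(A *\<^sub>v v) $ k = A $$ (k, i) + A $$ (k, j) * t" if "k < d" for k
    proof -
      have "(A *\<^sub>v v) $ k = (\<Sum>l<d. A $$ (k, l) * ((if l = i then 1 else 0) + (if l = j then t else 0)))"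
        using that A by (auto simp: v_def scalar_prod_def atLeast0LessThan intro!: sum.cong)
      then show ?thesis by (simp only: sum_mult_two_deltas[OF ij] mult_1_right)
    qed
    have "(A *\<^sub>v v) \<bullet>c v = (\<Sum>k<d. (A *\<^sub>v v) $ k * cnj (v $ k))"
      using v by (auto simp: scalar_prod_def atLeast0LessThan)
    also have "\<dots> = (\<Sum>k<d. (A $$ (k, i) + A $$ (k, j) * t) * cnj (v $ k))"
      using Av by (intro sum.cong) auto
    also have "\<dots> = A $$ (i, i) + A $$ (i, j) * t + (A $$ (j, i) + A $$ (j, j) * t) * cnj t"
    proof -
      have "(\<Sum>k<d. (A $$ (k, i) + A $$ (k, j) * t) * cnj (v $ k)) = (\<Sum>k<d. (A $$ (k, i) + A $$ (k, j) * t) *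
          ((if k = i then 1 else 0) + (if k = j then cnj t else 0)))"
        by (intro sum.cong) (auto simp: v_def)
      then show ?thesis by (simp only: sum_mult_two_deltas[OF ij] mult_1_right)
    qed
    finally show ?thesis using assms v by (auto simp: psd_def less_eq_complex_def)
  qed
  from this[of 0] this[of 1] this[of "-1"] this[of \<i>] this[of "-\<i>"]
  show "adj A $$ (i, j) = A $$ (i, j)" using ij A by (simp add: complex_eq_iff)
qed (use assms in \<open>auto simp: psd_def\<close>)

lemma psd_carrier: "psd d A \<Longrightarrow> A \<in> carrier_mat d d"
  by (simp add: psd_def)

lemma psd_gram:
  assumes S: "S \<in> carrier_mat d m"
  shows "psd d (S * adj S)"
  unfolding psd_def
proof (intro conjI ballI)
  fix v :: "complex vec" assume v: "v \<in> carrier_vec d"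
  have "((S * adj S) *\<^sub>v v) \<bullet>c v = (S *\<^sub>v (adj S *\<^sub>v v)) \<bullet>c v"
    using S v by (simp add: assoc_mult_mat_vec[of _ d m _ d])
  also have "\<dots> = (\<Sum>i<d. (\<Sum>k<m. S $$ (i, k) * (adj S *\<^sub>v v) $ k) * cnj (v $ i))"
    using S v by (auto simp: scalar_prod_def atLeast0LessThan intro!: sum.cong)
  also have "\<dots> = (\<Sum>k<m. (adj S *\<^sub>v v) $ k * (\<Sum>i<d. S $$ (i, k) * cnj (v $ i)))"
    by (simp add: sum_distrib_left sum_distrib_right, subst sum.swap) (simp add: mult_ac)
  also have "\<dots> = (\<Sum>k<m. (adj S *\<^sub>v v) $ k * cnj ((adj S *\<^sub>v v) $ k))"
    using S v by (auto simp: scalar_prod_def atLeast0LessThan intro!: sum.cong)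
  also have "\<dots> = complex_of_real (\<Sum>k<m. (cmod ((adj S *\<^sub>v v) $ k))\<^sup>2)"
    by (simp only: of_real_sum complex_norm_square)
  also have "\<dots> \<ge> 0" by (simp add: less_eq_complex_def sum_nonneg del: of_real_sum)
  finally show "0 \<le> ((S * adj S) *\<^sub>v v) \<bullet>c v" .
qed (use S in auto)

lemma psd_diagonalization:
  assumes A: "psd d A"
  shows "\<exists>U (l :: nat \<Rightarrow> real). U \<in> carrier_mat d d \<and> adj U * U = 1\<^sub>m d \<and> U * adj U = 1\<^sub>m d \<and>
    adj U * A * U = mat d d (\<lambda>(i, j). if i = j then complex_of_real (l i) else 0) \<and> (\<forall>i<d. 0 \<le> l i)"
proof -
  note Ac = psd_carrier[OF A]
  obtain U l where U: "U \<in> carrier_mat d d" "adj U * U = 1\<^sub>m d" "U * adj U = 1\<^sub>m d"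
    "adj U * A * U = mat d d (\<lambda>(i, j). if i = j then complex_of_real (l i) else 0)"
    using hermitian_diagonalization[OF Ac psd_hermitian[OF A]] by blast
  have "0 \<le> l i" if i: "i < d" for i
  proof -
    have "complex_of_real (l i) = (adj U * A * U) $$ (i, i)" using U(4) i by simp
    also have "\<dots> = (adj U * (A * U)) $$ (i, i)"
      using U(1) Ac by (simp add: assoc_mult_mat[of _ d d _ d _ d])
    also have "\<dots> = (\<Sum>k<d. adj U $$ (i, k) * (A * U) $$ (k, i))" using U(1) Ac i by (intro mult_index) auto
    also have "\<dots> = (A *\<^sub>v col U i) \<bullet>c col U i"
      using U(1) Ac i by (auto simp: scalar_prod_def atLeast0LessThan mult.commute intro!: sum.cong)
    also have "\<dots> \<ge> 0" using A U(1) i by (auto simp: psd_def)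
    finally show ?thesis by (simp add: less_eq_complex_def)
  qed
  then show ?thesis using U by blast
qed

text \<open>With \<open>1 / 0 = 0\<close>, inverting the eigenvalues gives the pseudo-inverse \<open>G\<close>; then \<open>A * G\<close> is
  the orthogonal projector onto the range of \<open>A\<close>.\<close>

lemma psd_factor_and_pseudoinverse:
  assumes A: "psd d A"
  shows "(\<exists>S\<in>carrier_mat d d. A = S * adj S) \<and>
    (\<exists>G\<in>carrier_mat d d. adj (A * G) = A * G \<and> (A * G) * (A * G) = A * G \<and> (A * G) * A = A)"
proof -
  note Ac = psd_carrier[OF A]
  obtain U l where U: "U \<in> carrier_mat d d" "adj U * U = 1\<^sub>m d" "U * adj U = 1\<^sub>m d"
    and D: "adj U * A * U = mat d d (\<lambda>(i, j). if i = j then complex_of_real (l i) else 0)" (is "_ = ?D")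
    and l: "\<And>i. i < d \<Longrightarrow> 0 \<le> l i"
    using psd_diagonalization[OF A] by blast
  \<comment> \<open>Functional calculus: \<open>c g\<close> applies \<open>g\<close> to the
    eigenvalues of \<open>A\<close>, so identities between such matrices become identities between
    real functions on the spectrum.\<close>
  define dg where "dg g = mat d d (\<lambda>(i, j). if i = j then complex_of_real (g (l i)) else 0)" for g :: "real \<Rightarrow> real"
  define c where "c g = U * dg g * adj U" for g :: "real \<Rightarrow> real"
  have dgc: "dg g \<in> carrier_mat d d" for g by (simp add: dg_def)
  note asc = assoc_mult_mat[of _ d d _ d _ d] mult_carrier_mat[of _ d d _ d]
  have canc: "adj U * (U * X) = X" if "X \<in> carrier_mat d d" for X
    using that U(1) by (simp add: U(2) flip: asc(1))
  have AD: "A = c (\<lambda>x. x)"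
  proof -
    have "c (\<lambda>x. x) = U * (adj U * A * U) * adj U" unfolding c_def D dg_def ..
    also have "\<dots> = (U * adj U) * A * (U * adj U)" using U(1) Ac by (simp add: asc)
    finally show ?thesis using U Ac by simp
  qed
  have dg_mult: "dg g * dg h = dg (\<lambda>x. g x * h x)" for g h
  proof (rule eq_matI)
    fix i j assume "i < dim_row (dg (\<lambda>x. g x * h x))" "j < dim_col (dg (\<lambda>x. g x * h x))"
    then have ij: "i < d" "j < d" by (auto simp: dg_def)
    have "(dg g * dg h) $$ (i, j) = (\<Sum>k<d. dg g $$ (i, k) * dg h $$ (k, j))"
      using ij dgc by (intro mult_index) auto
    also have "\<dots> = (\<Sum>k<d. if k = i then dg g $$ (i, i) * dg h $$ (i, j) else 0)"
      using ij by (intro sum.cong) (auto simp: dg_def)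
    also have "\<dots> = dg (\<lambda>x. g x * h x) $$ (i, j)" using ij by (auto simp: dg_def)
    finally show "(dg g * dg h) $$ (i, j) = dg (\<lambda>x. g x * h x) $$ (i, j)" .
  qed (auto simp: dg_def)
  have c_mult: "c g * c h = c (\<lambda>x. g x * h x)" for g h
  proof -
    have "c g * c h = U * (dg g * dg h) * adj U" unfolding c_def using U(1) dgc by (simp add: asc canc)
    then show ?thesis unfolding dg_mult c_def .
  qed
  have c_adj: "adj (c g) = c g" for g
  proof -
    have "adj (dg g) = dg g" by (rule eq_matI) (auto simp: dg_def)
    then show ?thesis unfolding c_def using U(1) dgc by (simp add: adj_mult[of _ d d _ d] asc)
  qed
  have cc: "c g \<in> carrier_mat d d" for g using U(1) dgc by (simp add: asc c_def)
  have cong: "c g = c h" if "\<And>i. i < d \<Longrightarrow> g (l i) = h (l i)" for g h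
  proof -
    have "dg g = dg h" by (rule eq_matI) (auto simp: that dg_def)
    then show ?thesis by (simp add: c_def)
  qed
  have "A = c sqrt * adj (c sqrt)"
    unfolding c_adj c_mult by (subst AD, rule cong) (use l in auto)
  moreover have "\<exists>G\<in>carrier_mat d d. adj (A * G) = A * G \<and> (A * G) * (A * G) = A * G \<and> (A * G) * A = A"
  proof (rule bexI[of _ "c (\<lambda>x. 1 / x)"], unfold AD c_mult c_adj, intro conjI cong)
    show "c (\<lambda>x. 1 / x) \<in> carrier_mat d d" by (rule cc)
  qed auto
  ultimately show ?thesis using cc by blast
qed

lemma psd_factor: "psd d A \<Longrightarrow> \<exists>S\<in>carrier_mat d d. A = S * adj S"
  using psd_factor_and_pseudoinverse by blast

lemma psd_trace_gram:
  assumes A: "A \<in> carrier_mat d d" and S: "S \<in> carrier_mat d d"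
  shows "mat_trace ((A * adj A) * (S * adj S)) = mat_trace (adj (adj A * S) * (adj A * S))"
proof -
  have "mat_trace ((A * adj A) * (S * adj S)) = mat_trace ((A * adj A * S) * adj S)"
    using assms by (simp add: assoc_mult_mat[of _ d d _ d _ d] mult_carrier_mat[of _ d d _ d])
  also have "\<dots> = mat_trace (adj S * (A * adj A * S))"
    using assms by (intro mat_trace_comm[of _ d d]) auto
  also have "adj S * (A * adj A * S) = adj (adj A * S) * (adj A * S)"
    using assms by (simp add: adj_mult[of _ d d _ d] assoc_mult_mat[of _ d d _ d _ d] mult_carrier_mat[of _ d d _ d])
  finally show ?thesis .
qed

lemma psd_trace_mult_nonneg:
  assumes "psd d A" "psd d B"
  shows "0 \<le> Re (mat_trace (A * B))"
proof -
  obtain S T where "S \<in> carrier_mat d d" "A = S * adj S" "T \<in> carrier_mat d d" "B = T * adj T"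
    using assms psd_factor by metis
  then show ?thesis using psd_trace_gram[of S d T] mat_trace_gram_nonneg[of "adj S * T" d d]
    by (simp add: mult_carrier_mat[of _ d d _ d])
qed

text \<open>With \<open>A = S * adj S\<close> and \<open>B = T * adj T\<close> the trace is the
  squared Frobenius norm of \<open>adj S * T\<close>, which is a factor of \<open>A * B\<close>.
  This turns an event of probability zero into an operator identity.\<close>

lemma psd_trace_mult_eq_0:
  assumes "psd d A" "psd d B" "Re (mat_trace (A * B)) = 0"
  shows "A * B = 0\<^sub>m d d"
proof -
  obtain S T where S: "S \<in> carrier_mat d d" "A = S * adj S" and T: "T \<in> carrier_mat d d" "B = T * adj T"
    using assms psd_factor by metis
  have "adj S * T = 0\<^sub>m d d"
    using mat_trace_gram_eq_0[of "adj S * T" d d] psd_trace_gram[of S d T] S T assms(3)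
    by (simp add: mult_carrier_mat[of _ d d _ d])
  moreover have "A * B = S * (adj S * T) * adj T" using S T
    by (simp add: assoc_mult_mat[of _ d d _ d _ d] mult_carrier_mat[of _ d d _ d])
  ultimately show ?thesis using S T by simp
qed

section \<open>Resolvent forms\<close>

text \<open>The minimum over \<open>X\<close> is \<open>s * tr (r * (r + s)\<^sup>-\<^sup>1)\<close>, attained at \<open>X = s * (r + s)\<^sup>-\<^sup>1\<close>. Working with all
  \<open>X\<close> makes the form affine in \<open>r\<close> and avoids inverses.\<close>

definition resolvent_form :: "nat \<Rightarrow> real \<Rightarrow> complex mat \<Rightarrow> complex mat \<Rightarrow> real" where
  "resolvent_form d s r X = Re (mat_trace (adj X * r * X)) + s * Re (mat_trace (adj (X - 1\<^sub>m d) * (X - 1\<^sub>m d)))"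

lemma mat_trace_mult3:
  assumes A: "A \<in> carrier_mat d d" and B: "B \<in> carrier_mat d d" and C: "C \<in> carrier_mat d d"
  shows "mat_trace (A * B * C) = (\<Sum>k<d. \<Sum>m<d. \<Sum>n<d. A $$ (k, n) * B $$ (n, m) * C $$ (m, k))"
proof -
  have "mat_trace (A * B * C) = (\<Sum>k<d. (A * B * C) $$ (k, k))" using A C by (simp add: mat_trace_def)
  then show ?thesis using mult3_index[OF A B C] by (simp add: sum_distrib_right)
qed

lemma resolvent_form_entries:
  assumes r: "r \<in> carrier_mat d d" and X: "X \<in> carrier_mat d d"
  shows "resolvent_form d s r X =
    (\<Sum>k<d. \<Sum>m<d. \<Sum>n<d. Re (cnj (X $$ (n, k)) * r $$ (n, m) * X $$ (m, k))) +
    (\<Sum>k<d. \<Sum>m<d. s * (cmod (X $$ (m, k) - (if m = k then 1 else 0)))\<^sup>2)"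
proof -
  have "Re (mat_trace (adj (X - 1\<^sub>m d) * (X - 1\<^sub>m d))) = (\<Sum>k<d. \<Sum>m<d. (cmod (X $$ (m, k) - (if m = k then 1 else 0)))\<^sup>2)"
  proof -
    have c: "X - 1\<^sub>m d \<in> carrier_mat d d" using X by auto
    show ?thesis unfolding mat_trace_gram[OF c] Re_complex_of_real
      using X by (intro sum.cong arg_cong[where f = "\<lambda>x. (cmod x)\<^sup>2"]) auto
  qed
  moreover have "Re (mat_trace (adj X * r * X)) = (\<Sum>k<d. \<Sum>m<d. \<Sum>n<d. Re (cnj (X $$ (n, k)) * r $$ (n, m) * X $$ (m, k)))"
    unfolding mat_trace_mult3[OF adj_carrier[OF X] r X] using X by (auto intro!: sum.cong)
  ultimately show ?thesis by (simp only: resolvent_form_def sum_distrib_left)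
qed

lemma resolvent_form_nonneg:
  assumes "psd d r" "X \<in> carrier_mat d d" "0 \<le> s"
  shows "0 \<le> resolvent_form d s r X"
proof -
  obtain S where S: "S \<in> carrier_mat d d" "r = S * adj S" using psd_factor[OF assms(1)] by blast
  have "adj X * r * X = adj (adj S * X) * (adj S * X)" using S assms(2)
    by (simp add: adj_mult[of _ d d _ d] assoc_mult_mat[of _ d d _ d _ d] mult_carrier_mat[of _ d d _ d])
  then have "0 \<le> Re (mat_trace (adj X * r * X))"
    using mat_trace_gram_nonneg[of "adj S * X" d d] S assms(2) by (simp add: mult_carrier_mat[of _ d d _ d])
  moreover have "0 \<le> s * Re (mat_trace (adj (X - 1\<^sub>m d) * (X - 1\<^sub>m d)))"
    using assms by (intro mult_nonneg_nonneg mat_trace_gram_nonneg[of _ d d]) auto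
  ultimately show ?thesis unfolding resolvent_form_def by linarith
qed

text \<open>Moving the matrix by \<open>D\<close> and the test point by \<open>Z\<close> in opposite
  senses cancels all terms of odd total degree in \<open>D\<close> and \<open>Z\<close>. If
  \<open>r + D\<close> and \<open>r - D\<close> are the two conditional states, the mixed term in
  \<open>D\<close> and \<open>Z\<close> is the gain from conditioning and the terms quadratic in
  \<open>Z\<close> are its price.\<close>

lemma resolvent_form_parallelogram:
  assumes r: "r \<in> carrier_mat d d" and D: "D \<in> carrier_mat d d" "adj D = D"
    and X: "X \<in> carrier_mat d d" and Z: "Z \<in> carrier_mat d d"
  shows "resolvent_form d s (r + D) (X - Z) + resolvent_form d s (r - D) (X + Z) =
    2 * resolvent_form d s r X + 2 * (\<Sum>k<d. \<Sum>m<d. \<Sum>n<d. Re (cnj (Z $$ (n, k)) * r $$ (n, m) * Z $$ (m, k)))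
    + 2 * (\<Sum>k<d. \<Sum>m<d. s * (cmod (Z $$ (m, k)))\<^sup>2)
    - 4 * (\<Sum>k<d. \<Sum>m<d. \<Sum>n<d. Re (cnj (X $$ (n, k)) * D $$ (n, m) * Z $$ (m, k)))"
proof -
  have Ds: "D $$ (n, m) = cnj (D $$ (m, n))" if "n < d" "m < d" for n m
    using D that by (metis adj_index carrier_matD)
  have sym: "(\<Sum>k<d. \<Sum>m<d. \<Sum>n<d. Re (cnj (Z $$ (n, k)) * D $$ (n, m) * X $$ (m, k))) =
      (\<Sum>k<d. \<Sum>m<d. \<Sum>n<d. Re (cnj (X $$ (n, k)) * D $$ (n, m) * Z $$ (m, k)))"
  proof (rule sum.cong[OF refl], subst sum.swap, intro sum.cong refl)
    fix k m n assume "k \<in> {..<d}" "m \<in> {..<d}" "n \<in> {..<d}"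
    then have "D $$ (m, n) = cnj (D $$ (n, m))" by (intro Ds) auto
    then show "Re (cnj (Z $$ (m, k)) * D $$ (m, n) * X $$ (n, k)) = Re (cnj (X $$ (n, k)) * D $$ (n, m) * Z $$ (m, k))"
      by (simp add: algebra_simps)
  qed
  have q: "Re (cnj (x - z) * (a + b) * (x' - z')) + Re (cnj (x + z) * (a - b) * (x' + z')) =
      2 * Re (cnj x * a * x') + 2 * Re (cnj z * a * z') - 2 * Re (cnj x * b * z') - 2 * Re (cnj z * b * x')" for x z a b x' z'
    by (simp add: algebra_simps)
  have e: "s * (cmod (x - z - y))\<^sup>2 + s * (cmod (x + z - y))\<^sup>2 = 2 * (s * (cmod (x - y))\<^sup>2) + 2 * (s * (cmod z)\<^sup>2)" for x y z
    unfolding cmod_power2 by (simp add: algebra_simps power2_eq_square)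
  let ?S3 = "\<lambda>f :: nat \<Rightarrow> nat \<Rightarrow> nat \<Rightarrow> real. \<Sum>k<d. \<Sum>m<d. \<Sum>n<d. f k m n"
  let ?S2 = "\<lambda>f :: nat \<Rightarrow> nat \<Rightarrow> real. \<Sum>k<d. \<Sum>m<d. f k m"
  have "resolvent_form d s (r + D) (X - Z) + resolvent_form d s (r - D) (X + Z) =
    ?S3 (\<lambda>k m n. Re (cnj (X $$ (n, k) - Z $$ (n, k)) * (r $$ (n, m) + D $$ (n, m)) * (X $$ (m, k) - Z $$ (m, k)))
      + Re (cnj (X $$ (n, k) + Z $$ (n, k)) * (r $$ (n, m) - D $$ (n, m)) * (X $$ (m, k) + Z $$ (m, k)))) +
    ?S2 (\<lambda>k m. s * (cmod (X $$ (m, k) - Z $$ (m, k) - (if m = k then 1 else 0)))\<^sup>2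
       + s * (cmod (X $$ (m, k) + Z $$ (m, k) - (if m = k then 1 else 0)))\<^sup>2)"
  proof -
    have c: "r + D \<in> carrier_mat d d" "r - D \<in> carrier_mat d d" "X - Z \<in> carrier_mat d d" "X + Z \<in> carrier_mat d d"
      using r D X Z by auto
    have comm: "(a + b) + (a' + b') = (a + a') + (b + b')" for a b a' b' :: real by simp
    show ?thesis
      unfolding resolvent_form_entries[OF c(1,3)] resolvent_form_entries[OF c(2,4)]
      by (subst comm, unfold sum.distrib[symmetric]) (use r D(1) X Z in \<open>intro arg_cong2[where f = "(+)"] sum.cong refl; simp\<close>)
  qed
  also have "\<dots> = ?S3 (\<lambda>k m n. 2 * Re (cnj (X $$ (n, k)) * r $$ (n, m) * X $$ (m, k))
        + 2 * Re (cnj (Z $$ (n, k)) * r $$ (n, m) * Z $$ (m, k))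
        - 2 * Re (cnj (X $$ (n, k)) * D $$ (n, m) * Z $$ (m, k))
        - 2 * Re (cnj (Z $$ (n, k)) * D $$ (n, m) * X $$ (m, k))) +
     ?S2 (\<lambda>k m. 2 * (s * (cmod (X $$ (m, k) - (if m = k then 1 else 0)))\<^sup>2) + 2 * (s * (cmod (Z $$ (m, k)))\<^sup>2))"
    by (simp only: q e)
  finally show ?thesis
    unfolding resolvent_form_entries[OF r X] sum.distrib sum_subtractf
    by (simp only: sum_distrib_left[symmetric] sym) simp
qed

text \<open>Finds the scale comparable to \<open>a\<close>. Comparability is given up only at the
  last scale, which is where the truncation error of the entropy argument comes from.\<close>

lemma dyadic_scale:
  fixes a :: real
  assumes "a \<le> 1"
  shows "\<exists>j\<le>J. a \<le> 1 / 2 ^ j \<and> (1 / 2 ^ j \<le> 2 * a \<or> j = J)"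
proof (induction J)
  case (Suc J)
  show ?case
  proof (cases "a \<le> 1 / 2 ^ Suc J")
    case False
    then have "1 / 2 ^ J \<le> 2 * a" by (simp add: field_simps)
    with Suc show ?thesis by (metis le_SucI)
  qed auto
qed (use assms in auto)

text \<open>Completing the square: the two sides differ by \<open>(l + s) * (cmod (y - w))^2\<close>
  with \<open>w = s / (l + s)\<close>.\<close>

lemma diagonal_form_ge:
  fixes l s :: real and y :: complex
  assumes "0 \<le> l" "0 < s"
  shows "l * s / (l + s) \<le> l * (cmod y)\<^sup>2 + s * (cmod (y - 1))\<^sup>2"
proof -
  define a b where "a = Re y" and "b = Im y"
  define w where "w = s / (l + s)"
  have "w * (l + s) = s" using assms by (simp add: w_def)
  then have w: "w * l + w * s = s" by (simp add: distrib_left)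
  have "l * (cmod y)\<^sup>2 + s * (cmod (y - 1))\<^sup>2 - l * w = (l + s) * a\<^sup>2 - 2 * a * s + (w * l + w * s) - l * w + (l + s) * b\<^sup>2"
    unfolding cmod_power2 a_def b_def w by (simp add: algebra_simps power2_eq_square)
  also have "\<dots> = (l + s) * a\<^sup>2 - 2 * a * (w * l + w * s) + w * (w * l + w * s) + (l + s) * b\<^sup>2"
    unfolding w using w by (simp add: algebra_simps)
  also have "\<dots> = (l + s) * (a - w)\<^sup>2 + (l + s) * b\<^sup>2" by (simp add: algebra_simps power2_eq_square)
  also have "\<dots> \<ge> 0" using assms by simp
  finally show ?thesis by (simp add: w_def)
qed

lemma diagonal_form_eq:
  fixes l s :: real
  assumes "0 \<le> l" "0 < s"
  shows "l * (s / (l + s))\<^sup>2 + s * (s / (l + s) - 1)\<^sup>2 = l * s / (l + s)"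
proof -
  define w where "w = s / (l + s)"
  have w: "(l + s) * w = s" using assms by (simp add: w_def)
  have "l * w\<^sup>2 + s * (w - 1)\<^sup>2 = ((l + s) * w) * w - 2 * s * w + s" by (simp add: algebra_simps power2_eq_square)
  also have "\<dots> = (l + s) * w - s * w" unfolding w by simp
  also have "\<dots> = l * w" by (simp add: algebra_simps)
  finally show ?thesis by (simp add: w_def)
qed

lemma resolvent_form_diag:
  assumes r: "r = mat d d (\<lambda>(i, j). if i = j then complex_of_real (l i) else 0)" and X: "X \<in> carrier_mat d d"
  shows "(\<Sum>k<d. \<Sum>m<d. \<Sum>n<d. Re (cnj (X $$ (n, k)) * r $$ (n, m) * X $$ (m, k))) = (\<Sum>k<d. \<Sum>m<d. l m * (cmod (X $$ (m, k)))\<^sup>2)"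
proof (intro sum.cong refl)
  fix k m assume "k \<in> {..<d}" "m \<in> {..<d}"
  then have km: "k < d" "m < d" by auto
  have q: "Re (cnj x * complex_of_real c * x) = c * (cmod x)\<^sup>2" for c x
    unfolding cmod_power2 by (simp add: algebra_simps power2_eq_square)
  have "(\<Sum>n<d. Re (cnj (X $$ (n, k)) * r $$ (n, m) * X $$ (m, k))) = (\<Sum>n<d. if n = m then l m * (cmod (X $$ (m, k)))\<^sup>2 else 0)"
    using km q by (intro sum.cong) (auto simp: r)
  also have "\<dots> = l m * (cmod (X $$ (m, k)))\<^sup>2" using km by simp
  finally show "(\<Sum>n<d. Re (cnj (X $$ (n, k)) * r $$ (n, m) * X $$ (m, k))) = l m * (cmod (X $$ (m, k)))\<^sup>2" .
qed

text \<open>For diagonal \<open>r\<close> the form is a sum over the entries of \<open>X\<close>: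
  off-diagonal entries only add cost, and every diagonal entry is the scalar problem solved
  above.\<close>

lemma resolvent_form_diag_min:
  assumes r: "r = mat d d (\<lambda>(i, j). if i = j then complex_of_real (l i) else 0)" and l: "\<And>i. i < d \<Longrightarrow> 0 \<le> l i"
    and s: "0 < s" and X: "X \<in> carrier_mat d d"
  shows "resolvent_form d s r (mat d d (\<lambda>(i, j). if i = j then complex_of_real (s / (l i + s)) else 0)) \<le> resolvent_form d s r X"
proof -
  let ?X = "mat d d (\<lambda>(i, j). if i = j then complex_of_real (s / (l i + s)) else 0)"
  have c: "r \<in> carrier_mat d d" "?X \<in> carrier_mat d d" by (auto simp: r)
  have *: "l m * (cmod (?X $$ (m, k)))\<^sup>2 + s * (cmod (?X $$ (m, k) - (if m = k then 1 else 0)))\<^sup>2 \<le>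
     l m * (cmod (X $$ (m, k)))\<^sup>2 + s * (cmod (X $$ (m, k) - (if m = k then 1 else 0)))\<^sup>2" if "k < d" "m < d" for k m
  proof (cases "m = k")
    case True
    have "l k * (cmod (?X $$ (k, k)))\<^sup>2 + s * (cmod (?X $$ (k, k) - 1))\<^sup>2 = l k * s / (l k + s)"
      using that diagonal_form_eq[of "l k" s] s l[of k] unfolding cmod_power2 by simp
    then show ?thesis using True diagonal_form_ge[of "l k" s "X $$ (k, k)"] l[of k] s that by simp
  qed (use that l[of m] s in auto)
  show ?thesis
    unfolding resolvent_form_entries[OF c(1) X] resolvent_form_entries[OF c] resolvent_form_diag[OF r X] resolvent_form_diag[OF r c(2)]
      sum.distrib[symmetric]
    by (intro sum_mono *) auto
qed

text \<open>The conditioning step in an eigenbasis of the mean state \<open>r\<close>;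
  \<open>r + E\<close> and \<open>r - E\<close> are the conditional states, and \<open>g0\<close>,
  \<open>g1\<close> bound their functionals from below. With \<open>1 / c\<close> in place of the
  factor \<open>1 / 64\<close> in \<open>Z\<close>, the cross term would yield
  \<open>2 * p / c\<close> at a cost of at most \<open>64 * p / c^2\<close>, up to truncation;
  \<open>c = 64\<close> maximises the difference. The subtracted term pays for entries of
  \<open>D\<close> whose two eigenvalues are small against the last scale.\<close>

lemma entropy_step_diag:
  fixes l :: "nat \<Rightarrow> real"
  assumes r: "r = mat d d (\<lambda>(i, j). if i = j then complex_of_real (l i) else 0)"
    and l: "\<And>i. i < d \<Longrightarrow> 0 \<le> l i \<and> l i \<le> 1"
    and E: "E \<in> carrier_mat d d" "adj E = E" and D: "D \<in> carrier_mat d d" "adj D = D"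
    and p: "p = Re (mat_trace (D * E))" and DDr: "Re (mat_trace (D * D * r)) \<le> 2 * p"
    and DD: "Re (mat_trace (D * D)) \<le> 4 * real d"
    and g0: "\<And>Y. (\<And>j. Y j \<in> carrier_mat d d) \<Longrightarrow> g0 \<le> (\<Sum>j\<le>J. resolvent_form d (1 / 2 ^ j) (r + E) (Y j))"
    and g1: "\<And>Y. (\<And>j. Y j \<in> carrier_mat d d) \<Longrightarrow> g1 \<le> (\<Sum>j\<le>J. resolvent_form d (1 / 2 ^ j) (r - E) (Y j))"
    and Y: "\<And>j. Y j \<in> carrier_mat d d"
  shows "(g0 + g1) / 2 + p / 64 - real d / 2 ^ J / 128 \<le> (\<Sum>j\<le>J. resolvent_form d (1 / 2 ^ j) r (Y j))"
proof -
  have "\<forall>k m. \<exists>j. k < d \<and> m < d \<longrightarrow> j \<le> J \<and> l k \<le> 1 / 2 ^ j \<and> l m \<le> 1 / 2 ^ j \<and> 1 / 2 ^ j \<le> 2 * l k + 2 * l m + 1 / 2 ^ J"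
  proof (intro allI)
    fix k m
    show "\<exists>j. k < d \<and> m < d \<longrightarrow> j \<le> J \<and> l k \<le> 1 / 2 ^ j \<and> l m \<le> 1 / 2 ^ j \<and> 1 / 2 ^ j \<le> 2 * l k + 2 * l m + 1 / 2 ^ J"
    proof (cases "k < d \<and> m < d")
      case True
      then obtain j where j: "j \<le> J" "max (l k) (l m) \<le> 1 / 2 ^ j" "1 / 2 ^ j \<le> 2 * max (l k) (l m) \<or> j = J"
        using dyadic_scale[of "max (l k) (l m)" J] l[of k] l[of m] by (meson max.bounded_iff)
      have "1 / 2 ^ j \<le> 2 * l k + 2 * l m + (1 / 2 ^ J :: real)"
        using j(3) l[of k] l[of m] True by (auto simp: max_def split: if_splits intro: add_increasing2)
      then show ?thesis using j by auto
    qed auto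
  qed
  then obtain jj where jj: "\<And>k m. k < d \<Longrightarrow> m < d \<Longrightarrow> jj k m \<le> J \<and> l k \<le> 1 / 2 ^ jj k m \<and> l m \<le> 1 / 2 ^ jj k m
      \<and> 1 / 2 ^ jj k m \<le> 2 * l k + 2 * l m + 1 / 2 ^ J"
    by metis
  define s :: "nat \<Rightarrow> real" where "s j = 1 / 2 ^ j" for j
  have s: "0 < s j" for j by (simp add: s_def)
  define X where "X j = mat d d (\<lambda>(i, k). if i = k then complex_of_real (s j / (l i + s j)) else 0)" for j
  text \<open>Perturbing the minimiser \<open>X j\<close> by \<open>\<plusminus> Z j\<close> gains \<open>2 Re tr (X E Z)\<close> to first order. Each entry of \<open>D\<close> enters
    at the single scale \<open>s j\<close> comparable to the larger of its two eigenvalues, where the quadratic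
    cost is proportional to that eigenvalue and hence sums to \<open>O(tr (D * D * r))\<close>.\<close>
  define Z where "Z j = mat d d (\<lambda>(m, k). if j = jj k m then complex_of_real ((l k + s j) / s j / 64) * D $$ (m, k) else 0)" for j
  have rc: "r \<in> carrier_mat d d" and Xc: "X j \<in> carrier_mat d d" and Zc: "Z j \<in> carrier_mat d d" for j
    by (auto simp: r X_def Z_def)
  have cross: "(\<Sum>j\<le>J. \<Sum>k<d. \<Sum>m<d. \<Sum>n<d. Re (cnj (X j $$ (n, k)) * E $$ (n, m) * Z j $$ (m, k))) = p / 64"
  proof -
    have 1: "(\<Sum>n<d. Re (cnj (X j $$ (n, k)) * E $$ (n, m) * Z j $$ (m, k))) = (if j = jj k m then Re (D $$ (m, k) * E $$ (k, m)) / 64 else 0)"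
      if "k < d" "m < d" for j k m
    proof -
      have X0: "X j $$ (n, k) = 0" if "n < d" "n \<noteq> k" for n using that \<open>k < d\<close> by (simp add: X_def)
      have "(\<Sum>n<d. Re (cnj (X j $$ (n, k)) * E $$ (n, m) * Z j $$ (m, k))) =
         (\<Sum>n<d. if n = k then Re (cnj (X j $$ (k, k)) * E $$ (k, m) * Z j $$ (m, k)) else 0)"
        by (intro sum.cong) (auto simp: X0)
      also have "\<dots> = Re (cnj (X j $$ (k, k)) * E $$ (k, m) * Z j $$ (m, k))" using that by (simp only: sum.delta finite_lessThan lessThan_iff if_True)
      also have "\<dots> = (if j = jj k m then Re (D $$ (m, k) * E $$ (k, m)) / 64 else 0)"
      proof (cases "j = jj k m")
        case True
        \<comment> \<open>The weight \<open>(l k + s j) / s j\<close> in \<open>Z\<close> is the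
          reciprocal of the diagonal entry of \<open>X\<close>, so the products of entries of
          \<open>D\<close> and \<open>E\<close> come out with equal weights.\<close>
        have "s j / (l k + s j) * ((l k + s j) / s j / 64) = 1 / 64" using s[of j] l[of k] that
          by (simp add: add_nonneg_eq_0_iff less_imp_le)
        then have xz: "complex_of_real (s j / (l k + s j)) * complex_of_real ((l k + s j) / s j / 64) = complex_of_real (1 / 64)"
          unfolding of_real_mult[symmetric] by simp
        have "X j $$ (k, k) = complex_of_real (s j / (l k + s j))" using that by (simp add: X_def)
        moreover have "Z j $$ (m, k) = complex_of_real ((l k + s j) / s j / 64) * D $$ (m, k)"
          using that True by (simp add: Z_def)
        ultimately have "cnj (X j $$ (k, k)) * E $$ (k, m) * Z j $$ (m, k) =
            (complex_of_real (s j / (l k + s j)) * complex_of_real ((l k + s j) / s j / 64)) * (D $$ (m, k) * E $$ (k, m))"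
          by (simp only: complex_cnj_complex_of_real mult_ac)
        also have "\<dots> = complex_of_real (1 / 64) * (D $$ (m, k) * E $$ (k, m))" unfolding xz ..
        also have "Re (complex_of_real (1 / 64) * (D $$ (m, k) * E $$ (k, m))) = Re (D $$ (m, k) * E $$ (k, m)) / 64" by simp
        finally show ?thesis using True by simp
      qed (use that in \<open>simp add: Z_def\<close>)
      finally show ?thesis .
    qed
    have "(\<Sum>j\<le>J. \<Sum>k<d. \<Sum>m<d. \<Sum>n<d. Re (cnj (X j $$ (n, k)) * E $$ (n, m) * Z j $$ (m, k))) =
        (\<Sum>j\<le>J. \<Sum>k<d. \<Sum>m<d. (if j = jj k m then Re (D $$ (m, k) * E $$ (k, m)) / 64 else 0))"
      by (intro sum.cong refl 1) auto
    also have "\<dots> = (\<Sum>k<d. \<Sum>m<d. \<Sum>j\<le>J. (if j = jj k m then Re (D $$ (m, k) * E $$ (k, m)) / 64 else 0))"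
      by (subst sum.swap) (intro sum.cong refl sum.swap)
    also have "\<dots> = (\<Sum>k<d. \<Sum>m<d. Re (D $$ (m, k) * E $$ (k, m)) / 64)"
      using jj by (intro sum.cong) auto
    also have "\<dots> = p / 64"
      unfolding p mat_trace_mult[OF D(1) E(1)]
      by (subst sum.swap) (simp add: sum_divide_distrib)
    finally show ?thesis .
  qed
  have cost: "(\<Sum>j\<le>J. (\<Sum>k<d. \<Sum>m<d. l m * (cmod (Z j $$ (m, k)))\<^sup>2) + (\<Sum>k<d. \<Sum>m<d. s j * (cmod (Z j $$ (m, k)))\<^sup>2))
      \<le> p / 64 + real d / 2 ^ J / 128"
  proof -
    let ?c = "\<lambda>m k. (cmod (D $$ (m, k)))\<^sup>2"
    have "(\<Sum>j\<le>J. (\<Sum>k<d. \<Sum>m<d. l m * (cmod (Z j $$ (m, k)))\<^sup>2) + (\<Sum>k<d. \<Sum>m<d. s j * (cmod (Z j $$ (m, k)))\<^sup>2))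
        = (\<Sum>j\<le>J. \<Sum>k<d. \<Sum>m<d. (l m + s j) * (cmod (Z j $$ (m, k)))\<^sup>2)"
      by (simp add: distrib_right sum.distrib)
    also have "\<dots> = (\<Sum>k<d. \<Sum>m<d. \<Sum>j\<le>J. (l m + s j) * (cmod (Z j $$ (m, k)))\<^sup>2)"
      by (subst sum.swap) (intro sum.cong refl sum.swap)
    also have "\<dots> \<le> (\<Sum>k<d. \<Sum>m<d. (2 * l k + 2 * l m + 1 / 2 ^ J) * ?c m k / 512)"
    proof (intro sum_mono)
      fix k m assume "k \<in> {..<d}" "m \<in> {..<d}"
      then have km: "k < d" "m < d" by auto
      define t where "t = s (jj k m)"
      have t: "0 < t" "l k \<le> t" "l m \<le> t" "t \<le> 2 * l k + 2 * l m + 1 / 2 ^ J" and lk: "0 \<le> l k" "0 \<le> l m"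
        using jj[OF km] s l km by (auto simp: t_def s_def)
      have "(\<Sum>j\<le>J. (l m + s j) * (cmod (Z j $$ (m, k)))\<^sup>2) =
          (\<Sum>j\<le>J. if j = jj k m then (l m + t) * (((l k + t) / t / 64)\<^sup>2 * ?c m k) else 0)"
      proof (intro sum.cong refl)
        fix j
        have "cmod (Z (jj k m) $$ (m, k)) = cmod (complex_of_real ((l k + t) / t / 64)) * cmod (D $$ (m, k))"
          unfolding norm_mult[symmetric] using km by (simp add: Z_def t_def)
        also have "cmod (complex_of_real ((l k + t) / t / 64)) = (l k + t) / t / 64"
          unfolding norm_of_real using t lk by simp
        finally have "(cmod (Z (jj k m) $$ (m, k)))\<^sup>2 = ((l k + t) / t / 64)\<^sup>2 * ?c m k"
          by (simp only: power_mult_distrib)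
        then show "(l m + s j) * (cmod (Z j $$ (m, k)))\<^sup>2 =
            (if j = jj k m then (l m + t) * (((l k + t) / t / 64)\<^sup>2 * ?c m k) else 0)"
          using km by (cases "j = jj k m") (simp_all add: t_def, simp add: Z_def)
      qed
      also have "\<dots> = ((l m + t) * ((l k + t) / t / 64)\<^sup>2) * ?c m k" using jj[OF km] by simp
      also have "\<dots> \<le> (t / 512) * ?c m k"
      proof (rule mult_right_mono)
        \<comment> \<open>At the selected scale both eigenvalues are at most \<open>t\<close>, so
          \<open>l k + t\<close> and \<open>l m + t\<close> are at most \<open>2 * t\<close>, and
          the cost per entry is at most \<open>2 * t * (1 / 32)^2 = t / 512\<close>.\<close>
        have "(l k + t) / t / 64 \<le> 1 / 32" using t lk by (simp add: field_simps)
        then have "((l k + t) / t / 64)\<^sup>2 \<le> (1 / 32)\<^sup>2" using t lk by (intro power_mono) auto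
        then have "(l m + t) * ((l k + t) / t / 64)\<^sup>2 \<le> (2 * t) * (1 / 32)\<^sup>2" using t lk by (intro mult_mono) auto
        then show "(l m + t) * ((l k + t) / t / 64)\<^sup>2 \<le> t / 512" by (simp add: power2_eq_square)
      qed auto
      also have "\<dots> \<le> (2 * l k + 2 * l m + 1 / 2 ^ J) / 512 * ?c m k" using t by (intro mult_right_mono) auto
      finally show "(\<Sum>j\<le>J. (l m + s j) * (cmod (Z j $$ (m, k)))\<^sup>2) \<le> (2 * l k + 2 * l m + 1 / 2 ^ J) * ?c m k / 512" by simp
    qed
    also have "\<dots> = ((\<Sum>k<d. \<Sum>m<d. l k * ?c m k) + (\<Sum>k<d. \<Sum>m<d. l m * ?c m k)) / 256 + (\<Sum>k<d. \<Sum>m<d. ?c m k) / 512 / 2 ^ J"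
    proof -
      have "(\<Sum>k<d. \<Sum>m<d. (2 * l k + 2 * l m + 1 / 2 ^ J) * ?c m k / 512) =
          (\<Sum>k<d. \<Sum>m<d. l k * ?c m k / 256 + l m * ?c m k / 256 + ?c m k / 512 / 2 ^ J)"
        by (intro sum.cong refl) (simp add: algebra_simps)
      then show ?thesis by (simp only: sum.distrib sum_divide_distrib add_divide_distrib)
    qed
    also have "(\<Sum>k<d. \<Sum>m<d. l k * ?c m k) = (\<Sum>k<d. \<Sum>m<d. l m * ?c m k)"
    proof (subst sum.swap, intro sum.cong refl)
      fix m k assume "m \<in> {..<d}" "k \<in> {..<d}"
      then have "D $$ (m, k) = cnj (D $$ (k, m))" using D adj_index[of m D k] by auto
      then show "l m * ?c k m = l m * ?c m k" by simp
    qed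
    also have "(\<Sum>k<d. \<Sum>m<d. l m * ?c m k) = Re (mat_trace (D * D * r))"
    proof -
      have "mat_trace (D * D * r) = mat_trace (D * r * D)"
        using D(1) rc mat_trace_comm[of "D * r" d d D] mat_trace_comm[of D d d "D * r"] by (simp add: assoc_mult_mat[of _ d d _ d _ d])
      then show ?thesis using resolvent_form_diag[OF r D(1)] mat_trace_mult3[OF D(1) rc D(1)] D
        by (auto simp flip: adj_index intro!: sum.cong)
    qed
    also have "(\<Sum>k<d. \<Sum>m<d. ?c m k) = Re (mat_trace (D * D))"
      using mat_trace_gram[OF D(1)] D(2) by simp
    also have "(Re (mat_trace (D * D * r)) + Re (mat_trace (D * D * r))) / 256 + Re (mat_trace (D * D)) / 512 / 2 ^ J
        \<le> (2 * p + 2 * p) / 256 + 4 * real d / 512 / 2 ^ J"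
      using DDr DD by (intro add_mono divide_right_mono) auto
    finally show ?thesis by simp
  qed
  define C where "C j = (\<Sum>k<d. \<Sum>m<d. l m * (cmod (Z j $$ (m, k)))\<^sup>2) + (\<Sum>k<d. \<Sum>m<d. s j * (cmod (Z j $$ (m, k)))\<^sup>2)" for j
  define K where "K j = (\<Sum>k<d. \<Sum>m<d. \<Sum>n<d. Re (cnj (X j $$ (n, k)) * E $$ (n, m) * Z j $$ (m, k)))" for j
  have "g0 + g1 \<le> (\<Sum>j\<le>J. resolvent_form d (s j) (r + E) (X j - Z j)) + (\<Sum>j\<le>J. resolvent_form d (s j) (r - E) (X j + Z j))"
    unfolding s_def by (intro add_mono g0 g1) (simp_all add: minus_carrier_mat[OF Zc] add_carrier_mat[OF Zc])
  also have "\<dots> = (\<Sum>j\<le>J. 2 * resolvent_form d (s j) r (X j) + 2 * C j - 4 * K j)"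
    unfolding sum.distrib[symmetric] C_def K_def
    by (intro sum.cong refl) (simp only: resolvent_form_parallelogram[OF rc E Xc Zc] resolvent_form_diag[OF r Zc] distrib_left, simp)
  also have "\<dots> = 2 * (\<Sum>j\<le>J. resolvent_form d (s j) r (X j)) + 2 * (\<Sum>j\<le>J. C j) - 4 * (\<Sum>j\<le>J. K j)"
    by (simp only: sum.distrib sum_subtractf sum_distrib_left)
  finally have "g0 + g1 \<le> \<dots>" .
  moreover have "(\<Sum>j\<le>J. resolvent_form d (s j) r (X j)) \<le> (\<Sum>j\<le>J. resolvent_form d (s j) r (Y j))"
    unfolding X_def using l s Y by (intro sum_mono resolvent_form_diag_min[OF r]) auto
  moreover have "(\<Sum>j\<le>J. C j) \<le> p / 64 + real d / 2 ^ J / 128" using cost by (simp only: C_def)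
  moreover have "(\<Sum>j\<le>J. K j) = p / 64" using cross by (simp only: K_def)
  ultimately have "(g0 + g1) / 2 + p / 64 - real d / 2 ^ J / 128 \<le> (\<Sum>j\<le>J. resolvent_form d (s j) r (Y j))"
    by argo
  then show ?thesis by (simp only: s_def)
qed

section \<open>Unambiguous detection of bits\<close>

lemma psd_add:
  assumes "psd d A" "psd d B"
  shows "psd d (A + B)"
  unfolding psd_def
proof (intro conjI ballI)
  fix v :: "complex vec" assume v: "v \<in> carrier_vec d"
  have "((A + B) *\<^sub>v v) \<bullet>c v = (A *\<^sub>v v) \<bullet>c v + (B *\<^sub>v v) \<bullet>c v"
    using assms v by (simp add: psd_def add_mult_distrib_mat_vec[of _ d d] mult_mat_vec_carrier[of _ d d]
        add_scalar_prod_distrib[of _ d _ "conjugate v"])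
  then show "0 \<le> ((A + B) *\<^sub>v v) \<bullet>c v" using assms v by (simp add: psd_def)
qed (use assms in \<open>auto simp: psd_def\<close>)

lemma psd_smult:
  assumes "psd d A" "0 \<le> c"
  shows "psd d (complex_of_real c \<cdot>\<^sub>m A)"
  unfolding psd_def
proof (intro conjI ballI)
  fix v :: "complex vec" assume v: "v \<in> carrier_vec d"
  have "((complex_of_real c \<cdot>\<^sub>m A) *\<^sub>v v) \<bullet>c v = complex_of_real c * ((A *\<^sub>v v) \<bullet>c v)"
    using assms v by (auto simp: psd_def scalar_prod_def sum_distrib_left mult_ac intro!: sum.cong)
  moreover have "0 \<le> (A *\<^sub>v v) \<bullet>c v" using assms v by (simp add: psd_def)
  ultimately show "0 \<le> ((complex_of_real c \<cdot>\<^sub>m A) *\<^sub>v v) \<bullet>c v" using assms(2) by (simp add: less_eq_complex_def)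
qed (use assms in \<open>auto simp: psd_def\<close>)

lemma mat_trace_smult: "mat_trace (c \<cdot>\<^sub>m A) = c * mat_trace A" if "A \<in> carrier_mat d d"
  using that by (auto simp: mat_trace_def sum_distrib_left)

lemma mat_trace_conj:
  assumes U: "U \<in> carrier_mat d d" "U * adj U = 1\<^sub>m d" and A: "A \<in> carrier_mat d d"
  shows "mat_trace (adj U * A * U) = mat_trace A"
proof -
  have "mat_trace (adj U * A * U) = mat_trace (U * (adj U * A))"
    using U A by (intro mat_trace_comm[of _ d d]) auto
  also have "U * (adj U * A) = A" using U A by (simp flip: assoc_mult_mat[of _ d d _ d _ d])
  finally show ?thesis .
qed

lemma conj_mult:
  assumes U: "U \<in> carrier_mat d d" "U * adj U = 1\<^sub>m d" and A: "A \<in> carrier_mat d d" and B: "B \<in> carrier_mat d d"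
  shows "(adj U * A * U) * (adj U * B * U) = adj U * (A * B) * U"
proof -
  have "(adj U * A * U) * (adj U * B * U) = adj U * A * (U * adj U) * (B * U)"
    using U(1) A B by (simp add: assoc_mult_mat[of _ d d _ d _ d] mult_carrier_mat[of _ d d _ d])
  also have "\<dots> = adj U * (A * B) * U"
    unfolding U(2) using U(1) A B by (simp add: assoc_mult_mat[of _ d d _ d _ d] mult_carrier_mat[of _ d d _ d])
  finally show ?thesis .
qed

lemma resolvent_form_conj:
  assumes U: "U \<in> carrier_mat d d" "adj U * U = 1\<^sub>m d" "U * adj U = 1\<^sub>m d"
    and A: "A \<in> carrier_mat d d" and Y: "Y \<in> carrier_mat d d"
  shows "resolvent_form d s (adj U * A * U) (adj U * Y * U) = resolvent_form d s A Y"
proof -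
  have adj_conj: "adj (adj U * B * U) = adj U * adj B * U" if "B \<in> carrier_mat d d" for B
    using that U(1) by (simp add: adj_mult[of _ d d _ d] assoc_mult_mat[of _ d d _ d _ d] mult_carrier_mat[of _ d d _ d])
  have 1: "adj U * Y * U - 1\<^sub>m d = adj U * (Y - 1\<^sub>m d) * U"
    using U Y by (simp add: mult_minus_distrib_mat[of _ d d _ d] minus_mult_distrib_mat[of _ d d _ _ d] mult_carrier_mat[of _ d d _ d])
  have Y1: "Y - 1\<^sub>m d \<in> carrier_mat d d" by (intro minus_carrier_mat) auto
  show ?thesis
    unfolding resolvent_form_def 1 adj_conj[OF Y] adj_conj[OF Y1]
      conj_mult[OF U(1,3) adj_carrier[OF Y1] Y1] conj_mult[OF U(1,3) adj_carrier[OF Y] A]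
      conj_mult[OF U(1,3) mult_carrier_mat[OF adj_carrier[OF Y] A] Y]
    using Y Y1 A by (simp add: mat_trace_conj[OF U(1,3)] mult_carrier_mat[of _ d d _ d])
qed

lemma projector_trace_le:
  assumes P: "P \<in> carrier_mat d d" "adj P = P" "P * P = P"
  shows "Re (mat_trace P) \<le> real d"
proof -
  have c: "1\<^sub>m d - P \<in> carrier_mat d d" using P by (intro minus_carrier_mat) auto
  have "adj (1\<^sub>m d - P) * (1\<^sub>m d - P) = 1\<^sub>m d - P"
  proof -
    have "adj (1\<^sub>m d - P) * (1\<^sub>m d - P) = (1\<^sub>m d - P) * (1\<^sub>m d - P)" using P by (simp add: adj_minus[of _ d d])
    also have "\<dots> = 1\<^sub>m d * (1\<^sub>m d - P) - P * (1\<^sub>m d - P)" using P by (intro minus_mult_distrib_mat[of _ d d]) auto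
    also have "P * (1\<^sub>m d - P) = P - P" using P by (simp add: mult_minus_distrib_mat[of _ d d _ d])
    also have "1\<^sub>m d * (1\<^sub>m d - P) = 1\<^sub>m d - P" by (rule left_mult_one_mat[OF c])
    also have "(1\<^sub>m d - P) - (P - P) = 1\<^sub>m d - P" using P by (intro eq_matI) auto
    finally show ?thesis .
  qed
  then have "0 \<le> Re (mat_trace (1\<^sub>m d - P))" using mat_trace_gram_nonneg[OF c] by simp
  also have "mat_trace (1\<^sub>m d - P) = of_nat d - mat_trace P"
    using P by (subst mat_trace_minus[of _ d]) (auto simp: mat_trace_def)
  finally show ?thesis by simp
qed

text \<open>Since each projector annihilates the other state, both \<open>tr (D * E)\<close> and
  \<open>tr (F * r)\<close>, for \<open>D = P0 - P1\<close> and \<open>F = P0 + P1\<close>, equal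
  the mean detection probability \<open>p\<close>. The two projectors may fail to commute; the
  identity \<open>D * D = 2 * F - F * F\<close> still gives
  \<open>tr (D * D * r) \<le> 2 * p\<close>, which is what the diagonal version consumes.\<close>

lemma entropy_step:
  assumes r0: "density_matrix d r0" and r1: "density_matrix d r1"
    and P0: "P0 \<in> carrier_mat d d" "adj P0 = P0" "P0 * P0 = P0" and P1: "P1 \<in> carrier_mat d d" "adj P1 = P1" "P1 * P1 = P1"
    and z: "P0 * r1 = 0\<^sub>m d d" "P1 * r0 = 0\<^sub>m d d"
    and g0: "\<And>Y. (\<And>j. Y j \<in> carrier_mat d d) \<Longrightarrow> g0 \<le> (\<Sum>j\<le>J. resolvent_form d (1 / 2 ^ j) r0 (Y j))"
    and g1: "\<And>Y. (\<And>j. Y j \<in> carrier_mat d d) \<Longrightarrow> g1 \<le> (\<Sum>j\<le>J. resolvent_form d (1 / 2 ^ j) r1 (Y j))"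
    and Y: "\<And>j. Y j \<in> carrier_mat d d"
  shows "(g0 + g1) / 2 + (Re (mat_trace (P0 * r0)) + Re (mat_trace (P1 * r1))) / 2 / 64 - real d / 2 ^ J / 128
     \<le> (\<Sum>j\<le>J. resolvent_form d (1 / 2 ^ j) ((1 / 2) \<cdot>\<^sub>m (r0 + r1)) (Y j))"
proof -
  define r where "r = (1 / 2) \<cdot>\<^sub>m (r0 + r1)"
  define E where "E = (1 / 2) \<cdot>\<^sub>m (r0 - r1)"
  define D where "D = P0 - P1"
  define F where "F = P0 + P1"
  define p where "p = (Re (mat_trace (P0 * r0)) + Re (mat_trace (P1 * r1))) / 2"
  have rc: "r0 \<in> carrier_mat d d" "r1 \<in> carrier_mat d d" using r0 r1 by (auto simp: density_matrix_def psd_def)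
  have psd_r: "psd d r" using psd_smult[OF psd_add, of d r0 r1 "1/2"] r0 r1 by (simp add: r_def density_matrix_def)
  have tr_r: "mat_trace r = 1" using r0 r1 rc
    by (simp add: r_def mat_trace_smult[of _ d] mat_trace_add[of _ d] density_matrix_def)
  note carr = mult_carrier_mat[of _ d d _ d] minus_carrier_mat[of _ d d] add_carrier_mat[of _ d d]
  have c: "r \<in> carrier_mat d d" "E \<in> carrier_mat d d" "D \<in> carrier_mat d d" "F \<in> carrier_mat d d"
    using rc P0 P1 by (auto simp: r_def E_def D_def F_def intro!: minus_carrier_mat add_carrier_mat)
  have rE: "r + E = r0" "r - E = r1" using rc by (auto simp: r_def E_def field_simps intro!: eq_matI)
  have herm: "adj E = E"
  proof -
    have h: "adj r0 = r0" "adj r1 = r1" using r0 r1 psd_hermitian by (auto simp: density_matrix_def)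
    have "adj E = (1 / 2) \<cdot>\<^sub>m adj (r0 - r1)" using rc by (auto simp: E_def intro!: eq_matI)
    then show ?thesis using h rc by (simp add: E_def adj_minus[of _ d d])
  qed
  have hD: "adj D = D" and hF: "adj F = F" using P0 P1 by (simp_all add: D_def F_def adj_minus[of _ d d] adj_add[of _ d d])
  have P0E: "P0 * E = (1 / 2) \<cdot>\<^sub>m (P0 * r0)" "P0 * r = (1 / 2) \<cdot>\<^sub>m (P0 * r0)"
  proof -
    have "P0 * E = (1 / 2) \<cdot>\<^sub>m (P0 * r0 - P0 * r1)" "P0 * r = (1 / 2) \<cdot>\<^sub>m (P0 * r0 + P0 * r1)"
      unfolding E_def r_def using P0 rc
      by (simp_all add: mult_smult_distrib[of _ d d _ d] carr mult_minus_distrib_mat[of _ d d _ d] mult_add_distrib_mat[of _ d d _ d])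
    then show "P0 * E = (1 / 2) \<cdot>\<^sub>m (P0 * r0)" "P0 * r = (1 / 2) \<cdot>\<^sub>m (P0 * r0)"
      unfolding z using P0 rc by (auto intro!: eq_matI)
  qed
  have P1E: "P1 * E = - ((1 / 2) \<cdot>\<^sub>m (P1 * r1))" "P1 * r = (1 / 2) \<cdot>\<^sub>m (P1 * r1)"
  proof -
    have "P1 * E = (1 / 2) \<cdot>\<^sub>m (P1 * r0 - P1 * r1)" "P1 * r = (1 / 2) \<cdot>\<^sub>m (P1 * r0 + P1 * r1)"
      unfolding E_def r_def using P1 rc
      by (simp_all add: mult_smult_distrib[of _ d d _ d] carr mult_minus_distrib_mat[of _ d d _ d] mult_add_distrib_mat[of _ d d _ d])
    then show "P1 * E = - ((1 / 2) \<cdot>\<^sub>m (P1 * r1))" "P1 * r = (1 / 2) \<cdot>\<^sub>m (P1 * r1)"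
      unfolding z using P1 rc by (auto intro!: eq_matI)
  qed
  have tF: "Re (mat_trace (F * r)) = p"
    using P0 P1 rc c by (simp add: F_def add_mult_distrib_mat[of _ d d _ _ d] mat_trace_add[of _ d] P0E P1E mat_trace_smult[of _ d] p_def carr)
  have tDE: "Re (mat_trace (D * E)) = p"
  proof -
    have "D * E = P0 * E - P1 * E" using P0 P1 c by (simp add: D_def minus_mult_distrib_mat[of _ d d _ _ d])
    also have "\<dots> = (1 / 2) \<cdot>\<^sub>m (P0 * r0) + (1 / 2) \<cdot>\<^sub>m (P1 * r1)"
      unfolding P0E P1E using P0 P1 rc by (auto intro!: eq_matI)
    finally show ?thesis using P0 P1 rc by (simp add: mat_trace_add[of _ d] mat_trace_smult[of _ d] p_def carr)
  qed
  have DDFF: "D * D = 2 \<cdot>\<^sub>m F - F * F"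
  proof -
    have e: "D * D = P0 - P0 * P1 - (P1 * P0 - P1)" "F * F = P0 + P0 * P1 + (P1 * P0 + P1)"
      unfolding D_def F_def using P0 P1
      by (simp_all add: minus_mult_distrib_mat[of _ d d _ _ d] mult_minus_distrib_mat[of _ d d _ d]
          add_mult_distrib_mat[of _ d d _ _ d] mult_add_distrib_mat[of _ d d _ d] carr)
         (auto intro!: eq_matI)
    show ?thesis unfolding e unfolding F_def using P0 P1
      by (intro eq_matI) (auto simp: algebra_simps)
  qed
  have FF: "psd d (F * F)" using psd_gram[OF c(4)] hF by simp
  have DDr: "Re (mat_trace (D * D * r)) \<le> 2 * p"
  proof -
    have "D * D * r = 2 \<cdot>\<^sub>m (F * r) - F * F * r" unfolding DDFF using c
      by (simp add: minus_mult_distrib_mat[of _ d d _ _ d] mult_smult_assoc_mat[of _ d d _ d] carr)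
    then have "Re (mat_trace (D * D * r)) = 2 * p - Re (mat_trace (F * F * r))"
      using c by (simp add: mat_trace_minus[of _ d] mat_trace_smult[of _ d] carr tF)
    then show ?thesis using psd_trace_mult_nonneg[OF FF psd_r] by simp
  qed
  have DD: "Re (mat_trace (D * D)) \<le> 4 * real d"
  proof -
    have "Re (mat_trace (D * D)) = 2 * (Re (mat_trace P0) + Re (mat_trace P1)) - Re (mat_trace (F * F))"
      unfolding DDFF using c P0 P1 by (simp add: mat_trace_minus[of _ d] mat_trace_smult[of _ d] carr, simp add: F_def mat_trace_add[of _ d])
    moreover have "0 \<le> Re (mat_trace (F * F))" using mat_trace_gram_nonneg[OF c(4)] hF by simp
    ultimately show ?thesis using projector_trace_le[OF P0] projector_trace_le[OF P1] by argo
  qed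
  obtain U l where U: "U \<in> carrier_mat d d" "adj U * U = 1\<^sub>m d" "U * adj U = 1\<^sub>m d"
    and dg: "adj U * r * U = mat d d (\<lambda>(i, j). if i = j then complex_of_real (l i) else 0)" and l0: "\<forall>i<d. 0 \<le> l i"
    using psd_diagonalization[OF psd_r] by blast
  have "complex_of_real (\<Sum>i<d. l i) = 1"
    using mat_trace_conj[OF U(1,3) c(1)] tr_r unfolding dg by (simp add: mat_trace_def)
  then have "(\<Sum>i<d. l i) = 1" using of_real_eq_1_iff by blast
  \<comment> \<open>Nonnegative eigenvalues of sum 1 do not exceed 1, the coarsest scale, so a
    dyadic scale above each of them exists.\<close>
  then have l1: "l i \<le> 1" if "i < d" for i using member_le_sum[of i "{..<d}" l] l0 that by auto
  let ?h = "\<lambda>A. adj U * A * U"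
  have hc: "?h A \<in> carrier_mat d d" if "A \<in> carrier_mat d d" for A using that U(1) by (simp add: carr)
  have hadj: "adj (?h A) = ?h A" if "A \<in> carrier_mat d d" "adj A = A" for A
    using that U(1) by (simp add: adj_mult[of _ d d _ d] assoc_mult_mat[of _ d d _ d _ d] carr)
  have hadd: "?h A + ?h B = ?h (A + B)" "?h A - ?h B = ?h (A - B)" if "A \<in> carrier_mat d d" "B \<in> carrier_mat d d" for A B
    using that U(1) by (simp_all add: mult_minus_distrib_mat[of _ d d _ d] minus_mult_distrib_mat[of _ d d _ _ d]
        mult_add_distrib_mat[of _ d d _ d] add_mult_distrib_mat[of _ d d _ _ d] carr)
  have conj_back: "?h (U * Y * adj U) = Y" if "Y \<in> carrier_mat d d" for Y
  proof -
    have "?h (U * Y * adj U) = (adj U * U) * Y * (adj U * U)"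
      using that U(1) by (simp add: assoc_mult_mat[of _ d d _ d _ d] carr)
    then show ?thesis using that U by simp
  qed
  have conj_form: "resolvent_form d s (?h A) Y = resolvent_form d s A (U * Y * adj U)"
    if "A \<in> carrier_mat d d" "Y \<in> carrier_mat d d" for s A Y
    using resolvent_form_conj[OF U that(1), of "U * Y * adj U" s] conj_back[OF that(2)] that U(1) by (simp add: carr)
  have "(g0 + g1) / 2 + p / 64 - real d / 2 ^ J / 128 \<le> (\<Sum>j\<le>J. resolvent_form d (1 / 2 ^ j) (?h r) (?h (Y j)))"
  proof (rule entropy_step_diag[OF dg _ hc[OF c(2)] hadj[OF c(2) herm] hc[OF c(3)] hadj[OF c(3) hD]])
    show "0 \<le> l i \<and> l i \<le> 1" if "i < d" for i using that l0 l1 by auto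
    show "p = Re (mat_trace (?h D * ?h E))"
      using c by (simp add: conj_mult[OF U(1,3)] mat_trace_conj[OF U(1,3)] carr tDE)
    show "Re (mat_trace (?h D * ?h D * ?h r)) \<le> 2 * p"
      using c DDr by (simp add: conj_mult[OF U(1,3)] mat_trace_conj[OF U(1,3)] carr)
    show "Re (mat_trace (?h D * ?h D)) \<le> 4 * real d"
      using c DD by (simp add: conj_mult[OF U(1,3)] mat_trace_conj[OF U(1,3)] carr)
    show "g0 \<le> (\<Sum>j\<le>J. resolvent_form d (1 / 2 ^ j) (?h r + ?h E) (Y j))" if "\<And>j. Y j \<in> carrier_mat d d" for Y
      unfolding hadd(1)[OF c(1,2)] rE conj_form[OF rc(1) that] using that U(1) by (intro g0) (simp add: carr)
    show "g1 \<le> (\<Sum>j\<le>J. resolvent_form d (1 / 2 ^ j) (?h r - ?h E) (Y j))" if "\<And>j. Y j \<in> carrier_mat d d" for Y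
      unfolding hadd(2)[OF c(1,2)] rE conj_form[OF rc(2) that] using that U(1) by (intro g1) (simp add: carr)
    show "?h (Y j) \<in> carrier_mat d d" for j by (rule hc[OF Y])
  qed
  then have "(g0 + g1) / 2 + p / 64 - real d / 2 ^ J / 128 \<le> (\<Sum>j\<le>J. resolvent_form d (1 / 2 ^ j) r (Y j))"
    unfolding resolvent_form_conj[OF U c(1) Y] .
  then show ?thesis unfolding p_def r_def .
qed

section \<open>Averages over the completions of a prefix\<close>

definition avg :: "(bits \<Rightarrow> real) \<Rightarrow> nat \<Rightarrow> bits \<Rightarrow> real" where
  "avg f k w = (\<Sum>v | length v = k. f (w @ v)) / 2 ^ k"

lemma finite_bits [simp]: "finite {v :: bits. length v = k}"
  using finite_lists_length_eq[of "UNIV :: bool set" k] by simp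

lemma avg_0 [simp]: "avg f 0 w = f w"
  by (simp add: avg_def)

lemma avg_Suc: "avg f (Suc k) w = (avg f k (w @ [False]) + avg f k (w @ [True])) / 2"
proof -
  have S: "{v :: bits. length v = Suc k} = (#) False ` {v. length v = k} \<union> (#) True ` {v. length v = k}"
    by (auto simp: length_Suc_conv image_iff)
  have "(\<Sum>v | length v = Suc k. f (w @ v)) = (\<Sum>v | length v = k. f (w @ False # v)) + (\<Sum>v | length v = k. f (w @ True # v))"
    unfolding S by (subst sum.union_disjoint) (auto simp: sum.reindex)
  then show ?thesis by (simp add: avg_def add_divide_distrib)
qed

lemma avg_add: "avg (\<lambda>x. f x + g x) k w = avg f k w + avg g k w"
  by (simp add: avg_def sum.distrib add_divide_distrib)

lemma avg_cong: "(\<And>v. length v = k \<Longrightarrow> f (w @ v) = g (w @ v)) \<Longrightarrow> avg f k w = avg g k w"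
  by (simp add: avg_def)

text \<open>Recursive, so that unfolding once exhibits the state as the mean of the two states in
  which one more bit is known.\<close>

fun avg_state :: "(bits \<Rightarrow> complex mat) \<Rightarrow> nat \<Rightarrow> bits \<Rightarrow> complex mat" where
  "avg_state \<alpha> 0 w = \<alpha> w"
| "avg_state \<alpha> (Suc k) w = (1 / 2) \<cdot>\<^sub>m (avg_state \<alpha> k (w @ [False]) + avg_state \<alpha> k (w @ [True]))"

lemma density_matrix_mean:
  assumes "density_matrix d A" "density_matrix d B"
  shows "density_matrix d ((1 / 2) \<cdot>\<^sub>m (A + B))"
  using assms psd_smult[OF psd_add, of d A B "1/2"] psd_carrier
  by (simp add: density_matrix_def mat_trace_smult[of _ d] mat_trace_add[of _ d])

lemma avg_state_density:
  assumes "\<And>v. length v = k \<Longrightarrow> density_matrix d (\<alpha> (w @ v))"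
  shows "density_matrix d (avg_state \<alpha> k w)"
  using assms
proof (induction k arbitrary: w)
  case (Suc k)
  then show ?case by (auto intro!: density_matrix_mean)
qed auto

lemma avg_state_trace:
  assumes "\<And>v. length v = k \<Longrightarrow> density_matrix d (\<alpha> (w @ v))" and P: "P \<in> carrier_mat d d"
  shows "Re (mat_trace (P * avg_state \<alpha> k w)) = avg (\<lambda>x. Re (mat_trace (P * \<alpha> x))) k w"
  using assms(1)
proof (induction k arbitrary: w)
  case (Suc k)
  let ?A = "avg_state \<alpha> k (w @ [False])" and ?B = "avg_state \<alpha> k (w @ [True])"
  have "density_matrix d ?A" "density_matrix d ?B" using Suc.prems by (auto intro!: avg_state_density)
  then have c: "?A \<in> carrier_mat d d" "?B \<in> carrier_mat d d" by (auto simp: density_matrix_def psd_def)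
  have "P * ((1 / 2) \<cdot>\<^sub>m (?A + ?B)) = (1 / 2) \<cdot>\<^sub>m (P * ?A + P * ?B)"
    using c P by (simp add: mult_smult_distrib[of _ d d _ d] mult_add_distrib_mat[of _ d d _ d])
  then have "Re (mat_trace (P * ((1 / 2) \<cdot>\<^sub>m (?A + ?B)))) = (Re (mat_trace (P * ?A)) + Re (mat_trace (P * ?B))) / 2"
    using c P by (simp add: mat_trace_smult[of _ d] mat_trace_add[of _ d] mult_carrier_mat[of _ d d _ d])
  then show ?case using Suc by (simp add: avg_Suc)
qed auto

lemma avg_state_annihilated:
  assumes "\<And>v. length v = k \<Longrightarrow> density_matrix d (\<alpha> (w @ v))" and P: "P \<in> carrier_mat d d"
    and "\<And>v. length v = k \<Longrightarrow> P * \<alpha> (w @ v) = 0\<^sub>m d d"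
  shows "P * avg_state \<alpha> k w = 0\<^sub>m d d"
  using assms(1,3)
proof (induction k arbitrary: w)
  case (Suc k)
  let ?A = "avg_state \<alpha> k (w @ [False])" and ?B = "avg_state \<alpha> k (w @ [True])"
  have "density_matrix d ?A" "density_matrix d ?B" using Suc.prems by (auto intro!: avg_state_density)
  then have c: "?A \<in> carrier_mat d d" "?B \<in> carrier_mat d d" by (auto simp: density_matrix_def psd_def)
  have "P * ((1 / 2) \<cdot>\<^sub>m (?A + ?B)) = (1 / 2) \<cdot>\<^sub>m (P * ?A + P * ?B)"
    using c P by (simp add: mult_smult_distrib[of _ d d _ d] mult_add_distrib_mat[of _ d d _ d])
  moreover have "P * ?A = 0\<^sub>m d d" "P * ?B = 0\<^sub>m d d" using Suc by auto
  ultimately show ?case by simp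
qed auto

text \<open>A chain rule over the unknown bits. The detector for bit value \<open>b\<close> at
  position \<open>length w\<close> annihilates every message with the other value there, hence also
  the average of these messages. So \<open>entropy_step\<close> applies to the two extensions of
  \<open>w\<close> and adds the detection probability of this position to the bound for the later
  ones.\<close>

lemma entropy_prefix_bound:
  fixes \<alpha> :: "bits \<Rightarrow> complex mat"
  assumes dens: "\<And>x. length x = n \<Longrightarrow> density_matrix d (\<alpha> x)"
    and P: "\<And>i b. i < n \<Longrightarrow> P i b \<in> carrier_mat d d \<and> adj (P i b) = P i b \<and> P i b * P i b = P i b"
    and z: "\<And>x i b. length x = n \<Longrightarrow> i < n \<Longrightarrow> x ! i \<noteq> b \<Longrightarrow> P i b * \<alpha> x = 0\<^sub>m d d"
    and "length w + k = n" "\<And>j. Y j \<in> carrier_mat d d"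
  shows "avg (\<lambda>x. \<Sum>i=length w..<n. Re (mat_trace (P i (x ! i) * \<alpha> x))) k w / 64 - real k * (real d / 2 ^ J / 128)
    \<le> (\<Sum>j\<le>J. resolvent_form d (1 / 2 ^ j) (avg_state \<alpha> k w) (Y j))"
  using assms(4,5)
proof (induction k arbitrary: w Y)
  case 0
  then have "psd d (\<alpha> w)" using dens[of w] by (simp add: density_matrix_def)
  then have "0 \<le> (\<Sum>j\<le>J. resolvent_form d (1 / 2 ^ j) (\<alpha> w) (Y j))"
    using 0 by (intro sum_nonneg resolvent_form_nonneg) auto
  then show ?case using 0 by simp
next
  case (Suc k)
  let ?f = "\<lambda>i x. Re (mat_trace (P i (x ! i) * \<alpha> x))"
  let ?m = "length w"
  have m: "?m < n" using Suc.prems by simp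
  let ?r = "\<lambda>b. avg_state \<alpha> k (w @ [b])"
  define g where "g b = avg (\<lambda>x. \<Sum>i=Suc ?m..<n. ?f i x) k (w @ [b]) / 64 - real k * (real d / 2 ^ J / 128)" for b
  have dn: "length v = k \<Longrightarrow> density_matrix d (\<alpha> ((w @ [b]) @ v))" for b v using Suc.prems by (intro dens) auto
  have gb: "g b \<le> (\<Sum>j\<le>J. resolvent_form d (1 / 2 ^ j) (?r b) (Y j))" if "\<And>j. Y j \<in> carrier_mat d d" for Y b
    using Suc.IH[of "w @ [b]" Y] that Suc.prems by (simp add: g_def)
  have step: "(g False + g True) / 2 + (Re (mat_trace (P ?m False * ?r False)) + Re (mat_trace (P ?m True * ?r True))) / 2 / 64 - real d / 2 ^ J / 128
    \<le> (\<Sum>j\<le>J. resolvent_form d (1 / 2 ^ j) ((1 / 2) \<cdot>\<^sub>m (?r False + ?r True)) (Y j))"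
  proof (rule entropy_step)
    show "density_matrix d (?r False)" "density_matrix d (?r True)" using dn by (auto intro!: avg_state_density)
    show "P ?m False * ?r True = 0\<^sub>m d d" "P ?m True * ?r False = 0\<^sub>m d d"
      using dn P[OF m] z[OF _ m] Suc.prems by (auto intro!: avg_state_annihilated simp: nth_append)
    show "g False \<le> (\<Sum>j\<le>J. resolvent_form d (1 / 2 ^ j) (?r False) (Y j))"
      "g True \<le> (\<Sum>j\<le>J. resolvent_form d (1 / 2 ^ j) (?r True) (Y j))" if "\<And>j. Y j \<in> carrier_mat d d" for Y
      using gb[OF that] by auto
  qed (use P[OF m] Suc.prems in auto)
  have p: "Re (mat_trace (P ?m b * ?r b)) = avg (?f ?m) k (w @ [b])" for b
    using P[OF m] dn by (subst avg_state_trace[of _ d]) (auto intro!: avg_cong simp: nth_append)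
  have "avg (\<lambda>x. \<Sum>i=?m..<n. ?f i x) (Suc k) w = avg (\<lambda>x. ?f ?m x + (\<Sum>i=Suc ?m..<n. ?f i x)) (Suc k) w"
    using m by (simp add: sum.atLeast_Suc_lessThan)
  also have "\<dots> = (avg (?f ?m) k (w @ [False]) + avg (?f ?m) k (w @ [True])) / 2 +
    (avg (\<lambda>x. \<Sum>i=Suc ?m..<n. ?f i x) k (w @ [False]) + avg (\<lambda>x. \<Sum>i=Suc ?m..<n. ?f i x) k (w @ [True])) / 2"
    unfolding avg_add by (simp only: avg_Suc)
  finally have split: "avg (\<lambda>x. \<Sum>i=?m..<n. ?f i x) (Suc k) w = \<dots>" .
  define e where "e = real d / 2 ^ J / 128"
  have "real (Suc k) * e = real k * e + e" by (simp add: algebra_simps)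
  then show ?case using step split unfolding p g_def e_def[symmetric] avg_state.simps by argo
qed

lemma geometric_cutoff: "(\<Sum>j\<le>q + m. if j \<le> q then 1 else 2 ^ q / 2 ^ j) = real q + 2 - 1 / 2 ^ m"
proof (induction m)
  case 0
  have "(\<Sum>j\<le>q. if j \<le> q then 1 else 2 ^ q / 2 ^ j) = (\<Sum>j\<le>q. 1 :: real)" by (intro sum.cong) auto
  then show ?case by simp
next
  case (Suc m)
  then show ?case by (simp add: power_add field_simps)
qed

theorem unambiguous_bits_bound:
  fixes \<alpha> :: "bits \<Rightarrow> complex mat"
  assumes dens: "\<And>x. length x = n \<Longrightarrow> density_matrix (2 ^ q) (\<alpha> x)"
    and P: "\<And>i b. i < n \<Longrightarrow> P i b \<in> carrier_mat (2 ^ q) (2 ^ q) \<and> adj (P i b) = P i b \<and> P i b * P i b = P i b"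
    and z: "\<And>x i b. length x = n \<Longrightarrow> i < n \<Longrightarrow> x ! i \<noteq> b \<Longrightarrow> P i b * \<alpha> x = 0\<^sub>m (2 ^ q) (2 ^ q)"
  shows "(\<Sum>x | length x = n. \<Sum>i<n. Re (mat_trace (P i (x ! i) * \<alpha> x))) / 2 ^ n \<le> 64 * (real q + 3)"
proof -
  \<comment> \<open>With \<open>n\<close> scales beyond \<open>q\<close>, the truncation errors of
    all \<open>n\<close> steps together amount to \<open>n / 2 ^ n / 128\<close>.\<close>
  let ?d = "2 ^ q :: nat" and ?J = "q + n"
  \<comment> \<open>The switch at \<open>q\<close> is tuned to the maximally mixed state, whose
    eigenvalues are \<open>1 / 2 ^ q\<close>: the identity costs 1 at each coarse scale, and the
    zero matrix costs \<open>2 ^ q / 2 ^ j\<close> at the finer ones, a geometric series.\<close>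
  define Y where "Y j = (if j \<le> q then 1\<^sub>m ?d else 0\<^sub>m ?d ?d :: complex mat)" for j
  have Y: "Y j \<in> carrier_mat ?d ?d" for j by (simp add: Y_def)
  let ?r = "avg_state \<alpha> n []"
  have r: "density_matrix ?d ?r" using dens by (intro avg_state_density) auto
  then have rc: "?r \<in> carrier_mat ?d ?d" by (simp add: density_matrix_def psd_def)
  have 1: "resolvent_form ?d (1 / 2 ^ j) ?r (1\<^sub>m ?d) = 1" for j
  proof -
    have z1: "1\<^sub>m ?d - 1\<^sub>m ?d = (0\<^sub>m ?d ?d :: complex mat)" by auto
    have z2: "mat_trace (adj (0\<^sub>m ?d ?d) * 0\<^sub>m ?d ?d) = 0"
      by (subst mat_trace_gram[of _ ?d ?d]) auto
    show ?thesis unfolding resolvent_form_def z1 z2 using rc r by (simp add: density_matrix_def)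
  qed
  have 0: "resolvent_form ?d (1 / 2 ^ j) ?r (0\<^sub>m ?d ?d) = 2 ^ q / 2 ^ j" for j
  proof -
    have "mat_trace (adj (0\<^sub>m ?d ?d - 1\<^sub>m ?d) * (0\<^sub>m ?d ?d - 1\<^sub>m ?d)) = complex_of_real (\<Sum>i<?d. \<Sum>k<?d. (cmod ((0\<^sub>m ?d ?d - 1\<^sub>m ?d) $$ (k, i)))\<^sup>2)"
      by (intro mat_trace_gram minus_carrier_mat) auto
    also have "(\<Sum>i<?d. \<Sum>k<?d. (cmod ((0\<^sub>m ?d ?d - 1\<^sub>m ?d) $$ (k, i)))\<^sup>2) = (\<Sum>i<?d. \<Sum>k<?d. if k = i then 1 else 0)"
      by (intro sum.cong refl) auto
    also have "\<dots> = 2 ^ q" by simp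
    finally have "Re (mat_trace (adj (0\<^sub>m ?d ?d - 1\<^sub>m ?d) * (0\<^sub>m ?d ?d - 1\<^sub>m ?d))) = 2 ^ q" by simp
    moreover have "mat_trace (adj (0\<^sub>m ?d ?d) * ?r * 0\<^sub>m ?d ?d) = 0"
      using rc by (subst right_mult_zero_mat[of _ ?d ?d]) (auto simp: mat_trace_def mult_carrier_mat[of _ ?d ?d _ ?d])
    ultimately show ?thesis by (simp add: resolvent_form_def)
  qed
  have "avg (\<lambda>x. \<Sum>i=0..<n. Re (mat_trace (P i (x ! i) * \<alpha> x))) n [] / 64 - real n * (real ?d / 2 ^ ?J / 128)
     \<le> (\<Sum>j\<le>?J. resolvent_form ?d (1 / 2 ^ j) ?r (Y j))"
    using entropy_prefix_bound[of n ?d \<alpha> P "[]" n Y ?J, OF dens P z _ Y] by simp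
  also have "\<dots> = (\<Sum>j\<le>?J. if j \<le> q then 1 else 2 ^ q / 2 ^ j)"
    by (intro sum.cong refl) (simp only: Y_def 0 1 split: if_splits, simp)
  also have "\<dots> \<le> real q + 2" unfolding geometric_cutoff by simp
  finally have "avg (\<lambda>x. \<Sum>i=0..<n. Re (mat_trace (P i (x ! i) * \<alpha> x))) n [] \<le> 64 * (real q + 2) + real n / 2 ^ n / 2"
    by (simp add: power_add field_simps)
  moreover have "real n / 2 ^ n \<le> 1"
  proof -
    have "real n < 2 ^ n" by (rule of_nat_less_two_power)
    then have "real n / 2 ^ n < 1" by (subst divide_less_eq_1_pos) auto
    then show ?thesis by (rule less_imp_le)
  qed
  ultimately have "avg (\<lambda>x. \<Sum>i=0..<n. Re (mat_trace (P i (x ! i) * \<alpha> x))) n [] \<le> 64 * (real q + 3)" by argo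
  then show ?thesis by (simp add: avg_def atLeast0LessThan)
qed

section \<open>Zero-error measurements on product states\<close>

lemma sum_div_mod:
  fixes f :: "nat \<Rightarrow> nat \<Rightarrow> 'a :: comm_monoid_add"
  shows "(\<Sum>k<n * p. f (k div p) (k mod p)) = (\<Sum>a<n. \<Sum>b<p. f a b)"
proof (cases "p = 0")
  case False
  have bound: "a * p + b < n * p" if "a < n" "b < p" for a b
    using mult_le_mono1[of "Suc a" n p] that by simp
  have "(\<Sum>k<n * p. f (k div p) (k mod p)) = (\<Sum>(a, b)\<in>{..<n} \<times> {..<p}. f a b)"
    by (rule sum.reindex_bij_witness[where i = "\<lambda>(a, b). a * p + b" and j = "\<lambda>k. (k div p, k mod p)"])
       (use False in \<open>auto simp: less_mult_imp_div_less bound\<close>)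
  then show ?thesis by (simp add: sum.cartesian_product)
qed simp

lemma minus_zero_mat: "A \<in> carrier_mat n m \<Longrightarrow> A - 0\<^sub>m n m = A" for A :: "complex mat"
  by (auto intro!: eq_matI)

lemma kron_carrier [simp]:
  "A \<in> carrier_mat n m \<Longrightarrow> B \<in> carrier_mat p q \<Longrightarrow> kron A B \<in> carrier_mat (n * p) (m * q)"
  by (simp add: kron_def)

lemma kron_index:
  assumes "A \<in> carrier_mat n m" "B \<in> carrier_mat p q" "i < n * p" "j < m * q"
  shows "kron A B $$ (i, j) = A $$ (i div p, j div q) * B $$ (i mod p, j mod q)"
  using assms by (simp add: kron_def)

lemma kron_mult:
  assumes A: "A \<in> carrier_mat n m" and B: "B \<in> carrier_mat p q" and C: "C \<in> carrier_mat m r" and D: "D \<in> carrier_mat q t"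
  shows "kron A B * kron C D = kron (A * C) (B * D)"
proof (rule eq_matI)
  have AC: "A * C \<in> carrier_mat n r" and BD: "B * D \<in> carrier_mat p t" using assms by auto
  note c = kron_carrier[OF A B] kron_carrier[OF C D] kron_carrier[OF AC BD]
  fix i j assume "i < dim_row (kron (A * C) (B * D))" "j < dim_col (kron (A * C) (B * D))"
  then have ij: "i < n * p" "j < r * t" using c(3) by auto
  then have p0: "p > 0" "t > 0" by (auto intro: gr0I)
  have dm: "i div p < n" "i mod p < p" "j div t < r" "j mod t < t"
    using ij p0 by (auto simp: less_mult_imp_div_less)
  have "(kron A B * kron C D) $$ (i, j) = (\<Sum>k<m * q. kron A B $$ (i, k) * kron C D $$ (k, j))"
    by (rule mult_index[OF c(1,2) ij])
  also have "\<dots> = (\<Sum>k<m * q. A $$ (i div p, k div q) * B $$ (i mod p, k mod q) * (C $$ (k div q, j div t) * D $$ (k mod q, j mod t)))"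
    using ij by (intro sum.cong refl) (simp add: kron_index[OF A B] kron_index[OF C D])
  also have "\<dots> = (\<Sum>a<m. \<Sum>b<q. A $$ (i div p, a) * B $$ (i mod p, b) * (C $$ (a, j div t) * D $$ (b, j mod t)))"
    by (rule sum_div_mod)
  also have "\<dots> = (\<Sum>a<m. A $$ (i div p, a) * C $$ (a, j div t)) * (\<Sum>b<q. B $$ (i mod p, b) * D $$ (b, j mod t))"
    by (simp add: sum_product mult_ac)
  also have "\<dots> = kron (A * C) (B * D) $$ (i, j)"
    unfolding kron_index[OF AC BD ij] mult_index[OF A C dm(1,3)] mult_index[OF B D dm(2,4)] ..
  finally show "(kron A B * kron C D) $$ (i, j) = kron (A * C) (B * D) $$ (i, j)" .
qed (use assms in \<open>auto simp: kron_def\<close>)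

lemma mod_less_of_less_mult: "i < n * p \<Longrightarrow> i mod p < (p :: nat)"
  by (cases "p = 0") auto

lemma adj_kron: "adj (kron A B) = kron (adj A) (adj B)"
proof (rule eq_matI)
  fix i j assume "i < dim_row (kron (adj A) (adj B))" "j < dim_col (kron (adj A) (adj B))"
  then have ij: "i < dim_col A * dim_col B" "j < dim_row A * dim_row B" by (auto simp: kron_def)
  then show "adj (kron A B) $$ (i, j) = kron (adj A) (adj B) $$ (i, j)"
    by (subst adj_index) (auto simp: kron_def less_mult_imp_div_less mod_less_of_less_mult)
qed (auto simp: kron_def)

lemma mat_trace_kron:
  assumes A: "A \<in> carrier_mat n n" and B: "B \<in> carrier_mat p p"
  shows "mat_trace (kron A B) = mat_trace A * mat_trace B"
proof -
  have "mat_trace (kron A B) = (\<Sum>k<n * p. A $$ (k div p, k div p) * B $$ (k mod p, k mod p))"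
    using A B by (auto simp: mat_trace_def kron_def intro!: sum.cong)
  also have "\<dots> = mat_trace A * mat_trace B"
    using A B by (subst sum_div_mod) (simp add: mat_trace_def sum_product)
  finally show ?thesis .
qed

lemma kron_minus_left:
  assumes "A \<in> carrier_mat n m" "B \<in> carrier_mat n m" "C \<in> carrier_mat p q"
  shows "kron (A - B) C = kron A C - kron B C"
  using assms by (intro eq_matI) (auto simp: kron_def less_mult_imp_div_less left_diff_distrib)

lemma kron_minus_right:
  assumes "A \<in> carrier_mat n m" "B \<in> carrier_mat p q" "C \<in> carrier_mat p q"
  shows "kron A (B - C) = kron A B - kron A C"
  using assms by (intro eq_matI) (auto simp: kron_def mod_less_of_less_mult right_diff_distrib)

lemma psd_kron:
  assumes "psd n A" "psd p B"
  shows "psd (n * p) (kron A B)"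
proof -
  obtain S T where S: "S \<in> carrier_mat n n" "A = S * adj S" and T: "T \<in> carrier_mat p p" "B = T * adj T"
    using psd_factor[OF assms(1)] psd_factor[OF assms(2)] by blast
  have "kron A B = kron S T * adj (kron S T)"
    unfolding adj_kron S(2) T(2) using S(1) T(1) by (intro kron_mult[symmetric]) auto
  then show ?thesis using psd_gram[OF kron_carrier[OF S(1) T(1)]] by simp
qed

text \<open>Entrywise with the dimension given in advance: the empty sum has a shape, and
  \<open>povm\<close> states completeness in literally this form.\<close>

definition msum :: "nat \<Rightarrow> 'a set \<Rightarrow> ('a \<Rightarrow> complex mat) \<Rightarrow> complex mat" where
  "msum d S f = mat d d (\<lambda>(i, j). \<Sum>x\<in>S. f x $$ (i, j))"

lemma msum_carrier [simp]: "msum d S f \<in> carrier_mat d d"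
  by (simp add: msum_def)

lemma mult_msum:
  assumes A: "A \<in> carrier_mat d d" and f: "\<And>x. x \<in> S \<Longrightarrow> f x \<in> carrier_mat d d"
  shows "A * msum d S f = msum d S (\<lambda>x. A * f x)"
proof (rule eq_matI)
  fix i j assume "i < dim_row (msum d S (\<lambda>x. A * f x))" "j < dim_col (msum d S (\<lambda>x. A * f x))"
  then have ij: "i < d" "j < d" by (auto simp: msum_def)
  have "(A * msum d S f) $$ (i, j) = (\<Sum>k<d. A $$ (i, k) * (\<Sum>x\<in>S. f x $$ (k, j)))"
    unfolding mult_index[OF A msum_carrier ij] using ij by (auto simp: msum_def intro!: sum.cong)
  also have "\<dots> = (\<Sum>x\<in>S. \<Sum>k<d. A $$ (i, k) * f x $$ (k, j))"
    by (simp add: sum_distrib_left) (rule sum.swap)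
  also have "\<dots> = (\<Sum>x\<in>S. (A * f x) $$ (i, j))" using mult_index[OF A f ij] by (intro sum.cong) auto
  finally show "(A * msum d S f) $$ (i, j) = msum d S (\<lambda>x. A * f x) $$ (i, j)" using ij by (simp add: msum_def)
qed (use A in \<open>auto simp: msum_def\<close>)

lemma mat_trace_msum: "(\<And>x. x \<in> S \<Longrightarrow> f x \<in> carrier_mat d d) \<Longrightarrow> mat_trace (msum d S f) = (\<Sum>x\<in>S. mat_trace (f x))"
  unfolding mat_trace_def msum_def by (simp, subst sum.swap) (auto intro!: sum.cong)

lemma msum_cong: "(\<And>x. x \<in> S \<Longrightarrow> f x = g x) \<Longrightarrow> msum d S f = msum d S g"
  by (auto simp: msum_def intro!: eq_matI sum.cong)

lemma psd_msum:
  assumes "finite S" "\<And>x. x \<in> S \<Longrightarrow> psd d (f x)"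
  shows "psd d (msum d S f)"
  using assms
proof (induction S rule: finite_induct)
  case empty
  have "0\<^sub>m d d * adj (0\<^sub>m d d) = (0\<^sub>m d d :: complex mat)" by (intro left_mult_zero_mat) auto
  then have "psd d (0\<^sub>m d d)" using psd_gram[of "0\<^sub>m d d" d d] by simp
  moreover have "msum d {} f = 0\<^sub>m d d" by (auto simp: msum_def)
  ultimately show ?case by simp
next
  case (insert x S)
  have "msum d (insert x S) f = f x + msum d S f"
    using insert psd_carrier[of d "f x"] by (intro eq_matI) (auto simp: msum_def)
  then show ?case using insert by (simp add: psd_add)
qed

lemma mat_trace_mult_kron_msum:
  assumes M: "M \<in> carrier_mat (n * p) (n * p)"
    and f: "\<And>x. x \<in> S \<Longrightarrow> f x \<in> carrier_mat n n" and g: "\<And>y. y \<in> T \<Longrightarrow> g y \<in> carrier_mat p p"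
  shows "mat_trace (M * kron (msum n S f) (msum p T g)) = (\<Sum>x\<in>S. \<Sum>y\<in>T. mat_trace (M * kron (f x) (g y)))"
proof -
  let ?h = "\<lambda>(x, y). kron (f x) (g y)"
  have h: "?h z \<in> carrier_mat (n * p) (n * p)" if "z \<in> S \<times> T" for z using that f g by auto
  have k: "kron (msum n S f) (msum p T g) = msum (n * p) (S \<times> T) ?h"
  proof (rule eq_matI)
    fix i j assume "i < dim_row (msum (n * p) (S \<times> T) ?h)" "j < dim_col (msum (n * p) (S \<times> T) ?h)"
    then have ij: "i < n * p" "j < n * p" by (auto simp: msum_def)
    have "(\<Sum>z\<in>S \<times> T. ?h z $$ (i, j)) = (\<Sum>(x, y)\<in>S \<times> T. f x $$ (i div p, j div p) * g y $$ (i mod p, j mod p))"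
      using ij f g by (intro sum.cong) (auto simp: kron_index[of _ n n _ p p])
    then show "kron (msum n S f) (msum p T g) $$ (i, j) = msum (n * p) (S \<times> T) ?h $$ (i, j)"
      unfolding kron_index[OF msum_carrier msum_carrier ij] using ij
      by (simp add: msum_def less_mult_imp_div_less mod_less_of_less_mult sum_product sum.cartesian_product)
  qed (auto simp: msum_def kron_def)
  have "mat_trace (M * kron (msum n S f) (msum p T g)) = (\<Sum>z\<in>S \<times> T. mat_trace (M * ?h z))"
  proof -
    have Mh: "M * ?h z \<in> carrier_mat (n * p) (n * p)" if "z \<in> S \<times> T" for z by (rule mult_carrier_mat[OF M h[OF that]])
    have "M * msum (n * p) (S \<times> T) ?h = msum (n * p) (S \<times> T) (\<lambda>z. M * ?h z)" by (rule mult_msum[OF M h])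
    then show ?thesis unfolding k using mat_trace_msum[OF Mh, of "S \<times> T" "\<lambda>z. z"] by simp
  qed
  then show ?thesis by (simp add: sum.cartesian_product split_def)
qed

section \<open>Projectors onto the supports of families of messages\<close>

definition range_projector :: "nat \<Rightarrow> complex mat \<Rightarrow> complex mat" where
  "range_projector d N = (SOME Q. Q \<in> carrier_mat d d \<and> adj Q = Q \<and> Q * Q = Q \<and> Q * N = N \<and> (\<exists>G\<in>carrier_mat d d. Q = N * G))"

text \<open>The factorisation through \<open>N\<close> is the clause that carries a vanishing
  product with \<open>N\<close> over to its range projector.\<close>

lemma range_projector:
  assumes "psd d N"
  shows "range_projector d N \<in> carrier_mat d d" "adj (range_projector d N) = range_projector d N"
    "range_projector d N * range_projector d N = range_projector d N" "range_projector d N * N = N"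
    "\<exists>G\<in>carrier_mat d d. range_projector d N = N * G"
proof -
  obtain G where "G \<in> carrier_mat d d" "adj (N * G) = N * G" "(N * G) * (N * G) = N * G" "(N * G) * N = N"
    using psd_factor_and_pseudoinverse[OF assms] by blast
  then have "\<exists>Q. Q \<in> carrier_mat d d \<and> adj Q = Q \<and> Q * Q = Q \<and> Q * N = N \<and> (\<exists>G\<in>carrier_mat d d. Q = N * G)"
    using psd_carrier[OF assms] by (intro exI[of _ "N * G"]) auto
  from someI_ex[OF this, folded range_projector_def]
  show "range_projector d N \<in> carrier_mat d d" "adj (range_projector d N) = range_projector d N"
    "range_projector d N * range_projector d N = range_projector d N" "range_projector d N * N = N"
    "\<exists>G\<in>carrier_mat d d. range_projector d N = N * G" by auto
qed

text \<open>The complementary projector has trace 0 against the whole sum. All summands contribute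
  nonnegatively, so each contributes 0, and a zero trace forces a zero product.\<close>

lemma range_projector_summand:
  assumes S: "finite S" "x \<in> S" and f: "\<And>x. x \<in> S \<Longrightarrow> psd d (f x)"
  shows "range_projector d (msum d S f) * f x = f x"
proof -
  let ?N = "msum d S f" let ?Q = "range_projector d ?N" let ?R = "1\<^sub>m d - ?Q"
  have "psd d ?N" using S(1) f by (rule psd_msum)
  note Q = range_projector[OF this]
  have fc: "x \<in> S \<Longrightarrow> f x \<in> carrier_mat d d" for x using f psd_carrier by auto
  have R: "?R \<in> carrier_mat d d" using Q by (intro minus_carrier_mat) auto
  have RA: "?R * A = A - ?Q * A" if "A \<in> carrier_mat d d" for A
    using that Q(1) by (simp add: minus_mult_distrib_mat[of _ d d _ _ d])
  have "?R * ?R = ?R - ?Q * ?R" by (rule RA[OF R])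
  also have "?Q * ?R = 0\<^sub>m d d" using Q(1,3) by (simp add: mult_minus_distrib_mat[of _ d d _ d])
  finally have "?R * ?R = ?R" using R by (metis minus_zero_mat)
  moreover have "adj ?R = ?R" using Q by (simp add: adj_minus[of _ d d])
  ultimately have psdR: "psd d ?R" using psd_gram[OF R] by simp
  have "(\<Sum>x\<in>S. mat_trace (?R * f x)) = mat_trace (?R * ?N)"
    using R fc by (subst mult_msum[OF R]) (auto simp: mat_trace_msum mult_carrier_mat[of _ d d _ d])
  also have "\<dots> = 0" unfolding RA[OF msum_carrier] Q(4) by (subst mat_trace_minus[of _ d]) auto
  finally have "(\<Sum>x\<in>S. Re (mat_trace (?R * f x))) = 0" by (metis Re_sum zero_complex.sel(1))
  then have "Re (mat_trace (?R * f x)) = 0"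
    using S psd_trace_mult_nonneg[OF psdR f] by (subst (asm) sum_nonneg_eq_0_iff) auto
  then have z: "f x - ?Q * f x = 0\<^sub>m d d"
    using psd_trace_mult_eq_0[OF psdR f[OF S(2)]] RA[OF fc[OF S(2)]] by simp
  show ?thesis
  proof (rule eq_matI)
    fix i j assume ij: "i < dim_row (f x)" "j < dim_col (f x)"
    then have "(f x - ?Q * f x) $$ (i, j) = 0" using z fc[OF S(2)] by simp
    then show "(?Q * f x) $$ (i, j) = f x $$ (i, j)" using ij Q(1) fc[OF S(2)] by simp
  qed (use Q(1) fc[OF S(2)] in auto)
qed

definition excluding_projector :: "nat \<Rightarrow> 'a set \<Rightarrow> 'a set \<Rightarrow> ('a \<Rightarrow> complex mat) \<Rightarrow> complex mat" where
  "excluding_projector d S T f = range_projector d (msum d S f) - range_projector d (msum d T f)"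

text \<open>Every summand of the smaller sum lies in the range of the larger one, so the range
  projectors are nested: their products in both orders equal the smaller one. Hence the difference
  is again a projector.\<close>

lemma excluding_projector:
  assumes S: "finite S" "T \<subseteq> S" and f: "\<And>x. x \<in> S \<Longrightarrow> psd d (f x)"
  defines "P \<equiv> excluding_projector d S T f"
  shows "P \<in> carrier_mat d d" "adj P = P" "P * P = P" "\<And>x. x \<in> T \<Longrightarrow> P * f x = 0\<^sub>m d d"
    "range_projector d (msum d S f) * range_projector d (msum d T f) = range_projector d (msum d T f)"
    "range_projector d (msum d S f) * P = P"
proof -
  let ?Q = "range_projector d (msum d S f)" and ?Q' = "range_projector d (msum d T f)"
  have T: "finite T" "\<And>x. x \<in> T \<Longrightarrow> psd d (f x)" using S f finite_subset by auto
  note Q = range_projector[OF psd_msum[of S d f, OF S(1) f]]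
  note Q' = range_projector[OF psd_msum[of T d f, OF T]]
  have fc: "x \<in> S \<Longrightarrow> f x \<in> carrier_mat d d" for x using f psd_carrier by auto
  have "?Q * msum d T f = msum d T f"
    using S Q(1) fc f by (subst mult_msum) (auto intro!: msum_cong range_projector_summand)
  then show QQ': "?Q * ?Q' = ?Q'" using Q'(5) Q(1) by (auto simp flip: assoc_mult_mat[of _ d d _ d _ d])
  then have Q'Q: "?Q' * ?Q = ?Q'" using adj_mult[OF Q(1) Q'(1)] Q(2) Q'(2) by simp
  show P: "P \<in> carrier_mat d d" unfolding P_def excluding_projector_def using Q' by (intro minus_carrier_mat) auto
  show "adj P = P" unfolding P_def excluding_projector_def using Q Q' by (simp add: adj_minus[of _ d d])
  show QP: "?Q * P = P" unfolding P_def excluding_projector_def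
    using Q Q' QQ' by (simp add: mult_minus_distrib_mat[of _ d d _ d])
  have "?Q' * P = 0\<^sub>m d d" unfolding P_def excluding_projector_def
    using Q Q' Q'Q by (simp add: mult_minus_distrib_mat[of _ d d _ d])
  moreover have "P * P = ?Q * P - ?Q' * P"
    unfolding P_def excluding_projector_def using Q Q' P
    by (intro minus_mult_distrib_mat[of _ d d]) (auto intro!: minus_carrier_mat)
  ultimately show "P * P = P" unfolding QP using P by (metis minus_zero_mat)
  show "P * f x = 0\<^sub>m d d" if x: "x \<in> T" for x
  proof -
    have xS: "x \<in> S" using x S by auto
    have "P * f x = ?Q * f x - ?Q' * f x" unfolding P_def excluding_projector_def using Q Q' fc[OF xS]
      by (simp add: minus_mult_distrib_mat[of _ d d _ _ d])
    also have "\<dots> = f x - f x"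
      using range_projector_summand[OF S(1) xS, of d f] range_projector_summand[OF T(1) x, of d f] f T by simp
    finally show ?thesis using fc[OF xS] by simp
  qed
qed

text \<open>Lets \<open>Re\<close> pass through the product of two traces, where it is not
  multiplicative in general.\<close>

lemma psd_trace_mult_real:
  assumes "psd d A" "psd d B"
  shows "mat_trace (A * B) = complex_of_real (Re (mat_trace (A * B)))"
proof -
  obtain S T where S: "S \<in> carrier_mat d d" "A = S * adj S" and T: "T \<in> carrier_mat d d" "B = T * adj T"
    using psd_factor[OF assms(1)] psd_factor[OF assms(2)] by blast
  have c: "adj S * T \<in> carrier_mat d d" using S T by (simp add: mult_carrier_mat[of _ d d _ d])
  show ?thesis unfolding S(2) T(2) psd_trace_gram[OF S(1) T(1)] mat_trace_gram[OF c] by simp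
qed

text \<open>\<open>M\<close> belongs to one answer, and \<open>S'\<close>, \<open>T'\<close> are the
  inputs of either party that make this answer wrong. Probability zero makes \<open>M\<close>
  annihilate \<open>kron (Q S') (R T)\<close> and \<open>kron (Q S) (R T')\<close>, so on the joint
  support \<open>M\<close> equals \<open>M * K\<close> with \<open>K = kron P1 P2\<close>. Placing
  \<open>K\<close> on both sides of the state and using \<open>M_le\<close> leaves the trace of
  \<open>K * \<rho>\<close>, which factors.\<close>

lemma zero_error_product_bound:
  fixes \<alpha> :: "'a \<Rightarrow> complex mat" and \<beta> :: "'b \<Rightarrow> complex mat"
  assumes S: "finite S" "S' \<subseteq> S" and T: "finite T" "T' \<subseteq> T"
    and \<alpha>: "\<And>x. x \<in> S \<Longrightarrow> psd n (\<alpha> x)" and \<beta>: "\<And>y. y \<in> T \<Longrightarrow> psd p (\<beta> y)"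
    and M: "psd (n * p) M" and M_le: "\<And>K. psd (n * p) K \<Longrightarrow> Re (mat_trace (M * K)) \<le> Re (mat_trace K)"
    and zero: "\<And>x y. x \<in> S \<Longrightarrow> y \<in> T \<Longrightarrow> x \<in> S' \<or> y \<in> T' \<Longrightarrow> Re (mat_trace (M * kron (\<alpha> x) (\<beta> y))) = 0"
    and x: "x \<in> S" and y: "y \<in> T"
  shows "Re (mat_trace (M * kron (\<alpha> x) (\<beta> y))) \<le>
    Re (mat_trace (excluding_projector n S S' \<alpha> * \<alpha> x)) * Re (mat_trace (excluding_projector p T T' \<beta> * \<beta> y))"
proof -
  have fin: "finite S'" "finite T'" using S T finite_subset by auto
  have \<alpha>': "\<And>x. x \<in> S' \<Longrightarrow> psd n (\<alpha> x)" and \<beta>': "\<And>y. y \<in> T' \<Longrightarrow> psd p (\<beta> y)" using \<alpha> \<beta> S T by auto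
  define N where "N A = msum n A \<alpha>" for A
  define L where "L A = msum p A \<beta>" for A
  have psdN: "psd n (N S)" "psd n (N S')" "psd p (L T)" "psd p (L T')"
    unfolding N_def L_def using S T fin \<alpha> \<beta> \<alpha>' \<beta>' by (auto intro!: psd_msum)
  define Q where "Q A = range_projector n (N A)" for A
  define R where "R A = range_projector p (L A)" for A
  note Qs = range_projector[OF psdN(1), folded Q_def] and Qs' = range_projector[OF psdN(2), folded Q_def]
  note Rs = range_projector[OF psdN(3), folded R_def] and Rs' = range_projector[OF psdN(4), folded R_def]
  define P1 where "P1 = excluding_projector n S S' \<alpha>"
  define P2 where "P2 = excluding_projector p T T' \<beta>"
  have P1: "P1 \<in> carrier_mat n n" "adj P1 = P1" "P1 * P1 = P1" "Q S * P1 = P1"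
    unfolding P1_def Q_def N_def using excluding_projector[OF S, of n \<alpha>] \<alpha> by auto
  have P2: "P2 \<in> carrier_mat p p" "adj P2 = P2" "P2 * P2 = P2" "R T * P2 = P2"
    unfolding P2_def R_def L_def using excluding_projector[OF T, of p \<beta>] \<beta> by auto
  let ?d = "n * p"
  note carr = mult_carrier_mat[of _ ?d ?d _ ?d]
  note asc = assoc_mult_mat[of _ ?d ?d _ ?d _ ?d]
  note km = kron_mult[of _ n n _ p p _ n _ p]
  have Mc: "M \<in> carrier_mat ?d ?d" by (rule psd_carrier[OF M])
  have zN: "M * kron (N A) (L B) = 0\<^sub>m ?d ?d" if AB: "A \<subseteq> S" "B \<subseteq> T" "A \<subseteq> S' \<or> B \<subseteq> T'" for A B
  proof (rule psd_trace_mult_eq_0[OF M psd_kron])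
    have fin: "finite A" "finite B" using AB S T finite_subset by auto
    show "psd n (N A)" "psd p (L B)" unfolding N_def L_def using AB \<alpha> \<beta> fin by (auto intro!: psd_msum)
    have "mat_trace (M * kron (N A) (L B)) = (\<Sum>x\<in>A. \<Sum>y\<in>B. mat_trace (M * kron (\<alpha> x) (\<beta> y)))"
      unfolding N_def L_def using AB \<alpha> \<beta> psd_carrier by (intro mat_trace_mult_kron_msum[OF Mc]) blast+
    then have "Re (mat_trace (M * kron (N A) (L B))) = (\<Sum>x\<in>A. \<Sum>y\<in>B. Re (mat_trace (M * kron (\<alpha> x) (\<beta> y))))" by simp
    also have "\<dots> = 0" using AB by (intro sum.neutral ballI zero) auto
    finally show "Re (mat_trace (M * kron (N A) (L B))) = 0" .
  qed
  have zQ: "M * kron (Q A) (R B) = 0\<^sub>m ?d ?d" if AB: "A \<subseteq> S" "B \<subseteq> T" "A \<subseteq> S' \<or> B \<subseteq> T'"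
    and psd: "psd n (N A)" "psd p (L B)" for A B
  proof -
    obtain G H where G: "G \<in> carrier_mat n n" "Q A = N A * G" and H: "H \<in> carrier_mat p p" "R B = L B * H"
      using range_projector(5)[OF psd(1)] range_projector(5)[OF psd(2)] unfolding Q_def R_def by blast
    have c: "N A \<in> carrier_mat n n" "L B \<in> carrier_mat p p" using psd psd_carrier by auto
    have "M * kron (Q A) (R B) = M * kron (N A) (L B) * kron G H"
      unfolding G(2) H(2) using c G(1) H(1) Mc by (simp add: asc flip: km)
    also have "\<dots> = 0\<^sub>m ?d ?d" unfolding zN[OF AB] using G(1) H(1) by (intro left_mult_zero_mat) auto
    finally show ?thesis .
  qed
  have z1: "M * kron (Q S') (R T) = 0\<^sub>m ?d ?d" and z2: "M * kron (Q S) (R T') = 0\<^sub>m ?d ?d"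
    using zQ S T psdN by auto
  define K where "K = kron P1 P2"
  define \<rho> where "\<rho> = kron (\<alpha> x) (\<beta> y)"
  have Kc: "K \<in> carrier_mat ?d ?d" using P1 P2 by (auto simp: K_def)
  have psd\<rho>: "psd ?d \<rho>" unfolding \<rho>_def by (rule psd_kron[OF \<alpha>[OF x] \<beta>[OF y]])
  note \<rho>c = psd_carrier[OF psd\<rho>]
  have hK: "adj K = K" unfolding K_def adj_kron using P1 P2 by simp
  have KK: "K * K = K" unfolding K_def using P1 P2 by (simp add: km)
  have MK: "M * K = M * kron (Q S) (R T)"
  proof -
    have P1e: "P1 = Q S - Q S'" and P2e: "P2 = R T - R T'"
      by (simp_all add: P1_def P2_def excluding_projector_def Q_def N_def R_def L_def)
    have c: "kron P1 (R T) \<in> carrier_mat ?d ?d" "kron P1 (R T') \<in> carrier_mat ?d ?d"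
      "kron (Q S) (R T) \<in> carrier_mat ?d ?d" "kron (Q S') (R T) \<in> carrier_mat ?d ?d" "kron (Q S) (R T') \<in> carrier_mat ?d ?d"
      using P1(1) Qs(1) Qs'(1) Rs(1) Rs'(1) by auto
    have "M * kron P1 (R T) = M * kron (Q S) (R T) - M * kron (Q S') (R T)"
      using Qs(1) Qs'(1) Rs(1) Mc c by (simp add: P1e kron_minus_left[of _ n n _ _ p p] mult_minus_distrib_mat[of _ ?d ?d _ ?d])
    also have "\<dots> = M * kron (Q S) (R T)" unfolding z1 by (intro minus_zero_mat) (use Mc c in \<open>auto simp: carr\<close>)
    finally have 1: "M * kron P1 (R T) = M * kron (Q S) (R T)" .
    \<comment> \<open>\<open>z2\<close> speaks of \<open>Q S\<close>, not of \<open>P1\<close>; as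
      \<open>Q S * P1 = P1\<close>, the operator factors through the one that \<open>M\<close>
      annihilates.\<close>
    have "kron P1 (R T') = kron (Q S) (R T') * kron P1 (1\<^sub>m p)"
      using P1 Rs'(1) Qs(1) by (simp add: km)
    then have "M * kron P1 (R T') = M * kron (Q S) (R T') * kron P1 (1\<^sub>m p)"
      using Mc c P1(1) by (simp add: asc)
    then have 2: "M * kron P1 (R T') = 0\<^sub>m ?d ?d" unfolding z2 using P1(1) by (simp add: left_mult_zero_mat[of _ ?d ?d])
    have "M * K = M * kron P1 (R T) - M * kron P1 (R T')"
      using P1(1) Rs(1) Rs'(1) Mc c
      by (simp add: K_def P2e kron_minus_right[of _ n n _ p p] mult_minus_distrib_mat[of _ ?d ?d _ ?d])
    also have "\<dots> = M * kron (Q S) (R T)" unfolding 1 2 by (intro minus_zero_mat) (use Mc c in \<open>auto simp: carr\<close>)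
    finally show ?thesis .
  qed
  have "Q S * \<alpha> x = \<alpha> x" "R T * \<beta> y = \<beta> y"
    unfolding Q_def N_def R_def L_def using S T x y \<alpha> \<beta> by (auto intro!: range_projector_summand)
  then have QR\<rho>: "kron (Q S) (R T) * \<rho> = \<rho>"
    unfolding \<rho>_def using Qs(1) Rs(1) psd_carrier[OF \<alpha>[OF x]] psd_carrier[OF \<beta>[OF y]] by (simp add: km)
  have M\<rho>: "M * K * \<rho> = M * \<rho>" unfolding MK using QR\<rho> Mc \<rho>c Qs(1) Rs(1) by (simp add: asc)
  \<comment> \<open>The adjoint is the same identity from the other side; both together let
    \<open>K\<close> enclose \<rho> under the trace.\<close>
  have "adj (M * K * \<rho>) = adj (M * \<rho>)" unfolding M\<rho> ..
  then have \<rho>M: "\<rho> * K * M = \<rho> * M"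
    using Mc Kc \<rho>c hK psd_hermitian[OF M] psd_hermitian[OF psd\<rho>]
    by (simp add: adj_mult[of _ ?d ?d _ ?d] carr asc)
  have "mat_trace (M * \<rho>) = mat_trace ((\<rho> * M) * K)"
    using Mc Kc \<rho>c mat_trace_comm[of "M * K" ?d ?d \<rho>] M\<rho> by (simp add: carr asc)
  also have "\<dots> = mat_trace (M * (K * \<rho> * K))"
    unfolding \<rho>M[symmetric] using Mc Kc \<rho>c mat_trace_comm[of "\<rho> * K" ?d ?d "M * K"] by (simp add: carr asc)
  finally have "Re (mat_trace (M * \<rho>)) = Re (mat_trace (M * (K * \<rho> * K)))" by simp
  also have "\<dots> \<le> Re (mat_trace (K * \<rho> * K))"
  proof (rule M_le)
    obtain W where W: "W \<in> carrier_mat ?d ?d" "\<rho> = W * adj W" using psd_factor[OF psd\<rho>] by blast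
    have "K * \<rho> * K = (K * W) * adj (K * W)" unfolding W(2)
      using W(1) Kc hK by (simp add: adj_mult[of _ ?d ?d _ ?d] carr asc)
    then show "psd ?d (K * \<rho> * K)" using psd_gram[of "K * W" ?d ?d] W(1) Kc by (simp add: carr)
  qed
  also have "mat_trace (K * \<rho> * K) = mat_trace (K * \<rho>)"
  proof -
    have "K * (K * \<rho>) = K * K * \<rho>" using Kc \<rho>c by (simp add: asc)
    then show ?thesis using mat_trace_comm[of "K * \<rho>" ?d ?d K] Kc \<rho>c KK by (simp add: carr)
  qed
  also have "K * \<rho> = kron (P1 * \<alpha> x) (P2 * \<beta> y)"
    unfolding K_def \<rho>_def using P1 P2 psd_carrier[OF \<alpha>[OF x]] psd_carrier[OF \<beta>[OF y]] by (simp add: km)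
  also have "mat_trace \<dots> = mat_trace (P1 * \<alpha> x) * mat_trace (P2 * \<beta> y)"
    using P1(1) P2(1) psd_carrier[OF \<alpha>[OF x]] psd_carrier[OF \<beta>[OF y]]
    by (intro mat_trace_kron[of _ n _ p]) (auto simp: mult_carrier_mat)
  also have "Re \<dots> = Re (mat_trace (P1 * \<alpha> x)) * Re (mat_trace (P2 * \<beta> y))"
  proof -
    have "psd n P1" "psd p P2" using psd_gram[OF P1(1)] psd_gram[OF P2(1)] P1 P2 by simp_all
    then show ?thesis
      using psd_trace_mult_real[OF _ \<alpha>[OF x]] psd_trace_mult_real[OF _ \<beta>[OF y]]
      by (metis Re_complex_of_real of_real_mult)
  qed
  finally show ?thesis unfolding \<rho>_def P1_def P2_def .
qed

section \<open>The quantum lower bound\<close>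

lemma finite_answers [simp]: "finite (answers n)"
  by (auto simp: answers_def)

lemma finite_alice_inputs [simp]: "finite (alice_inputs n)"
  by (simp add: alice_inputs_def)

lemma card_alice_inputs: "card (alice_inputs n) = 2 ^ n"
  using card_lists_length_eq[of "UNIV :: bool set" n] by (simp add: alice_inputs_def)

definition indicator_bits :: "nat \<Rightarrow> nat set \<Rightarrow> bits" where
  "indicator_bits n I = map (\<lambda>i. i \<in> I) [0..<n]"

lemma indicator_bits_in_bob_inputs:
  assumes "I \<subseteq> {..<n}" "2 * card I = n" "length y = n"
  shows "(y, indicator_bits n I) \<in> bob_inputs n"
proof -
  have "{i. i < n \<and> indicator_bits n I ! i} = I" using assms(1) by (auto simp: indicator_bits_def)
  then show ?thesis using assms by (simp add: bob_inputs_def hamming_weight_def indicator_bits_def)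
qed

lemma sum_correct_answers:
  "(\<Sum>z\<in>correct_answers x (y, s). f z) = (\<Sum>i | i < length x \<and> s ! i. f (Some (i, x ! i, y ! i)))"
proof -
  have "correct_answers x (y, s) = (\<lambda>i. Some (i, x ! i, y ! i)) ` {i. i < length x \<and> s ! i}" by auto
  then show ?thesis by (simp add: sum.reindex inj_on_def)
qed

lemma povm_element_trace_le:
  assumes M: "povm d Z M" and z: "z \<in> Z" and K: "psd d K"
  shows "Re (mat_trace (M z * K)) \<le> Re (mat_trace K)"
proof -
  have Mp: "psd d (M z)" if "z \<in> Z" for z using M that by (simp add: povm_def)
  have fin: "finite Z" and one: "msum d Z M = 1\<^sub>m d" using M by (simp_all add: povm_def msum_def)
  note Kc = psd_carrier[OF K] and Mc = psd_carrier[OF Mp]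
  have "mat_trace K = mat_trace (K * msum d Z M)" unfolding one using Kc by simp
  also have "\<dots> = (\<Sum>z\<in>Z. mat_trace (K * M z))"
  proof -
    have KM: "K * M z \<in> carrier_mat d d" if "z \<in> Z" for z by (rule mult_carrier_mat[OF Kc Mc[OF that]])
    have "K * msum d Z M = msum d Z (\<lambda>z. K * M z)" by (rule mult_msum[OF Kc Mc])
    then show ?thesis using mat_trace_msum[OF KM, of Z "\<lambda>z. z"] by simp
  qed
  also have "\<dots> = (\<Sum>z\<in>Z. mat_trace (M z * K))" using Kc Mc by (intro sum.cong refl mat_trace_comm) auto
  finally have "Re (mat_trace K) = (\<Sum>z\<in>Z. Re (mat_trace (M z * K)))" by simp
  then show ?thesis using member_le_sum[of z Z "\<lambda>z. Re (mat_trace (M z * K))"] z fin psd_trace_mult_nonneg[OF Mp K] by simp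
qed

section \<open>Bits that a single message reveals with certainty\<close>

definition flipped_inputs :: "nat \<Rightarrow> nat \<Rightarrow> bool \<Rightarrow> bits set" where
  "flipped_inputs n i v = {x \<in> alice_inputs n. x ! i \<noteq> v}"

definition bit_detector :: "nat \<Rightarrow> nat \<Rightarrow> (bits \<Rightarrow> complex mat) \<Rightarrow> nat \<Rightarrow> bool \<Rightarrow> complex mat" where
  "bit_detector n q \<alpha> i v = excluding_projector (2 ^ q) (alice_inputs n) (flipped_inputs n i v) \<alpha>"

definition reveal_prob :: "nat \<Rightarrow> nat \<Rightarrow> (bits \<Rightarrow> complex mat) \<Rightarrow> nat \<Rightarrow> bits \<Rightarrow> real" where
  "reveal_prob n q \<alpha> i x = Re (mat_trace (bit_detector n q \<alpha> i (x ! i) * \<alpha> x))"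

text \<open>Stated for any family of states indexed by \<open>n\<close>-bit strings: it serves
  Alice's messages and, once \<open>s\<close> is fixed, Bob's messages as a function of
  \<open>y\<close>.\<close>

lemma reveal_prob_sum_le:
  assumes "\<And>x. x \<in> alice_inputs n \<Longrightarrow> density_matrix (2 ^ q) (\<alpha> x)"
  shows "(\<Sum>i<n. \<Sum>x\<in>alice_inputs n. reveal_prob n q \<alpha> i x) \<le> 64 * (real q + 3) * 2 ^ n"
    and "x \<in> alice_inputs n \<Longrightarrow> 0 \<le> reveal_prob n q \<alpha> i x"
proof -
  have psd: "\<And>x. x \<in> alice_inputs n \<Longrightarrow> psd (2 ^ q) (\<alpha> x)" using assms by (simp add: density_matrix_def)
  note P = excluding_projector[OF finite_alice_inputs, of "flipped_inputs n i v" n "2 ^ q" \<alpha> for i v, folded bit_detector_def]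
  have fl: "flipped_inputs n i v \<subseteq> alice_inputs n" for i v by (auto simp: flipped_inputs_def)
  note P = P[OF fl psd]
  have "(\<Sum>x | length x = n. \<Sum>i<n. Re (mat_trace (bit_detector n q \<alpha> i (x ! i) * \<alpha> x))) / 2 ^ n \<le> 64 * (real q + 3)"
  proof (rule unambiguous_bits_bound)
    show "bit_detector n q \<alpha> i b * \<alpha> x = 0\<^sub>m (2 ^ q) (2 ^ q)" if "length x = n" "x ! i \<noteq> b" for x i b
      using that by (intro P(4)) (auto simp: flipped_inputs_def alice_inputs_def)
  qed (use assms P(1-3) in \<open>auto simp: alice_inputs_def\<close>)
  then have "(\<Sum>x\<in>alice_inputs n. \<Sum>i<n. reveal_prob n q \<alpha> i x) \<le> 64 * (real q + 3) * 2 ^ n"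
    by (simp add: reveal_prob_def alice_inputs_def divide_le_eq)
  then show "(\<Sum>i<n. \<Sum>x\<in>alice_inputs n. reveal_prob n q \<alpha> i x) \<le> 64 * (real q + 3) * 2 ^ n"
    by (subst sum.swap)
  have "psd (2 ^ q) (bit_detector n q \<alpha> i v)" for i v
    using psd_gram[OF P(1)[of i v]] P(2,3)[of i v] by simp
  then show "0 \<le> reveal_prob n q \<alpha> i x" if "x \<in> alice_inputs n" for x
    unfolding reveal_prob_def using psd[OF that] by (rule psd_trace_mult_nonneg)
qed

text \<open>Markov's inequality: more than \<open>n / 2\<close> positions with values above
  \<open>2 * B / n\<close> would push the sum beyond \<open>B\<close>.\<close>

lemma light_half:
  fixes p :: "nat \<Rightarrow> real"
  assumes p: "\<And>i. i < n \<Longrightarrow> 0 \<le> p i" and B: "(\<Sum>i<n. p i) \<le> B" "0 < B" and n: "even n" "0 < n"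
  shows "\<exists>I\<subseteq>{..<n}. 2 * card I = n \<and> (\<forall>i\<in>I. p i \<le> 2 * B / n)"
proof -
  define L where "L = {i. i < n \<and> p i \<le> 2 * B / n}"
  have fin: "finite L" "L \<subseteq> {..<n}" by (auto simp: L_def)
  have "n div 2 \<le> card L"
  proof (rule ccontr)
    assume "\<not> n div 2 \<le> card L"
    then have "real n < 2 * real (card ({..<n} - L))" using fin n by (subst card_Diff_subset) (auto elim!: evenE)
    moreover have "real (card ({..<n} - L)) * (2 * B / n) \<le> (\<Sum>i\<in>{..<n} - L. p i)"
      by (rule sum_bounded_below) (auto simp: L_def)
    moreover have "(\<Sum>i\<in>{..<n} - L. p i) \<le> (\<Sum>i<n. p i)" using p by (intro sum_mono2) auto
    ultimately have c: "real (card ({..<n} - L)) * (2 * B / n) \<le> B" "real n < 2 * real (card ({..<n} - L))" using B by auto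
    have "B = real n / 2 * (2 * B / n)" using n by simp
    also have "\<dots> < real (card ({..<n} - L)) * (2 * B / n)" using c(2) B n by (intro mult_strict_right_mono) auto
    finally show False using c(1) by simp
  qed
  then obtain I where "I \<subseteq> L" "card I = n div 2" using fin by (meson obtain_subset_with_card_n)
  then show ?thesis using n fin by (intro exI[of _ I]) (auto simp: L_def)
qed

theorem quantum_lower_bound:
  assumes n: "even n" "0 < n" and qp: "quantum_protocol (1 / 3) n c"
  shows "sqrt (real n) \<le> 111 * (real c + 3)"
proof -
  obtain a b \<alpha> \<beta> M where ab: "a + b \<le> c" and \<alpha>: "\<And>x. x \<in> alice_inputs n \<Longrightarrow> density_matrix (2 ^ a) (\<alpha> x)"
    and \<beta>: "\<And>ys. ys \<in> bob_inputs n \<Longrightarrow> density_matrix (2 ^ b) (\<beta> ys)"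
    and M: "povm (2 ^ (a + b)) (answers n) M"
    and sol: "solves (1 / 3) n (\<lambda>x ys z. Re (mat_trace (M z * kron (\<alpha> x) (\<beta> ys))))"
    using qp unfolding quantum_protocol_def by blast
  let ?X = "alice_inputs n"
  define B1 where "B1 = 64 * (real a + 3)"
  define B2 where "B2 = 64 * (real b + 3)"
  have Bpos: "0 < B1" "0 < B2" by (auto simp: B1_def B2_def)
  let ?p = "\<lambda>i. (\<Sum>x\<in>?X. reveal_prob n a \<alpha> i x) / 2 ^ n"
  have "(\<Sum>i<n. ?p i) \<le> B1"
    using reveal_prob_sum_le(1)[OF \<alpha>] by (simp add: B1_def divide_le_eq flip: sum_divide_distrib)
  moreover have p0: "0 \<le> ?p i" for i using reveal_prob_sum_le(2)[OF \<alpha>] by (auto intro!: divide_nonneg_pos sum_nonneg)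
  ultimately obtain I where I: "I \<subseteq> {..<n}" "2 * card I = n" and light: "\<And>i. i \<in> I \<Longrightarrow> ?p i \<le> 2 * B1 / n"
    using light_half[of n ?p B1] n Bpos by blast
  define s where "s = indicator_bits n I"
  have sI: "{i. i < n \<and> s ! i} = I" using I(1) by (auto simp: s_def indicator_bits_def)
  \<comment> \<open>With \<open>s\<close> fixed from Alice's statistics alone, Bob's input is the
    string \<open>y\<close>, which ranges over all strings independently of
    \<open>x\<close>.\<close>
  define \<gamma> where "\<gamma> y = \<beta> (y, s)" for y
  have ys: "(y, s) \<in> bob_inputs n" if "y \<in> ?X" for y
    using that I by (auto simp: s_def alice_inputs_def intro!: indicator_bits_in_bob_inputs)
  have \<gamma>: "density_matrix (2 ^ b) (\<gamma> y)" if "y \<in> ?X" for y using \<beta>[OF ys[OF that]] by (simp add: \<gamma>_def)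
  let ?q = "\<lambda>i. (\<Sum>y\<in>?X. reveal_prob n b \<gamma> i y) / 2 ^ n"
  have q: "(\<Sum>i<n. ?q i) \<le> B2"
    using reveal_prob_sum_le(1)[OF \<gamma>] by (simp add: B2_def divide_le_eq flip: sum_divide_distrib)
  have q0: "0 \<le> ?q i" for i using reveal_prob_sum_le(2)[OF \<gamma>] by (auto intro!: divide_nonneg_pos sum_nonneg)
  have M': "povm (2 ^ a * 2 ^ b) (answers n) M" using M by (simp add: power_add)
  have bound: "Re (mat_trace (M (Some (i, x ! i, y ! i)) * kron (\<alpha> x) (\<gamma> y))) \<le> reveal_prob n a \<alpha> i x * reveal_prob n b \<gamma> i y"
    if x: "x \<in> ?X" and y: "y \<in> ?X" and i: "i \<in> I" for x y i
    unfolding reveal_prob_def bit_detector_def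
  proof (rule zero_error_product_bound)
    have z: "Some (i, x ! i, y ! i) \<in> answers n" using i I by (auto simp: answers_def)
    show "psd (2 ^ a * 2 ^ b) (M (Some (i, x ! i, y ! i)))" using M' z by (simp add: povm_def)
    show "Re (mat_trace (M (Some (i, x ! i, y ! i)) * K)) \<le> Re (mat_trace K)" if "psd (2 ^ a * 2 ^ b) K" for K
      using povm_element_trace_le[OF M' z that] .
    show "Re (mat_trace (M (Some (i, x ! i, y ! i)) * kron (\<alpha> x') (\<gamma> y'))) = 0"
      if "x' \<in> ?X" "y' \<in> ?X" "x' \<in> flipped_inputs n i (x ! i) \<or> y' \<in> flipped_inputs n i (y ! i)" for x' y'
    proof -
      have "Some (i, x ! i, y ! i) \<in> answers n - insert None (correct_answers x' (y', s))"
        using z that(3) by (auto simp: flipped_inputs_def)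
      then show ?thesis using sol that(1) ys[OF that(2)] unfolding solves_def \<gamma>_def by blast
    qed
  qed (use \<alpha> \<gamma> x y in \<open>auto simp: density_matrix_def flipped_inputs_def\<close>)
  have "2 / 3 \<le> (\<Sum>i\<in>I. reveal_prob n a \<alpha> i x * reveal_prob n b \<gamma> i y)" if x: "x \<in> ?X" and y: "y \<in> ?X" for x y
  proof -
    have "1 - 1 / 3 \<le> (\<Sum>z\<in>correct_answers x (y, s). Re (mat_trace (M z * kron (\<alpha> x) (\<gamma> y))))"
      using sol x ys[OF y] unfolding solves_def \<gamma>_def by blast
    also have "\<dots> = (\<Sum>i\<in>I. Re (mat_trace (M (Some (i, x ! i, y ! i)) * kron (\<alpha> x) (\<gamma> y))))"
      unfolding sum_correct_answers using sI x by (simp add: alice_inputs_def)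
    also have "\<dots> \<le> (\<Sum>i\<in>I. reveal_prob n a \<alpha> i x * reveal_prob n b \<gamma> i y)"
      by (intro sum_mono bound x y)
    finally show ?thesis by simp
  qed
  then have "(\<Sum>x\<in>?X. \<Sum>y\<in>?X. 2 / 3) \<le> (\<Sum>x\<in>?X. \<Sum>y\<in>?X. \<Sum>i\<in>I. reveal_prob n a \<alpha> i x * reveal_prob n b \<gamma> i y)"
    by (intro sum_mono) auto
  also have "\<dots> = (\<Sum>x\<in>?X. \<Sum>i\<in>I. \<Sum>y\<in>?X. reveal_prob n a \<alpha> i x * reveal_prob n b \<gamma> i y)"
    by (intro sum.cong refl sum.swap)
  also have "\<dots> = (\<Sum>i\<in>I. \<Sum>x\<in>?X. \<Sum>y\<in>?X. reveal_prob n a \<alpha> i x * reveal_prob n b \<gamma> i y)" by (rule sum.swap)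
  \<comment> \<open>Independence of \<open>x\<close> and \<open>y\<close>: the mean of the product
    is the product of the means.\<close>
  also have "\<dots> = (\<Sum>i\<in>I. ?p i * ?q i) * (2 ^ n * 2 ^ n)"
    by (simp add: sum_product flip: sum_divide_distrib)
  finally have "2 / 3 \<le> (\<Sum>i\<in>I. ?p i * ?q i)" by (simp add: card_alice_inputs)
  also have "\<dots> \<le> (\<Sum>i\<in>I. 2 * B1 / n * ?q i)" using light q0 by (intro sum_mono mult_right_mono) auto
  also have "\<dots> = 2 * B1 / n * (\<Sum>i\<in>I. ?q i)" by (simp only: sum_distrib_left)
  also have "\<dots> \<le> 2 * B1 / n * B2"
  proof (rule mult_left_mono)
    have "(\<Sum>i\<in>I. ?q i) \<le> (\<Sum>i<n. ?q i)" using I q0 by (intro sum_mono2) auto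
    then show "(\<Sum>i\<in>I. ?q i) \<le> B2" using q by linarith
  qed (use Bpos in auto)
  finally have "real n \<le> 3 * (B1 * B2)" using n by (simp add: field_simps)
  also have "\<dots> \<le> 3 * ((64 * (real c + 3)) * (64 * (real c + 3)))"
    unfolding B1_def B2_def using ab by (intro mult_left_mono mult_mono) auto
  also have "\<dots> = 12288 * (real c + 3)\<^sup>2" by (simp add: power2_eq_square algebra_simps)
  \<comment> \<open>\<open>12288 = 3 * 64^2\<close>, and \<open>111^2 = 12321\<close> is the next
    square above it.\<close>
  also have "\<dots> \<le> (111 * (real c + 3))\<^sup>2" unfolding power_mult_distrib by (intro mult_right_mono) auto
  finally show ?thesis by (intro real_le_lsqrt) auto
qed

section \<open>Classical protocols\<close>

text \<open>Messages may have any length up to \<open>c\<close>; all of them together can be indexed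
  by \<open>Suc c\<close> bits or qubits.\<close>

lemma card_short_bits: "finite {v :: bits. length v \<le> c}" "card {v :: bits. length v \<le> c} < 2 ^ Suc c"
proof -
  have *: "{v :: bits. length v \<le> c} = {v. set v \<subseteq> UNIV \<and> length v \<le> c}" by simp
  show "finite {v :: bits. length v \<le> c}" unfolding * by (rule finite_lists_length_le) simp
  have "(\<Sum>i\<le>c. 2 ^ i) < (2 ^ Suc c :: nat)" by (induction c) auto
  then show "card {v :: bits. length v \<le> c} < 2 ^ Suc c"
    unfolding * by (subst card_lists_length_le) (simp_all add: lessThan_Suc_atMost)
qed

lemma alice_inputs_nonempty: "replicate n False \<in> alice_inputs n"
  by (simp add: alice_inputs_def)

lemma bob_inputs_nonempty: "even n \<Longrightarrow> length y = n \<Longrightarrow> (y, indicator_bits n {..<n div 2}) \<in> bob_inputs n"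
  by (intro indicator_bits_in_bob_inputs) auto

lemma psd_diag:
  assumes "\<And>i. i < d \<Longrightarrow> 0 \<le> w i"
  shows "psd d (mat d d (\<lambda>(i, j). if i = j then complex_of_real (w i) else 0))"
proof -
  let ?S = "mat d d (\<lambda>(i, j). if i = j then complex_of_real (sqrt (w i)) else 0)"
  have "?S * adj ?S = mat d d (\<lambda>(i, j). if i = j then complex_of_real (w i) else 0)" (is "_ = ?D")
  proof (rule eq_matI)
    fix i j assume "i < dim_row ?D" "j < dim_col ?D"
    then have ij: "i < d" "j < d" by auto
    have "(?S * adj ?S) $$ (i, j) = (\<Sum>k<d. ?S $$ (i, k) * adj ?S $$ (k, j))" using ij by (intro mult_index) auto
    also have "\<dots> = (\<Sum>k<d. if k = i then (if i = j then complex_of_real (w i) else 0) else 0)"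
      using ij assms by (intro sum.cong) (auto simp flip: of_real_mult)
    also have "\<dots> = ?D $$ (i, j)" using ij by simp
    finally show "(?S * adj ?S) $$ (i, j) = ?D $$ (i, j)" .
  qed auto
  then show ?thesis using psd_gram[of ?S d d] by simp
qed

lemma pmf_bind_finite:
  assumes "finite L" "set_pmf p \<subseteq> L"
  shows "pmf (bind_pmf p f) z = (\<Sum>u\<in>L. pmf p u * pmf (f u) z)"
  unfolding pmf_bind by (subst integral_measure_pmf_real[OF assms(1)]) (use assms in \<open>auto simp: mult.commute\<close>)

text \<open>Alice's and Bob's message distributions become diagonal states, and the referee's
  randomised rule becomes a diagonal measurement. Only the sum of the two lengths is bounded, so
  each party receives a register for messages of length up to \<open>c\<close>. Evenness of
  \<open>n\<close> provides an input for Bob, without which the cost condition would say nothing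
  about Alice's messages.\<close>

lemma private_to_quantum:
  assumes n: "even n" and pp: "private_protocol \<epsilon> n c"
  shows "quantum_protocol \<epsilon> n (2 * Suc c)"
proof -
  obtain A B C where len: "\<And>x ys a b. x \<in> alice_inputs n \<Longrightarrow> ys \<in> bob_inputs n \<Longrightarrow> a \<in> set_pmf (A x) \<Longrightarrow> b \<in> set_pmf (B ys)
      \<Longrightarrow> length a + length b \<le> c"
    and C: "\<And>a b. set_pmf (C a b) \<subseteq> answers n"
    and sol: "solves \<epsilon> n (\<lambda>x ys. pmf (private_output A B C x ys))"
    using pp unfolding private_protocol_def by blast
  define L where "L = {v :: bits. length v \<le> c}"
  define N where "N = (2 :: nat) ^ Suc c"
  note L = card_short_bits[of c, folded L_def N_def]
  obtain e where e: "inj_on e L" "e ` L \<subseteq> {..<N}"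
    using card_le_inj[OF L(1), of "{..<N}"] L(2) by auto
  define d where "d = inv_into L e"
  have de: "d (e v) = v" if "v \<in> L" for v using that e by (simp add: d_def)
  have A: "set_pmf (A x) \<subseteq> L" if "x \<in> alice_inputs n" for x
  proof
    fix a assume a: "a \<in> set_pmf (A x)"
    obtain b where b: "b \<in> set_pmf (B (replicate n False, indicator_bits n {..<n div 2}))" using set_pmf_not_empty by fast
    then show "a \<in> L" using len[OF that bob_inputs_nonempty[OF n length_replicate] a b] by (simp add: L_def)
  qed
  have B: "set_pmf (B ys) \<subseteq> L" if "ys \<in> bob_inputs n" for ys
  proof
    fix b assume b: "b \<in> set_pmf (B ys)"
    obtain a where a: "a \<in> set_pmf (A (replicate n False))" using set_pmf_not_empty by fast
    then show "b \<in> L" using len[OF alice_inputs_nonempty that a b] by (simp add: L_def)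
  qed
  define w where "w p i = (if i \<in> e ` L then pmf p (d i) else 0)" for p :: "bits pmf" and i
  define \<rho> where "\<rho> p = mat N N (\<lambda>(i, j). if i = j then complex_of_real (w p i) else 0)" for p
  \<comment> \<open>An index outside the code decodes to some arbitrary string, but \<open>C\<close>
    is a distribution there too, so the operators still sum to the identity.\<close>
  define M where "M z = mat (N * N) (N * N) (\<lambda>(i, j). if i = j then complex_of_real (pmf (C (d (i div N)) (d (i mod N))) z) else 0)" for z
  have sumw: "(\<Sum>i<N. w p i * f i) = (\<Sum>v\<in>L. pmf p v * f (e v))" for p and f :: "nat \<Rightarrow> real"
  proof -
    have "(\<Sum>i<N. w p i * f i) = (\<Sum>i\<in>e ` L. w p i * f i)"
      using e(2) by (intro sum.mono_neutral_right) (auto simp: w_def)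
    also have "\<dots> = (\<Sum>v\<in>L. w p (e v) * f (e v))" using e(1) by (simp add: sum.reindex)
    also have "\<dots> = (\<Sum>v\<in>L. pmf p v * f (e v))" by (intro sum.cong) (auto simp: w_def de)
    finally show ?thesis .
  qed
  have dens: "density_matrix N (\<rho> p)" if "set_pmf p \<subseteq> L" for p
  proof -
    have "mat_trace (\<rho> p) = complex_of_real (\<Sum>i<N. w p i * 1)" by (simp add: mat_trace_def \<rho>_def)
    also have "(\<Sum>i<N. w p i * 1) = 1" unfolding sumw using sum_pmf_eq_1[OF L(1) that] by simp
    finally show ?thesis unfolding density_matrix_def \<rho>_def by (auto intro!: psd_diag simp: w_def)
  qed
  have trM: "mat_trace (M z * kron (\<rho> p) (\<rho> q)) = complex_of_real (\<Sum>i<N. w p i * (\<Sum>j<N. w q j * pmf (C (d i) (d j)) z))" for z p q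
  proof -
    have N0: "N > 0" by (simp add: N_def)
    have Mc: "M z \<in> carrier_mat (N * N) (N * N)" and \<rho>c: "\<And>p. \<rho> p \<in> carrier_mat N N" by (auto simp: M_def \<rho>_def)
    have "mat_trace (M z * kron (\<rho> p) (\<rho> q)) = (\<Sum>i<N * N. \<Sum>k<N * N. M z $$ (i, k) * kron (\<rho> p) (\<rho> q) $$ (k, i))"
      by (rule mat_trace_mult[OF Mc]) (use \<rho>c in auto)
    also have "\<dots> = (\<Sum>i<N * N. \<Sum>k<N * N. if k = i then complex_of_real (w p (i div N) * (w q (i mod N) * pmf (C (d (i div N)) (d (i mod N))) z)) else 0)"
    proof (intro sum.cong refl)
      fix i k assume ik: "i \<in> {..<N * N}" "k \<in> {..<N * N}"
      then have "kron (\<rho> p) (\<rho> q) $$ (i, i) = \<rho> p $$ (i div N, i div N) * \<rho> q $$ (i mod N, i mod N)"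
        by (intro kron_index[OF \<rho>c \<rho>c]) auto
      also have "\<dots> = complex_of_real (w p (i div N) * w q (i mod N))"
        using ik N0 by (simp add: \<rho>_def less_mult_imp_div_less)
      finally have "kron (\<rho> p) (\<rho> q) $$ (i, i) = complex_of_real (w p (i div N) * w q (i mod N))" .
      then show "M z $$ (i, k) * kron (\<rho> p) (\<rho> q) $$ (k, i) =
          (if k = i then complex_of_real (w p (i div N) * (w q (i mod N) * pmf (C (d (i div N)) (d (i mod N))) z)) else 0)"
        using ik by (simp add: M_def)
    qed
    also have "\<dots> = complex_of_real (\<Sum>i<N * N. w p (i div N) * (w q (i mod N) * pmf (C (d (i div N)) (d (i mod N))) z))" by simp
    also have "(\<Sum>i<N * N. w p (i div N) * (w q (i mod N) * pmf (C (d (i div N)) (d (i mod N))) z)) =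
        (\<Sum>i<N. \<Sum>j<N. w p i * (w q j * pmf (C (d i) (d j)) z))"
      by (rule sum_div_mod)
    finally show ?thesis by (simp add: sum_distrib_left)
  qed
  have out: "Re (mat_trace (M z * kron (\<rho> (A x)) (\<rho> (B ys)))) = pmf (private_output A B C x ys) z"
    if "x \<in> alice_inputs n" "ys \<in> bob_inputs n" for x ys z
    unfolding trM sumw private_output_def pmf_bind_finite[OF L(1) A[OF that(1)]] pmf_bind_finite[OF L(1) B[OF that(2)]]
    by (simp add: de)
  have povm: "povm (2 ^ (Suc c + Suc c)) (answers n) M"
    unfolding povm_def
  proof (intro conjI ballI)
    have NN: "(2 ^ (Suc c + Suc c) :: nat) = N * N" unfolding N_def by (rule power_add)
    show "psd (2 ^ (Suc c + Suc c)) (M z)" for z unfolding NN M_def by (intro psd_diag) auto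
    have "(\<Sum>z\<in>answers n. pmf (C a b) z) = 1" for a b by (rule sum_pmf_eq_1) (use C in auto)
    then have s: "(\<Sum>z\<in>answers n. complex_of_real (pmf (C a b) z)) = 1" for a b unfolding of_real_sum[symmetric] by simp
    show "mat (2 ^ (Suc c + Suc c)) (2 ^ (Suc c + Suc c)) (\<lambda>(i, j). \<Sum>z\<in>answers n. M z $$ (i, j)) = 1\<^sub>m (2 ^ (Suc c + Suc c))"
      unfolding NN
    proof (rule eq_matI)
      fix i j assume "i < dim_row (1\<^sub>m (N * N) :: complex mat)" "j < dim_col (1\<^sub>m (N * N) :: complex mat)"
      then show "mat (N * N) (N * N) (\<lambda>(i, j). \<Sum>z\<in>answers n. M z $$ (i, j)) $$ (i, j) = 1\<^sub>m (N * N) $$ (i, j)"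
        by (cases "i = j") (simp_all add: M_def s)
    qed auto
  qed simp
  show ?thesis
    unfolding quantum_protocol_def
  proof (intro exI conjI ballI)
    show "Suc c + Suc c \<le> 2 * Suc c" by simp
    show "density_matrix (2 ^ Suc c) (\<rho> (A x))" if "x \<in> alice_inputs n" for x using dens[OF A[OF that]] by (simp only: N_def)
    show "density_matrix (2 ^ Suc c) (\<rho> (B ys))" if "ys \<in> bob_inputs n" for ys using dens[OF B[OF that]] by (simp only: N_def)
    show "povm (2 ^ (Suc c + Suc c)) (answers n) M" by (rule povm)
    show "solves \<epsilon> n (\<lambda>x ys z. Re (mat_trace (M z * kron (\<rho> (A x)) (\<rho> (B ys)))))"
      using sol unfolding solves_def by (auto simp: out)
  qed
qed

text \<open>One position \<open>pick a b\<close> per message pair is enough, even if the referee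
  randomises over many, and it does not depend on the coin because he does not see it. Let
  \<open>s\<close> avoid all picked positions. Some pair that occurs leads to a triple, so its
  picked position is also named with positive probability; zero error then puts that position among
  the ones of \<open>s\<close>.\<close>

theorem public_lower_bound:
  assumes n: "even n" "0 < n" and pp: "public_protocol (1 / 3) n c"
  shows "n < 2 ^ (2 * c + 3)"
proof (rule ccontr)
  assume big: "\<not> n < 2 ^ (2 * c + 3)"
  obtain R A B C where len: "\<And>r x ys a b. r \<in> set_pmf R \<Longrightarrow> x \<in> alice_inputs n \<Longrightarrow> ys \<in> bob_inputs n \<Longrightarrow> a \<in> set_pmf (A r x)
      \<Longrightarrow> b \<in> set_pmf (B r ys) \<Longrightarrow> length a + length b \<le> c"
    and C: "\<And>a b. set_pmf (C a b) \<subseteq> answers n"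
    and sol: "solves (1 / 3) n (\<lambda>x ys. pmf (public_output R A B C x ys))"
    using pp unfolding public_protocol_def by blast
  define L where "L = {v :: bits. length v \<le> c}"
  note L = card_short_bits[of c, folded L_def]
  define pick where "pick a b = (SOME i. \<exists>u v. Some (i, u, v) \<in> set_pmf (C a b))" for a b
  define I where "I = (\<lambda>(a, b). pick a b) ` (L \<times> L)"
  have "card I \<le> card L * card L" using card_image_le[of "L \<times> L" "\<lambda>(a, b). pick a b"] L(1) by (simp add: I_def card_cartesian_product)
  also have "\<dots> \<le> 2 ^ Suc c * 2 ^ Suc c" using L(2) by (intro mult_mono) auto
  finally have "card I \<le> 2 ^ Suc c * 2 ^ Suc c" .
  moreover have "(2 :: nat) ^ (2 * c + 3) = 2 * (2 ^ Suc c * 2 ^ Suc c)"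
  proof -
    have "2 * c + 3 = 1 + (Suc c + Suc c)" by simp
    then show ?thesis by (simp only: power_add power_one_right)
  qed
  ultimately have "2 * card I \<le> 2 ^ (2 * c + 3)" by linarith
  then have "2 * card I \<le> n" using big by linarith
  then have "n div 2 \<le> card ({..<n} - I)"
    using diff_card_le_card_Diff[of I "{..<n}"] L(1) n by (auto simp: I_def elim!: evenE)
  then obtain J where J: "J \<subseteq> {..<n} - I" "card J = n div 2" by (meson obtain_subset_with_card_n)
  define x where "x = replicate n False"
  define s where "s = indicator_bits n J"
  have x: "x \<in> alice_inputs n" by (simp add: x_def alice_inputs_nonempty)
  have ys: "(x, s) \<in> bob_inputs n" unfolding s_def using J n by (intro indicator_bits_in_bob_inputs) (auto simp: x_def)
  have "0 < (\<Sum>z\<in>correct_answers x (x, s). pmf (public_output R A B C x (x, s)) z)"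
    using sol x ys unfolding solves_def by fastforce
  then obtain z where z: "z \<in> correct_answers x (x, s)" "pmf (public_output R A B C x (x, s)) z \<noteq> 0"
    by (metis less_irrefl sum.neutral)
  then have "z \<in> set_pmf (public_output R A B C x (x, s))" by (simp add: set_pmf_iff)
  then obtain r a b where r: "r \<in> set_pmf R" "a \<in> set_pmf (A r x)" "b \<in> set_pmf (B r (x, s))" "z \<in> set_pmf (C a b)"
    by (auto simp: public_output_def private_output_def)
  have abL: "a \<in> L" "b \<in> L" using len[OF r(1) x ys r(2,3)] by (auto simp: L_def)
  have "\<exists>i u v. Some (i, u, v) \<in> set_pmf (C a b)" using z(1) r(4) by auto
  then obtain u v where uv: "Some (pick a b, u, v) \<in> set_pmf (C a b)"
    unfolding pick_def using someI_ex[of "\<lambda>i. \<exists>u v. Some (i, u, v) \<in> set_pmf (C a b)"] by blast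
  then have "Some (pick a b, u, v) \<in> set_pmf (public_output R A B C x (x, s))"
    using r by (auto simp: public_output_def private_output_def)
  then have "pmf (public_output R A B C x (x, s)) (Some (pick a b, u, v)) \<noteq> 0" by (simp add: set_pmf_iff)
  moreover have "Some (pick a b, u, v) \<in> answers n" using uv C by auto
  ultimately have "Some (pick a b, u, v) \<in> correct_answers x (x, s)"
    using sol x ys unfolding solves_def by blast
  then have "pick a b \<in> J" by (auto simp: s_def indicator_bits_def x_def)
  then show False using J(1) abL by (auto simp: I_def)
qed

section \<open>Protocols driven by a uniform coin\<close>

lemma finite_message_code:
  assumes "finite T" "card T \<le> 2 ^ l"
  shows "\<exists>(enc :: 'a \<Rightarrow> bits) dec. \<forall>t\<in>T. length (enc t) = l \<and> dec (enc t) = t"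
proof -
  have "card {v :: bits. length v = l} = 2 ^ l" using card_alice_inputs by (simp add: alice_inputs_def)
  then obtain e :: "'a \<Rightarrow> bits" where "inj_on e T" "e ` T \<subseteq> {v. length v = l}"
    using card_le_inj[OF assms(1), of "{v :: bits. length v = l}"] assms by auto
  then show ?thesis by (intro exI[of _ e] exI[of _ "inv_into T e"]) auto
qed

text \<open>In both constructions the output is a function of the inputs and one uniform coin, so
  correctness reduces to counting the coins that yield no answer.\<close>

lemma solves_uniform:
  fixes out :: "bits \<Rightarrow> bits \<times> bits \<Rightarrow> 'w \<Rightarrow> answer"
  assumes W: "finite W" "W \<noteq> {}"
    and cor: "\<And>x ys w. x \<in> alice_inputs n \<Longrightarrow> ys \<in> bob_inputs n \<Longrightarrow> w \<in> W \<Longrightarrow> out x ys w \<in> insert None (correct_answers x ys)"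
    and fail: "\<And>x ys. x \<in> alice_inputs n \<Longrightarrow> ys \<in> bob_inputs n \<Longrightarrow> 3 * card {w \<in> W. out x ys w = None} \<le> card W"
    and p: "\<And>x ys. x \<in> alice_inputs n \<Longrightarrow> ys \<in> bob_inputs n \<Longrightarrow> p x ys = map_pmf (out x ys) (pmf_of_set W)"
  shows "solves (1 / 3) n (\<lambda>x ys. pmf (p x ys))"
  unfolding solves_def
proof (intro ballI conjI)
  fix x ys assume xy: "x \<in> alice_inputs n" "ys \<in> bob_inputs n"
  have set: "set_pmf (p x ys) \<subseteq> insert None (correct_answers x ys)" 
  proof -
    have "set_pmf (p x ys) = out x ys ` W" using W by (simp add: p[OF xy])
    then show ?thesis using cor[OF xy] by (simp only: image_subset_iff) auto
  qed
  show "pmf (p x ys) z = 0" if "z \<in> answers n - insert None (correct_answers x ys)" for z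
    using that set by (auto simp: set_pmf_iff)
  have fin: "finite (correct_answers x ys)" by (cases ys) auto
  have "None \<notin> correct_answers x ys" by (cases ys) auto
  then have "(\<Sum>z\<in>insert None (correct_answers x ys). pmf (p x ys) z) = pmf (p x ys) None + (\<Sum>z\<in>correct_answers x ys. pmf (p x ys) z)"
    using fin by simp
  moreover have "(\<Sum>z\<in>insert None (correct_answers x ys). pmf (p x ys) z) = 1" using fin set by (intro sum_pmf_eq_1) auto
  moreover have "pmf (p x ys) None = card {w \<in> W. out x ys w = None} / card W"
    unfolding p[OF xy] pmf_map measure_pmf_of_set[OF W(2,1)] by (rule arg_cong[where f = "\<lambda>S. card S / card W"]) auto
  moreover have "real (card {w \<in> W. out x ys w = None}) / card W \<le> 1 / 3"
    using fail[OF xy] W by (simp add: divide_simps card_gt_0_iff)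
  ultimately show "1 - 1 / 3 \<le> (\<Sum>z\<in>correct_answers x ys. pmf (p x ys) z)" by linarith
qed

lemma card_bad_positions:
  assumes "ys \<in> bob_inputs n"
  shows "2 * card {i. i < n \<and> \<not> snd ys ! i} = n" "2 * card {i. i < n \<and> snd ys ! i} = n"
proof -
  obtain y s where ys: "ys = (y, s)" by (cases ys)
  have h: "2 * card {i. i < n \<and> s ! i} = n" using assms by (auto simp: ys bob_inputs_def hamming_weight_def)
  have "card ({i. i < n \<and> s ! i} \<union> {i. i < n \<and> \<not> s ! i}) = card {i. i < n \<and> s ! i} + card {i. i < n \<and> \<not> s ! i}"
    by (rule card_Un_disjoint) auto
  moreover have "{i. i < n \<and> s ! i} \<union> {i. i < n \<and> \<not> s ! i} = {..<n}" by auto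
  ultimately show "2 * card {i. i < n \<and> \<not> snd ys ! i} = n" "2 * card {i. i < n \<and> snd ys ! i} = n" using h by (auto simp: ys)
qed

text \<open>Two independent positions both miss the ones of \<open>s\<close> with probability
  \<open>1 / 4\<close>; a single one would miss with probability \<open>1 / 2\<close>, too often.
  The referee does not see the coin, so Bob names the position and flags which of Alice's two bits
  belongs to it.\<close>

theorem public_upper_bound:
  assumes n: "0 < n" and l: "n \<le> 2 ^ l"
  shows "public_protocol (1 / 3) n (2 + (l + 4))"
proof -
  define W where "W = {..<n} \<times> {..<n}"
  have W: "finite W" "W \<noteq> {}" using n by (auto simp: W_def)
  \<comment> \<open>The pair of positions is written in unary: the length of the public string does
    not count towards the cost.\<close>
  define enc where "enc = (\<lambda>w. replicate (prod_encode w) True)"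
  define dec where "dec = (\<lambda>r :: bits. prod_decode (length r))"
  have de: "dec (enc w) = w" for w by (simp add: dec_def enc_def)
  define T where "T = insert None (Some ` ({..<n} \<times> (UNIV :: bool set) \<times> (UNIV :: bool set)))"
  have "card T \<le> 1 + card ({..<n} \<times> (UNIV :: bool set) \<times> (UNIV :: bool set))"
    unfolding T_def by (simp add: card_insert_if card_image)
  also have "\<dots> = 1 + 4 * n" by (simp add: card_cartesian_product UNIV_bool)
  also have "\<dots> \<le> 2 ^ (l + 4)" using l n by (simp add: power_add)
  finally have T: "card T \<le> 2 ^ (l + 4)" .
  have "finite T" by (simp add: T_def)
  then obtain be :: "(nat \<times> bool \<times> bool) option \<Rightarrow> bits" and bd where b: "\<And>t. t \<in> T \<Longrightarrow> length (be t) = l + 4" "\<And>t. t \<in> T \<Longrightarrow> bd (be t) = t"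
    using finite_message_code[OF _ T] by metis
  define msg where "msg = (\<lambda>(y, s) (i, j). if s ! i then Some (i, y ! i, True) else if s ! j then Some (j, y ! j, False) else None :: (nat \<times> bool \<times> bool) option)"
  define ref where "ref a m = (case m of None \<Rightarrow> None | Some (i, v, f) \<Rightarrow> Some (i, a ! (if f then 0 else 1), v))" for a :: bits and m :: "(nat \<times> bool \<times> bool) option"
  define A where "A r x = return_pmf (let (i, j) = dec r in [x ! i, x ! j])" for r and x :: bits
  define B where "B r ys = return_pmf (be (msg ys (dec r)))" for r ys
  \<comment> \<open>The referee has to stay within \<open>answers n\<close> on every pair of
    strings, including those that are not codewords.\<close>
  define C where "C a b = return_pmf (if ref a (bd b) \<in> answers n then ref a (bd b) else None)" for a b
  define out where "out x ys w = ref [x ! fst w, x ! snd w] (msg ys w)" for x ys w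
  have mT: "msg ys w \<in> T" if "w \<in> W" for ys w using that by (auto simp: msg_def T_def W_def split: prod.splits)
  have outc: "out x ys w \<in> insert None (correct_answers x ys)" if "x \<in> alice_inputs n" "w \<in> W" for x ys w
    using that by (auto simp: out_def msg_def ref_def W_def alice_inputs_def split: prod.splits)
  have outa: "out x ys w \<in> answers n" if "x \<in> alice_inputs n" "w \<in> W" for x ys w
    using that by (auto simp: out_def msg_def ref_def W_def answers_def split: prod.splits)
  show ?thesis
    unfolding public_protocol_def
  proof (rule exI[of _ "map_pmf enc (pmf_of_set W)"], rule exI[of _ A], rule exI[of _ B], rule exI[of _ C], intro conjI ballI allI)
    let ?R = "map_pmf enc (pmf_of_set W)"
    show "length a + length b \<le> 2 + (l + 4)" if "r \<in> set_pmf ?R" "a \<in> set_pmf (A r x)" "b \<in> set_pmf (B r ys)" for r x ys a b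
    proof -
      have "dec r \<in> W" using that(1) W by (auto simp: de)
      then have "length b = l + 4" using that(3) b(1)[OF mT] by (auto simp: B_def)
      moreover have "length a = 2" using that(2) by (auto simp: A_def split: prod.splits)
      ultimately show ?thesis by simp
    qed
    show "set_pmf (C a b) \<subseteq> answers n" for a b by (auto simp: C_def answers_def)
    show "solves (1 / 3) n (\<lambda>x ys. pmf (public_output ?R A B C x ys))"
    proof (rule solves_uniform[OF W, of _ out])
      fix x ys assume xy: "x \<in> alice_inputs n" "ys \<in> bob_inputs n"
      show "out x ys w \<in> insert None (correct_answers x ys)" if "w \<in> W" for w by (rule outc[OF xy(1) that])
      have "{w \<in> W. out x ys w = None} = {i. i < n \<and> \<not> snd ys ! i} \<times> {i. i < n \<and> \<not> snd ys ! i}"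
        by (auto simp: W_def out_def msg_def ref_def split: prod.splits if_splits)
      then have "card {w \<in> W. out x ys w = None} = card {i. i < n \<and> \<not> snd ys ! i} * card {i. i < n \<and> \<not> snd ys ! i}"
        by (simp add: card_cartesian_product)
      moreover have "card W = (2 * card {i. i < n \<and> \<not> snd ys ! i}) * (2 * card {i. i < n \<and> \<not> snd ys ! i})"
        unfolding card_bad_positions(1)[OF xy(2)] by (simp add: W_def card_cartesian_product)
      ultimately show "3 * card {w \<in> W. out x ys w = None} \<le> card W" by simp
      have "public_output ?R A B C x ys = bind_pmf (pmf_of_set W) (\<lambda>w. private_output (A (enc w)) (B (enc w)) C x ys)"
        by (simp add: public_output_def bind_map_pmf)
      also have "\<dots> = bind_pmf (pmf_of_set W) (\<lambda>w. return_pmf (out x ys w))"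
      proof (rule bind_pmf_cong[OF refl])
        fix w assume "w \<in> set_pmf (pmf_of_set W)"
        then have w: "w \<in> W" using W by simp
        show "private_output (A (enc w)) (B (enc w)) C x ys = return_pmf (out x ys w)"
          using b(2)[OF mT[OF w]] outa[OF xy(1) w, of ys]
          by (simp add: private_output_def A_def B_def C_def bind_return_pmf de out_def case_prod_beta)
      qed
      finally show "public_output ?R A B C x ys = map_pmf (out x ys) (pmf_of_set W)" by (simp add: map_pmf_def)
    qed
  qed
qed

section \<open>Asymptotics\<close>

text \<open>Position \<open>i\<close> is the cell in row \<open>i div m\<close> and column
  \<open>i mod m\<close>, and cells from \<open>n\<close> on stay empty. The \<open>n / 2\<close>
  ones of \<open>s\<close> lie in \<open>m\<close> columns, so some column has at least
  \<open>n / (2 * m)\<close> of them.\<close>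

lemma dense_column:
  assumes n: "n \<le> m * m" "0 < n" and ys: "ys \<in> bob_inputs n"
  shows "\<exists>k<m. n \<le> 2 * m * card {r. r < m \<and> r * m + k < n \<and> snd ys ! (r * m + k)}"
proof (rule ccontr)
  assume "\<not> ?thesis"
  then have small: "2 * m * card {r. r < m \<and> r * m + k < n \<and> snd ys ! (r * m + k)} < n" if "k < m" for k
    using that by force
  let ?g = "\<lambda>i. i < n \<and> snd ys ! i"
  have m: "0 < m" using n by (intro gr0I) auto
  have "(\<Sum>k<m. card {r. r < m \<and> ?g (r * m + k)}) = (\<Sum>k<m. \<Sum>r<m. of_bool (?g (r * m + k)))"
    by (intro sum.cong refl) (auto simp: of_bool_def sum.If_cases intro!: arg_cong[where f = card])
  also have "\<dots> = (\<Sum>r<m. \<Sum>k<m. of_bool (?g (r * m + k)))" by (rule sum.swap)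
  also have "\<dots> = (\<Sum>i<m * m. of_bool (?g (i div m * m + i mod m)))"
    by (rule sum_div_mod[where f = "\<lambda>r k. of_bool (?g (r * m + k))", symmetric])
  also have "\<dots> = (\<Sum>i<m * m. of_bool (?g i))" by simp
  also have "\<dots> = card {i. ?g i}"
    using n by (auto simp: of_bool_def sum.If_cases intro!: arg_cong[where f = card])
  finally have *: "2 * (\<Sum>k<m. card {r. r < m \<and> ?g (r * m + k)}) = n" using card_bad_positions(2)[OF ys] by simp
  have "m * n = (\<Sum>k<m. 2 * m * card {r. r < m \<and> ?g (r * m + k)})"
    unfolding sum_distrib_left[symmetric] using * by (simp add: mult_ac)
  also have "\<dots> < (\<Sum>k<m. n)" using m small by (intro sum_strict_mono) auto
  finally show False by simp
qed

text \<open>Three independent misses of probability at most \<open>2 / 3\<close> leave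
  \<open>8 / 27\<close>, which is below \<open>1 / 3\<close>; two would leave
  \<open>4 / 9\<close>.\<close>

lemma cube_bound:
  fixes b m :: nat
  assumes "3 * b \<le> 2 * m"
  shows "3 * (b * (b * b)) \<le> m * (m * m)"
proof -
  have "(3 * b) * ((3 * b) * (3 * b)) \<le> (2 * m) * ((2 * m) * (2 * m))" by (intro mult_le_mono assms)
  then have "27 * (b * (b * b)) \<le> 8 * (m * (m * m))" by (simp add: mult_ac)
  then show ?thesis by linarith
qed

text \<open>A row and a column always meet in one cell, which replaces the shared coin. The second
  hypothesis makes at least a third of the cells in Bob's densest column usable. Bob also sends that
  column of \<open>s\<close>, which tells the referee which crossings count.\<close>

theorem private_upper_bound:
  assumes n: "n \<le> m * m" "2 * (m * m) \<le> 3 * n" "0 < n"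
  shows "private_protocol (1 / 3) n (6 * m + 3 * m)"
proof -
  have m: "0 < m" using n by (intro gr0I) auto
  define W where "W = {..<m} \<times> {..<m} \<times> {..<m}"
  have W: "finite W" "W \<noteq> {}" using m by (auto simp: W_def)
  let ?X = "alice_inputs m"
  define row where "row x r = map (\<lambda>k. r * m + k < n \<and> x ! (r * m + k)) [0..<m]" for x :: bits and r
  define col where "col y k = map (\<lambda>r. r * m + k < n \<and> y ! (r * m + k)) [0..<m]" for y :: bits and k
  define am where "am x = (\<lambda>(r1, r2, r3). ((r1, r2, r3), (row x r1, row x r2, row x r3)))" for x
  define best where "best s = (SOME k. k < m \<and> n \<le> 2 * m * card {r. r < m \<and> r * m + k < n \<and> s ! (r * m + k)})" for s
  define bm where "bm = (\<lambda>(y, s). (best s, col y (best s), col s (best s)))"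
  define ref where "ref = (\<lambda>((r1, r2, r3), (w1, w2, w3)) (k, u, v).
    if v ! r1 then Some (r1 * m + k, w1 ! k, u ! r1)
    else if v ! r2 then Some (r2 * m + k, w2 ! k, u ! r2)
    else if v ! r3 then Some (r3 * m + k, w3 ! k, u ! r3) else (None :: answer))" for v u w1 w2 w3 :: bits
  have best: "best (snd ys) < m" "n \<le> 2 * m * card {r. r < m \<and> r * m + best (snd ys) < n \<and> snd ys ! (r * m + best (snd ys))}"
    if "ys \<in> bob_inputs n" for ys
    using someI_ex[OF dense_column[OF n(1,3) that]] by (auto simp: best_def)
  define TA where "TA = W \<times> ?X \<times> ?X \<times> ?X"
  define TB where "TB = {..<m} \<times> ?X \<times> ?X"
  \<comment> \<open>Each index below \<open>m\<close> is allotted \<open>m\<close> bits, no more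
    than a row takes anyway: three indices and three rows for Alice, one index and two columns for
    Bob.\<close>
  have m2: "m \<le> 2 ^ m" using less_exp[of m] by simp
  have "card TA = m * m * m * (2 ^ m * 2 ^ m * 2 ^ m)" by (simp add: TA_def W_def card_cartesian_product card_alice_inputs)
  also have "\<dots> \<le> 2 ^ m * 2 ^ m * 2 ^ m * (2 ^ m * 2 ^ m * 2 ^ m)" using m2 by (intro mult_mono) auto
  also have "\<dots> = 2 ^ (6 * m)" by (simp flip: power_add)
  finally have TA: "card TA \<le> 2 ^ (6 * m)" .
  have "card TB = m * (2 ^ m * 2 ^ m)" by (simp add: TB_def card_cartesian_product card_alice_inputs)
  also have "\<dots> \<le> 2 ^ m * (2 ^ m * 2 ^ m)" using m2 by (intro mult_mono) auto
  also have "\<dots> = 2 ^ (3 * m)" by (simp flip: power_add)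
  finally have TB: "card TB \<le> 2 ^ (3 * m)" .
  have fin: "finite TA" "finite TB" using W by (auto simp: TA_def TB_def)
  obtain ae :: "_ \<Rightarrow> bits" and ad where a: "\<And>t. t \<in> TA \<Longrightarrow> length (ae t) = 6 * m" "\<And>t. t \<in> TA \<Longrightarrow> ad (ae t) = t"
    using finite_message_code[OF fin(1) TA] by metis
  obtain be :: "_ \<Rightarrow> bits" and bd where b: "\<And>t. t \<in> TB \<Longrightarrow> length (be t) = 3 * m" "\<And>t. t \<in> TB \<Longrightarrow> bd (be t) = t"
    using finite_message_code[OF fin(2) TB] by metis
  define A where "A x = map_pmf (\<lambda>w. ae (am x w)) (pmf_of_set W)" for x
  define B where "B ys = return_pmf (be (bm ys))" for ys
  define C where "C a b = return_pmf (if ref (ad a) (bd b) \<in> answers n then ref (ad a) (bd b) else None)" for a b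
  define out where "out x ys w = ref (am x w) (bm ys)" for x ys w
  have amT: "am x w \<in> TA" if "w \<in> W" for x w
    using that by (auto simp: am_def TA_def row_def alice_inputs_def split: prod.splits)
  have bmT: "bm ys \<in> TB" if "ys \<in> bob_inputs n" for ys
    using best(1)[OF that] by (auto simp: bm_def TB_def col_def alice_inputs_def split: prod.splits)
  have outc: "out x ys w \<in> insert None (correct_answers x ys)" if "x \<in> alice_inputs n" "ys \<in> bob_inputs n" "w \<in> W" for x ys w
  proof -
    obtain y s where ys: "ys = (y, s)" by (cases ys)
    obtain r1 r2 r3 where w: "w = (r1, r2, r3)" by (cases w)
    have k: "best s < m" using best(1)[OF that(2)] by (simp add: ys)
    have r: "r1 < m" "r2 < m" "r3 < m" using that(3) by (auto simp: w W_def)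
    have hit: "Some (r * m + best s, row x r ! best s, col y (best s) ! r) \<in> correct_answers x (y, s)"
      if "r < m" "col s (best s) ! r" for r
    proof -
      have "r * m + best s < n" "s ! (r * m + best s)" using that by (auto simp: col_def)
      moreover have "row x r ! best s = x ! (r * m + best s)" "col y (best s) ! r = y ! (r * m + best s)"
        using that k calculation by (auto simp: col_def row_def)
      ultimately show ?thesis using \<open>x \<in> alice_inputs n\<close> by (auto simp: alice_inputs_def)
    qed
    show ?thesis
      using hit[OF r(1)] hit[OF r(2)] hit[OF r(3)]
      by (simp add: ys w out_def am_def bm_def ref_def del: correct_answers.simps)
  qed
  have outa: "out x ys w \<in> answers n" if "x \<in> alice_inputs n" "ys \<in> bob_inputs n" "w \<in> W" for x ys w
    using outc[OF that] that(1) by (cases ys) (auto simp: answers_def alice_inputs_def)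
  show ?thesis
    unfolding private_protocol_def
  proof (rule exI[of _ A], rule exI[of _ B], rule exI[of _ C], intro conjI ballI allI)
    show "length a + length b \<le> 6 * m + 3 * m" if "ys \<in> bob_inputs n" "a \<in> set_pmf (A x)" "b \<in> set_pmf (B ys)" for x ys a b
      using that a(1)[OF amT] b(1)[OF bmT] W by (auto simp: A_def B_def)
    show "set_pmf (C a b) \<subseteq> answers n" for a b by (auto simp: C_def answers_def)
    show "solves (1 / 3) n (\<lambda>x ys. pmf (private_output A B C x ys))"
    proof (rule solves_uniform[OF W, of _ out])
      fix x ys assume xy: "x \<in> alice_inputs n" "ys \<in> bob_inputs n"
      show "out x ys w \<in> insert None (correct_answers x ys)" if "w \<in> W" for w by (rule outc[OF xy that])
      let ?k = "best (snd ys)"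
      let ?G = "{r. r < m \<and> r * m + ?k < n \<and> snd ys ! (r * m + ?k)}"
      let ?N = "{..<m} - ?G"
      have "{w \<in> W. out x ys w = None} = ?N \<times> ?N \<times> ?N"
      proof -
        obtain y s where ys: "ys = (y, s)" by (cases ys)
        have "out x ys (r1, r2, r3) = None \<longleftrightarrow> \<not> col s ?k ! r1 \<and> \<not> col s ?k ! r2 \<and> \<not> col s ?k ! r3" for r1 r2 r3
          by (simp add: ys out_def am_def bm_def ref_def)
        moreover define G where "G = ?G"
        have "col s ?k ! r \<longleftrightarrow> r \<in> G" if "r < m" for r using that by (simp add: col_def ys G_def)
        ultimately have "out x ys (r1, r2, r3) = None \<longleftrightarrow> r1 \<notin> G \<and> r2 \<notin> G \<and> r3 \<notin> G"
          if "r1 < m" "r2 < m" "r3 < m" for r1 r2 r3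
          using that by simp
        then show ?thesis unfolding G_def[symmetric] W_def by auto
      qed
      then have "card {w \<in> W. out x ys w = None} = card ?N * (card ?N * card ?N)" by (simp add: card_cartesian_product)
      moreover have "card W = m * (m * m)" by (simp add: W_def card_cartesian_product)
      moreover have "3 * card ?N \<le> 2 * m"
      proof -
        define g where "g = card ?G"
        have "2 * (m * m) \<le> 3 * (2 * m * g)" using n(2) best(2)[OF xy(2)] unfolding g_def by linarith
        then have "m * (2 * m) \<le> m * (6 * card ?G)" unfolding g_def by (simp add: mult_ac)
        then have "2 * m \<le> 6 * card ?G" using m by simp
        moreover have "card ?N = m - card ?G" by (subst card_Diff_subset) auto
        ultimately show ?thesis by linarith
      qed
      ultimately show "3 * card {w \<in> W. out x ys w = None} \<le> card W" by (simp only: cube_bound)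
      have "private_output A B C x ys = bind_pmf (pmf_of_set W) (\<lambda>w. return_pmf (out x ys w))"
        unfolding private_output_def A_def B_def bind_map_pmf bind_return_pmf
      proof (rule bind_pmf_cong[OF refl])
        fix w assume "w \<in> set_pmf (pmf_of_set W)"
        then have w: "w \<in> W" using W by simp
        show "C (ae (am x w)) (be (bm ys)) = return_pmf (out x ys w)"
          using outa[OF xy w] by (simp add: C_def a(2)[OF amT[OF w]] b(2)[OF bmT[OF xy(2)]] out_def)
      qed
      then show "private_output A B C x ys = map_pmf (out x ys) (pmf_of_set W)" by (simp add: map_pmf_def)
    qed
  qed
qed

section \<open>From protocols to minimal costs\<close>

lemma eventually_even_at_top:
  assumes "\<And>n. N \<le> n \<Longrightarrow> even n \<Longrightarrow> P n"
  shows "eventually P even_at_top"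
  unfolding even_at_top_def eventually_inf_principal eventually_at_top_linorder using assms by auto

text \<open>The upper bound comes first because it provides the protocol that makes
  \<open>LEAST\<close> attained; the lower bound is then applied at the least cost. With
  \<open>L = log 2 n\<close>, \<open>16 \<le> n\<close> means \<open>L \<ge> 4\<close>, exactly what
  \<open>(L - 3) / 2 \<ge> L / 8\<close> requires.\<close>

lemma R_par_pub_bounds:
  assumes n: "even n" "16 \<le> n"
  shows "real (R_par_pub (1 / 3) n) \<le> 8 * log 2 (real n)" and "1 / 8 * log 2 (real n) \<le> real (R_par_pub (1 / 3) n)"
proof -
  define l where "l = nat \<lceil>log 2 (real n)\<rceil>"
  have "log 2 16 \<le> log 2 (real n)" using n by (subst log_le_cancel_iff) auto
  moreover have "log 2 16 = (4 :: real)"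
  proof -
    have "log 2 (2 powr 4) = (4 :: real)" by (rule log_powr_cancel) auto
    then show ?thesis by simp
  qed
  ultimately have L: "4 \<le> log 2 (real n)" by simp
  have "log 2 (real n) \<le> real l" unfolding l_def by linarith
  then have "real n \<le> 2 powr real l" using n by (simp add: log_le_iff)
  then have "real n \<le> real (2 ^ l)" by (simp add: powr_realpow)
  then have nl: "n \<le> 2 ^ l" by (simp only: of_nat_le_iff)
  have ex: "public_protocol (1 / 3) n (2 + (l + 4))" using n nl by (intro public_upper_bound) auto
  then have "R_par_pub (1 / 3) n \<le> 2 + (l + 4)" unfolding R_par_pub_def by (rule Least_le)
  moreover have "real l \<le> log 2 (real n) + 1" unfolding l_def using L by linarith
  ultimately show "real (R_par_pub (1 / 3) n) \<le> 8 * log 2 (real n)" using L by linarith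
  have "public_protocol (1 / 3) n (R_par_pub (1 / 3) n)" unfolding R_par_pub_def using ex by (rule LeastI)
  then have "n < 2 ^ (2 * R_par_pub (1 / 3) n + 3)" using n by (intro public_lower_bound) auto
  then have "real n < real (2 ^ (2 * R_par_pub (1 / 3) n + 3))" by (simp only: of_nat_less_iff)
  then have "real n < 2 powr real (2 * R_par_pub (1 / 3) n + 3)" by (subst powr_realpow) auto
  then have "log 2 (real n) < real (2 * R_par_pub (1 / 3) n + 3)" using n by (simp add: log_less_iff)
  then show "1 / 8 * log 2 (real n) \<le> real (R_par_pub (1 / 3) n)" using L by simp
qed

text \<open>The threshold gives \<open>sqrt n \<ge> 1110 = 2 * 555\<close>. The quantum bound at
  cost \<open>2 * Suc R\<close> reads \<open>sqrt n \<le> 222 * R + 555\<close>, so the additive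
  part is at most half of the left side and the slope doubles to 444; likewise 111 doubles to 222
  for \<open>Q_par\<close>.\<close>

lemma private_quantum_bounds:
  assumes n: "even n" "2000000 \<le> n"
  shows "real (R_par (1 / 3) n) \<le> 18 * sqrt (real n)" "1 / 444 * sqrt (real n) \<le> real (R_par (1 / 3) n)"
    "real (Q_par (1 / 3) n) \<le> 38 * sqrt (real n)" "1 / 222 * sqrt (real n) \<le> real (Q_par (1 / 3) n)"
proof -
  define m where "m = nat \<lceil>sqrt (real n)\<rceil>"
  have S: "1110 \<le> sqrt (real n)" using n by (intro real_le_rsqrt) auto
  have m: "sqrt (real n) \<le> real m" "real m \<le> sqrt (real n) + 1" unfolding m_def using S by linarith+
  have SS: "sqrt (real n) * sqrt (real n) = real n" by simp
  have "sqrt (real n) * sqrt (real n) \<le> real m * real m" using m(1) by (intro mult_mono) auto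
  then have "real n \<le> real m * real m" unfolding SS .
  then have nm: "n \<le> m * m" by (simp only: of_nat_mult[symmetric] of_nat_le_iff)
  have "real m * real m \<le> (sqrt (real n) + 1) * (sqrt (real n) + 1)" using m(2) by (intro mult_mono) auto
  also have "\<dots> = real n + 2 * sqrt (real n) + 1" using SS by (simp add: algebra_simps)
  also have "2 * (real n + 2 * sqrt (real n) + 1) \<le> 3 * real n"
  proof -
    have "1110 * sqrt (real n) \<le> sqrt (real n) * sqrt (real n)" using S by (intro mult_right_mono) auto
    then show ?thesis using S SS by simp
  qed
  finally have "2 * (real m * real m) \<le> 3 * real n" by simp
  then have "real (2 * (m * m)) \<le> real (3 * n)" by simp
  then have nm': "2 * (m * m) \<le> 3 * n" by (simp only: of_nat_le_iff)
  have ex: "private_protocol (1 / 3) n (6 * m + 3 * m)" using nm nm' n by (intro private_upper_bound) auto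
  then have "R_par (1 / 3) n \<le> 6 * m + 3 * m" unfolding R_par_def by (rule Least_le)
  then show R: "real (R_par (1 / 3) n) \<le> 18 * sqrt (real n)" using m(2) S by linarith
  have "private_protocol (1 / 3) n (R_par (1 / 3) n)" unfolding R_par_def using ex by (rule LeastI)
  then have qp: "quantum_protocol (1 / 3) n (2 * Suc (R_par (1 / 3) n))" using n by (intro private_to_quantum) auto
  then have "Q_par (1 / 3) n \<le> 2 * Suc (R_par (1 / 3) n)" unfolding Q_par_def by (rule Least_le)
  then have "real (Q_par (1 / 3) n) \<le> real (2 * Suc (R_par (1 / 3) n))" by (simp only: of_nat_le_iff)
  then have "real (Q_par (1 / 3) n) \<le> 2 * real (R_par (1 / 3) n) + 2" by simp
  then show "real (Q_par (1 / 3) n) \<le> 38 * sqrt (real n)" using R S by linarith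
  have "sqrt (real n) \<le> 111 * (real (2 * Suc (R_par (1 / 3) n)) + 3)" using n qp by (intro quantum_lower_bound) auto
  then show "1 / 444 * sqrt (real n) \<le> real (R_par (1 / 3) n)" using S by simp
  have "quantum_protocol (1 / 3) n (Q_par (1 / 3) n)" unfolding Q_par_def using qp by (rule LeastI)
  then have "sqrt (real n) \<le> 111 * (real (Q_par (1 / 3) n) + 3)" using n by (intro quantum_lower_bound) auto
  then show "1 / 222 * sqrt (real n) \<le> real (Q_par (1 / 3) n)" using S by simp
qed

lemma bigtheta_even_at_top:
  fixes f g :: "nat \<Rightarrow> real"
  assumes c: "0 < c" "0 < c'"
    and "\<And>n. N \<le> n \<Longrightarrow> even n \<Longrightarrow> 0 \<le> f n \<and> 0 \<le> g n \<and> f n \<le> c * g n \<and> c' * g n \<le> f n"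
  shows "f \<in> \<Theta>[even_at_top](g)"
proof (rule bigthetaI)
  show "f \<in> O[even_at_top](g)" using assms by (intro landau_o.bigI[OF c(1)] eventually_even_at_top[of N]) auto
  show "f \<in> \<Omega>[even_at_top](g)" using assms by (intro landau_omega.bigI[OF c(2)] eventually_even_at_top[of N]) auto
qed

theorem theorem1:
  shows "(\<lambda>n. real (R_par_pub (1/3) n)) \<in> \<Theta>[even_at_top](\<lambda>n. log 2 (real n)) \<and>
         (\<lambda>n. real (R_par (1/3) n)) \<in> \<Theta>[even_at_top](\<lambda>n. sqrt (real n)) \<and>
         (\<lambda>n. real (Q_par (1/3) n)) \<in> \<Theta>[even_at_top](\<lambda>n. sqrt (real n))"
proof (intro conjI)
  show "(\<lambda>n. real (R_par_pub (1/3) n)) \<in> \<Theta>[even_at_top](\<lambda>n. log 2 (real n))"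
    by (rule bigtheta_even_at_top[of 8 "1 / 8" 16]) (use R_par_pub_bounds in auto)
  show "(\<lambda>n. real (R_par (1/3) n)) \<in> \<Theta>[even_at_top](\<lambda>n. sqrt (real n))"
    by (rule bigtheta_even_at_top[of 18 "1 / 444" 2000000]) (use private_quantum_bounds in auto)
  show "(\<lambda>n. real (Q_par (1/3) n)) \<in> \<Theta>[even_at_top](\<lambda>n. sqrt (real n))"
    by (rule bigtheta_even_at_top[of 38 "1 / 222" 2000000]) (use private_quantum_bounds in auto)
qed

end
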